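(* Let $(G,\pi_G)$ be a connected and simply connected Poisson Lie group acting on a connected and simply connected Poisson manifold $(M,\pi)$ with an infinitesimal momentum map $\alpha$, and suppose that the dual Poisson Lie group $G^*$ is the Heisenberg group. Let $x,y,z$ be the standard basis of $\mathfrak g^*$ (with $z$ central and $[x,y]=z$) and let $\xi,\eta,\zeta$ be the dual basis of $\mathfrak g$. Suppose the Lie algebra structure of $\mathfrak g$ is one of $$[\xi,\eta]=0,\ [\xi,\zeta]=\xi,\ [\eta,\zeta]=\eta\qquad\text{or}\qquad [\xi,\eta]=0,\ [\xi,\zeta]=\eta,\ [\eta,\zeta]=-\xi .$$ Then $$\pi(\alpha_\xi,\alpha_\eta)=c$$ is constant on $M$. The form $\alpha$ lifts to a momentum map $\boldsymbol\mu:M\to G^*$ (a Poisson map with $\boldsymbol\mu^*(\theta_\chi)=\alpha_\chi$ for all $\chi\in\mathfrak g$) if and only if $c=0$. When $c=0$, the set of momentum maps with given $\alpha$ is one dimensional, with a free transitive action of $\mathbb R$.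
   Context: A Poisson Lie group $(G,\pi_G)$ is a Lie group with a multiplicative Poisson bivector; its tangent Lie bialgebra is $(\mathfrak g,\delta)$, $\delta=d_e\pi_G:\mathfrak g\to\wedge^2\mathfrak g$, and the Lie bracket on $\mathfrak g^*$ is given by $\langle[l_1,l_2],\chi\rangle=\langle\delta(\chi),l_1\otimes l_2\rangle$. Here $\delta(\xi)=\delta(\eta)=0$ and $\delta(\zeta)=\xi\wedge\eta$. The dual Poisson Lie group $(G^*,\pi_{G^*})$ is the connected simply connected Poisson Lie group whose tangent Lie bialgebra is $\mathfrak g^*$ with cobracket the transpose of the bracket of $\mathfrak g$. For $\chi\in\mathfrak g=(T_eG^* )^*$, $\theta_\chi$ is the left invariant 1-form on $G^*$ with $\theta_\chi(e)=\chi$; these satisfy the Maurer-Cartan equation $d\theta_\chi+\frac12\theta\wedge\theta\circ\delta(\chi)=0$, where for $\delta(\chi)=\sum_i\chi_i'\otimes\chi_i''$ one writes $\alpha\wedge\alpha\circ\delta(\chi)=\sum_i\alpha_{\chi_i'}\wedge\alpha_{\chi_i''}$. For a Poisson bivector $\pi$: $\beta(\pi^\sharp(\alpha))=\pi(\alpha,\beta)$ and $[\alpha,\beta]_\pi=\mathcal L_{\pi^\sharp(\alpha)}\beta-\mathcal L_{\pi^\sharp(\beta)}\alpha-d(\pi(\alpha,\beta))$ on 1-forms. An infinitesimal momentum map for the action is a linear map $\alpha:\mathfrak g\to\Omega^1(M)$ with $\alpha_{[\chi,\chi']}=[\alpha_\chi,\alpha_{\chi'}]_\pi$ and $d\alpha_\chi+\frac12\alpha\wedge\alpha\circ\delta(\chi)=0$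 for all $\chi,\chi'\in\mathfrak g$, such that the infinitesimal generators of the action, $\chi_M(m)=\frac{d}{dt}|_{t=0}\Phi_{\exp(-t\chi)}(m)$, are $\chi_M=\pi^\sharp(\alpha_\chi)$. *)

theory Defs
  imports "HOL-Analysis.Analysis"
begin

section \<open>Smooth manifolds\<close>

primrec Ck_on :: "nat \<Rightarrow> 'a::euclidean_space set \<Rightarrow> ('a \<Rightarrow> 'b::real_normed_vector) \<Rightarrow> bool" where
  "Ck_on 0 S f \<longleftrightarrow> continuous_on S f"
| "Ck_on (Suc k) S f \<longleftrightarrow>
     (\<exists>f'. (\<forall>x\<in>S. (f has_derivative f' x) (at x)) \<and> (\<forall>v. Ck_on k S (\<lambda>x. f' x v)))"

text \<open>On a set that need not be open, a map is smooth if locally it extends to a smooth map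
  on an open set of the ambient space.\<close>

definition smooth_on :: "'a::euclidean_space set \<Rightarrow> ('a \<Rightarrow> 'b::real_normed_vector) \<Rightarrow> bool" where
  "smooth_on S f \<longleftrightarrow>
     (\<forall>x\<in>S. \<exists>T g. open T \<and> x \<in> T \<and> (\<forall>k. Ck_on k T g) \<and> (\<forall>y\<in>S \<inter> T. f y = g y))"

type_synonym ('m, 'e) atlas = "('m set \<times> ('m \<Rightarrow> 'e)) set"

text \<open>The manifold is the whole type \<open>'m\<close>. Charts take values in a linear subspace \<open>V\<close> of
  \<open>'e\<close>, so the dimension is the dimension of \<open>V\<close>; in particular it may be zero, although
  \<open>'e\<close> itself is never trivial.\<close>

definition smooth_manifold ::
  "('m::{t2_space,second_countable_topology}, 'e::euclidean_space) atlas \<Rightarrow> bool" where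
  "smooth_manifold A \<longleftrightarrow>
     (\<Union>(U, \<phi>)\<in>A. U) = UNIV \<and>
     (\<exists>V. subspace V \<and>
       (\<forall>(U, \<phi>)\<in>A. open U \<and> openin (top_of_set V) (\<phi> ` U) \<and>
          homeomorphism U (\<phi> ` U) \<phi> (inv_into U \<phi>))) \<and>
     (\<forall>(U, \<phi>)\<in>A. \<forall>(W, \<psi>)\<in>A. smooth_on (\<phi> ` (U \<inter> W)) (\<psi> \<circ> inv_into U \<phi>))"

definition euclidean_atlas :: "('e::euclidean_space, 'e) atlas" where
  "euclidean_atlas = {(UNIV, id)}"

definition prod_atlas :: "('m, 'e) atlas \<Rightarrow> ('n, 'f) atlas \<Rightarrow> ('m \<times> 'n, 'e \<times> 'f) atlas" where
  "prod_atlas A B = {(U \<times> W, map_prod \<phi> \<psi>) | U \<phi> W \<psi>. (U, \<phi>) \<in> A \<and> (W, \<psi>) \<in> B}"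

definition smooth_map ::
  "('m::topological_space, 'e::euclidean_space) atlas \<Rightarrow>
   ('n::topological_space, 'f::euclidean_space) atlas \<Rightarrow> ('m \<Rightarrow> 'n) \<Rightarrow> bool" where
  "smooth_map A B F \<longleftrightarrow> continuous_on UNIV F \<and>
     (\<forall>(U, \<phi>)\<in>A. \<forall>(W, \<psi>)\<in>B. smooth_on (\<phi> ` (U \<inter> F -` W)) (\<psi> \<circ> F \<circ> inv_into U \<phi>))"

definition smooth_functions ::
  "('m::topological_space, 'e::euclidean_space) atlas \<Rightarrow> ('m \<Rightarrow> real) set" where
  "smooth_functions A = {f. smooth_map A euclidean_atlas f}"


section \<open>Tangent vectors, vector fields and 1-forms\<close>

type_synonym 'm tvec = "('m \<Rightarrow> real) \<Rightarrow> real"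
type_synonym 'm covec = "'m tvec \<Rightarrow> real"
type_synonym 'm vfield = "'m \<Rightarrow> 'm tvec"
type_synonym 'm form1 = "'m \<Rightarrow> 'm covec"
type_synonym 'm bivec = "'m \<Rightarrow> 'm covec \<Rightarrow> 'm covec \<Rightarrow> real"

text \<open>Linearity on a linear subspace of a space of real functions, for functionals and for
  maps into another space of real functions.\<close>

definition linear_functional_on :: "('a \<Rightarrow> real) set \<Rightarrow> (('a \<Rightarrow> real) \<Rightarrow> real) \<Rightarrow> bool" where
  "linear_functional_on S l \<longleftrightarrow>
     (\<forall>u\<in>S. \<forall>v\<in>S. l (\<lambda>a. u a + v a) = l u + l v) \<and>
     (\<forall>c. \<forall>u\<in>S. l (\<lambda>a. c * u a) = c * l u)"

definition linear_fun_on :: "('a \<Rightarrow> real) set \<Rightarrow> (('a \<Rightarrow> real) \<Rightarrow> ('b \<Rightarrow> real)) \<Rightarrow> bool" where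
  "linear_fun_on S F \<longleftrightarrow>
     (\<forall>u\<in>S. \<forall>v\<in>S. F (\<lambda>a. u a + v a) = (\<lambda>b. F u b + F v b)) \<and>
     (\<forall>c. \<forall>u\<in>S. F (\<lambda>a. c * u a) = (\<lambda>b. c * F u b))"

text \<open>Tangent vectors are derivations of the algebra of smooth functions. They are set to
  \<open>0\<close> on non-smooth functions, and covectors are set to \<open>0\<close> outside the tangent space, so that
  equality of tangent vectors and of covectors is equality of functions.\<close>

definition tangent_space ::
  "('m::topological_space, 'e::euclidean_space) atlas \<Rightarrow> 'm \<Rightarrow> 'm tvec set" where
  "tangent_space A p = {v. linear_functional_on (smooth_functions A) v \<and>
     (\<forall>f\<in>smooth_functions A. \<forall>g\<in>smooth_functions A. v (\<lambda>q. f q * g q) = f p * v g + v f * g p) \<and>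
     (\<forall>f. f \<notin> smooth_functions A \<longrightarrow> v f = 0)}"

definition cotangent_space ::
  "('m::topological_space, 'e::euclidean_space) atlas \<Rightarrow> 'm \<Rightarrow> 'm covec set" where
  "cotangent_space A p = {a. linear_functional_on (tangent_space A p) a \<and>
     (\<forall>v. v \<notin> tangent_space A p \<longrightarrow> a v = 0)}"

definition vector_field ::
  "('m::topological_space, 'e::euclidean_space) atlas \<Rightarrow> 'm vfield \<Rightarrow> bool" where
  "vector_field A X \<longleftrightarrow> (\<forall>p. X p \<in> tangent_space A p) \<and>
     (\<forall>f\<in>smooth_functions A. (\<lambda>p. X p f) \<in> smooth_functions A)"

definition one_form ::
  "('m::topological_space, 'e::euclidean_space) atlas \<Rightarrow> 'm form1 \<Rightarrow> bool" where
  "one_form A \<beta> \<longleftrightarrow> (\<forall>p. \<beta> p \<in> cotangent_space A p) \<and>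
     (\<forall>X. vector_field A X \<longrightarrow> (\<lambda>p. \<beta> p (X p)) \<in> smooth_functions A)"

definition vf_bracket :: "'m vfield \<Rightarrow> 'm vfield \<Rightarrow> 'm vfield" where
  "vf_bracket X Y = (\<lambda>p f. X p (\<lambda>q. Y q f) - Y p (\<lambda>q. X q f))"

definition dfun ::
  "('m::topological_space, 'e::euclidean_space) atlas \<Rightarrow> ('m \<Rightarrow> real) \<Rightarrow> 'm form1" where
  "dfun A f = (\<lambda>p v. if v \<in> tangent_space A p then v f else 0)"

text \<open>Forms are evaluated on vector fields: the exterior derivative is normalised by
  \<open>d\<beta>(X, Y) = X(\<beta>(Y)) - Y(\<beta>(X)) - \<beta>([X, Y])\<close>, the wedge product by
  \<open>(\<beta> \<and> \<gamma>)(X, Y) = \<beta>(X) \<gamma>(Y) - \<beta>(Y) \<gamma>(X)\<close>.\<close>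

definition ext_deriv :: "'m form1 \<Rightarrow> 'm vfield \<Rightarrow> 'm vfield \<Rightarrow> 'm \<Rightarrow> real" where
  "ext_deriv \<beta> X Y =
     (\<lambda>p. X p (\<lambda>q. \<beta> q (Y q)) - Y p (\<lambda>q. \<beta> q (X q)) - \<beta> p (vf_bracket X Y p))"

definition wedge :: "'m form1 \<Rightarrow> 'm form1 \<Rightarrow> 'm vfield \<Rightarrow> 'm vfield \<Rightarrow> 'm \<Rightarrow> real" where
  "wedge \<beta> \<gamma> X Y = (\<lambda>p. \<beta> p (X p) * \<gamma> p (Y p) - \<beta> p (Y p) * \<gamma> p (X p))"

definition lie_deriv :: "'m vfield \<Rightarrow> 'm form1 \<Rightarrow> 'm vfield \<Rightarrow> 'm \<Rightarrow> real" where
  "lie_deriv X \<beta> Y = (\<lambda>p. X p (\<lambda>q. \<beta> q (Y q)) - \<beta> p (vf_bracket X Y p))"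

definition push ::
  "('n::topological_space, 'f::euclidean_space) atlas \<Rightarrow> ('m \<Rightarrow> 'n) \<Rightarrow> 'm tvec \<Rightarrow> 'n tvec" where
  "push B F v = (\<lambda>f. if f \<in> smooth_functions B then v (f \<circ> F) else 0)"

definition cot_pull ::
  "('m::topological_space, 'e::euclidean_space) atlas \<Rightarrow>
   ('n::topological_space, 'f::euclidean_space) atlas \<Rightarrow> ('m \<Rightarrow> 'n) \<Rightarrow> 'm \<Rightarrow> 'n covec \<Rightarrow> 'm covec" where
  "cot_pull A B F p a = (\<lambda>v. if v \<in> tangent_space A p then a (push B F v) else 0)"

definition form_pull ::
  "('m::topological_space, 'e::euclidean_space) atlas \<Rightarrow>
   ('n::topological_space, 'f::euclidean_space) atlas \<Rightarrow> ('m \<Rightarrow> 'n) \<Rightarrow> 'n form1 \<Rightarrow> 'm form1" where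
  "form_pull A B F \<beta> = (\<lambda>p. cot_pull A B F p (\<beta> (F p)))"


section \<open>Poisson manifolds\<close>

record ('m, 'e) poisson_space =
  atlas :: "('m, 'e) atlas"
  bivector :: "'m bivec"

definition bivector_field ::
  "('m::topological_space, 'e::euclidean_space) atlas \<Rightarrow> 'm bivec \<Rightarrow> bool" where
  "bivector_field A \<pi> \<longleftrightarrow>
     (\<forall>p. \<forall>b\<in>cotangent_space A p. linear_functional_on (cotangent_space A p) (\<lambda>a. \<pi> p a b)) \<and>
     (\<forall>p. \<forall>a\<in>cotangent_space A p. \<forall>b\<in>cotangent_space A p. \<pi> p a b = - \<pi> p b a) \<and>
     (\<forall>\<beta> \<gamma>. one_form A \<beta> \<and> one_form A \<gamma> \<longrightarrow> (\<lambda>p. \<pi> p (\<beta> p) (\<gamma> p)) \<in> smooth_functions A)"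

definition poisson_bracket ::
  "('m::topological_space, 'e::euclidean_space, 'z) poisson_space_scheme \<Rightarrow>
   ('m \<Rightarrow> real) \<Rightarrow> ('m \<Rightarrow> real) \<Rightarrow> 'm \<Rightarrow> real" where
  "poisson_bracket M f g = (\<lambda>p. bivector M p (dfun (atlas M) f p) (dfun (atlas M) g p))"

definition poisson_manifold ::
  "('m::{t2_space,second_countable_topology}, 'e::euclidean_space, 'z) poisson_space_scheme \<Rightarrow> bool"
  where
  "poisson_manifold M \<longleftrightarrow> smooth_manifold (atlas M) \<and> bivector_field (atlas M) (bivector M) \<and>
     (\<forall>f\<in>smooth_functions (atlas M). \<forall>g\<in>smooth_functions (atlas M). \<forall>h\<in>smooth_functions (atlas M).
        \<forall>p. poisson_bracket M f (poisson_bracket M g h) p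
          + poisson_bracket M g (poisson_bracket M h f) p
          + poisson_bracket M h (poisson_bracket M f g) p = 0)"

definition poisson_map ::
  "('m::topological_space, 'e::euclidean_space, 'y) poisson_space_scheme \<Rightarrow>
   ('n::topological_space, 'f::euclidean_space, 'z) poisson_space_scheme \<Rightarrow> ('m \<Rightarrow> 'n) \<Rightarrow> bool" where
  "poisson_map M N F \<longleftrightarrow> smooth_map (atlas M) (atlas N) F \<and>
     (\<forall>f\<in>smooth_functions (atlas N). \<forall>g\<in>smooth_functions (atlas N).
        poisson_bracket M (f \<circ> F) (g \<circ> F) = poisson_bracket N f g \<circ> F)"

definition sharp ::
  "('m::topological_space, 'e::euclidean_space, 'z) poisson_space_scheme \<Rightarrow> 'm form1 \<Rightarrow> 'm vfield"
  where
  "sharp M \<beta> = (\<lambda>p. THE v. v \<in> tangent_space (atlas M) p \<and>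
     (\<forall>b\<in>cotangent_space (atlas M) p. b v = bivector M p (\<beta> p) b))"

definition form_bracket ::
  "('m::topological_space, 'e::euclidean_space, 'z) poisson_space_scheme \<Rightarrow>
   'm form1 \<Rightarrow> 'm form1 \<Rightarrow> 'm vfield \<Rightarrow> 'm \<Rightarrow> real" where
  "form_bracket M \<beta> \<gamma> X = (\<lambda>p. lie_deriv (sharp M \<beta>) \<gamma> X p - lie_deriv (sharp M \<gamma>) \<beta> X p
     - X p (\<lambda>q. bivector M q (\<beta> q) (\<gamma> q)))"


section \<open>Poisson Lie groups and their duals\<close>

record ('g, 'e) poisson_group = "('g, 'e) poisson_space" +
  gmult :: "'g \<Rightarrow> 'g \<Rightarrow> 'g"
  gone :: "'g"
  ginv :: "'g \<Rightarrow> 'g"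

definition lie_group ::
  "('g::{t2_space,second_countable_topology}, 'e::euclidean_space) poisson_group \<Rightarrow> bool" where
  "lie_group G \<longleftrightarrow> smooth_manifold (atlas G) \<and> group (gmult G) (gone G) (ginv G) \<and>
     smooth_map (prod_atlas (atlas G) (atlas G)) (atlas G) (\<lambda>(g, h). gmult G g h) \<and>
     smooth_map (atlas G) (atlas G) (ginv G)"

text \<open>Multiplicativity: \<open>\<pi>(gh) = (L\<^sub>g)\<^sub>* \<pi>(h) + (R\<^sub>h)\<^sub>* \<pi>(g)\<close>, evaluated on covectors at \<open>gh\<close>.\<close>

definition multiplicative ::
  "('g::topological_space, 'e::euclidean_space) poisson_group \<Rightarrow> bool" where
  "multiplicative G \<longleftrightarrow>
     (\<forall>g h. \<forall>a\<in>cotangent_space (atlas G) (gmult G g h). \<forall>b\<in>cotangent_space (atlas G) (gmult G g h).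
        bivector G (gmult G g h) a b =
          bivector G h (cot_pull (atlas G) (atlas G) (gmult G g) h a)
                       (cot_pull (atlas G) (atlas G) (gmult G g) h b)
        + bivector G g (cot_pull (atlas G) (atlas G) (\<lambda>k. gmult G k h) g a)
                       (cot_pull (atlas G) (atlas G) (\<lambda>k. gmult G k h) g b))"

definition poisson_lie_group ::
  "('g::{t2_space,second_countable_topology}, 'e::euclidean_space) poisson_group \<Rightarrow> bool" where
  "poisson_lie_group G \<longleftrightarrow> lie_group G \<and> poisson_manifold G \<and> multiplicative G"

definition lie_algebra ::
  "('g::topological_space, 'e::euclidean_space) poisson_group \<Rightarrow> 'g tvec set" where
  "lie_algebra G = tangent_space (atlas G) (gone G)"

definition lie_coalgebra ::
  "('g::topological_space, 'e::euclidean_space) poisson_group \<Rightarrow> 'g covec set" where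
  "lie_coalgebra G = cotangent_space (atlas G) (gone G)"

definition left_field ::
  "('g::topological_space, 'e::euclidean_space) poisson_group \<Rightarrow> 'g tvec \<Rightarrow> 'g vfield" where
  "left_field G v = (\<lambda>g. push (atlas G) (gmult G g) v)"

definition left_form ::
  "('g::topological_space, 'e::euclidean_space) poisson_group \<Rightarrow> 'g covec \<Rightarrow> 'g form1" where
  "left_form G a = (\<lambda>g. cot_pull (atlas G) (atlas G) (gmult G (ginv G g)) g a)"

definition lie_bracket ::
  "('g::topological_space, 'e::euclidean_space) poisson_group \<Rightarrow> 'g tvec \<Rightarrow> 'g tvec \<Rightarrow> 'g tvec" where
  "lie_bracket G v w = vf_bracket (left_field G v) (left_field G w) (gone G)"

text \<open>\<open>cobracket G \<kappa> a b\<close> is \<open>\<langle>\<delta>(\<kappa>), a \<otimes> b\<rangle>\<close> for \<open>\<delta> = d\<^sub>e \<pi>\<close>. Since a multiplicative \<open>\<pi>\<close>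
  vanishes at the unit, the derivative at the unit does not depend on how the covectors \<open>a\<close>
  and \<open>b\<close> are extended to 1-forms.\<close>

definition cobracket ::
  "('g::topological_space, 'e::euclidean_space) poisson_group \<Rightarrow>
   'g tvec \<Rightarrow> 'g covec \<Rightarrow> 'g covec \<Rightarrow> real" where
  "cobracket G \<kappa> a b = \<kappa> (\<lambda>g. bivector G g (left_form G a g) (left_form G b g))"

text \<open>\<open>D\<close> identifies the Lie algebra of \<open>G\<close> with the dual of the Lie algebra of \<open>H\<close>. Under the
  pairing \<open>\<langle>\<kappa>, l\<rangle> = D \<kappa> l\<close> the bracket of \<open>H\<close> is the transpose of the cobracket of \<open>G\<close>, and the
  cobracket of \<open>H\<close> is the transpose of the bracket of \<open>G\<close>.\<close>

definition dual_covec ::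
  "('g::topological_space, 'e::euclidean_space) poisson_group \<Rightarrow>
   ('g tvec \<Rightarrow> 'h covec) \<Rightarrow> 'h tvec \<Rightarrow> 'g covec" where
  "dual_covec G D l = (\<lambda>\<kappa>. if \<kappa> \<in> lie_algebra G then D \<kappa> l else 0)"

definition dual_poisson_lie_group ::
  "('g::{t2_space,second_countable_topology}, 'e::euclidean_space) poisson_group \<Rightarrow>
   ('h::{t2_space,second_countable_topology}, 'f::euclidean_space) poisson_group \<Rightarrow>
   ('g tvec \<Rightarrow> 'h covec) \<Rightarrow> bool" where
  "dual_poisson_lie_group G H D \<longleftrightarrow>
     poisson_lie_group H \<and> connected (UNIV :: 'h set) \<and> simply_connected (UNIV :: 'h set) \<and>
     bij_betw D (lie_algebra G) (lie_coalgebra H) \<and> linear_fun_on (lie_algebra G) D \<and>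
     (\<forall>l1\<in>lie_algebra H. \<forall>l2\<in>lie_algebra H. \<forall>\<kappa>\<in>lie_algebra G.
        D \<kappa> (lie_bracket H l1 l2) = cobracket G \<kappa> (dual_covec G D l1) (dual_covec G D l2)) \<and>
     (\<forall>\<kappa>1\<in>lie_algebra G. \<forall>\<kappa>2\<in>lie_algebra G. \<forall>l\<in>lie_algebra H.
        D (lie_bracket G \<kappa>1 \<kappa>2) l = cobracket H l (D \<kappa>1) (D \<kappa>2))"


section \<open>Actions and momentum maps\<close>

definition lie_group_action ::
  "('g::topological_space, 'e::euclidean_space) poisson_group \<Rightarrow>
   ('m::topological_space, 'f::euclidean_space) poisson_space \<Rightarrow> ('g \<Rightarrow> 'm \<Rightarrow> 'm) \<Rightarrow> bool" where
  "lie_group_action G M \<Phi> \<longleftrightarrow>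
     smooth_map (prod_atlas (atlas G) (atlas M)) (atlas M) (\<lambda>(g, m). \<Phi> g m) \<and>
     (\<forall>m. \<Phi> (gone G) m = m) \<and> (\<forall>g h m. \<Phi> (gmult G g h) m = \<Phi> g (\<Phi> h m))"

definition one_parameter_subgroup ::
  "('g::topological_space, 'e::euclidean_space) poisson_group \<Rightarrow>
   'g tvec \<Rightarrow> (real \<Rightarrow> 'g) \<Rightarrow> bool" where
  "one_parameter_subgroup G \<kappa> \<gamma> \<longleftrightarrow>
     smooth_map euclidean_atlas (atlas G) \<gamma> \<and>
     (\<forall>s t. \<gamma> (s + t) = gmult G (\<gamma> s) (\<gamma> t)) \<and>
     (\<forall>f\<in>smooth_functions (atlas G). ((\<lambda>t. f (\<gamma> t)) has_real_derivative \<kappa> f) (at 0))"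

definition lie_exp ::
  "('g::topological_space, 'e::euclidean_space) poisson_group \<Rightarrow> 'g tvec \<Rightarrow> 'g" where
  "lie_exp G \<kappa> = (THE \<gamma>. one_parameter_subgroup G \<kappa> \<gamma>) 1"

definition infinitesimal_generator ::
  "('g::topological_space, 'e::euclidean_space) poisson_group \<Rightarrow>
   ('m::topological_space, 'f::euclidean_space) poisson_space \<Rightarrow> ('g \<Rightarrow> 'm \<Rightarrow> 'm) \<Rightarrow>
   'g tvec \<Rightarrow> 'm vfield \<Rightarrow> bool" where
  "infinitesimal_generator G M \<Phi> \<kappa> X \<longleftrightarrow> (\<forall>m. \<forall>f\<in>smooth_functions (atlas M).
     ((\<lambda>t. f (\<Phi> (lie_exp G (\<lambda>h. - t * \<kappa> h)) m)) has_real_derivative X m f) (at 0))"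

text \<open>A list of pairs \<open>(\<kappa>'\<^sub>i, \<kappa>''\<^sub>i)\<close> with \<open>\<delta>(\<kappa>) = \<Sum>\<^sub>i \<kappa>'\<^sub>i \<otimes> \<kappa>''\<^sub>i\<close>.\<close>

definition represents_cobracket ::
  "('g::topological_space, 'e::euclidean_space) poisson_group \<Rightarrow>
   'g tvec \<Rightarrow> ('g tvec \<times> 'g tvec) list \<Rightarrow> bool" where
  "represents_cobracket G \<kappa> ps \<longleftrightarrow> set ps \<subseteq> lie_algebra G \<times> lie_algebra G \<and>
     (\<forall>a\<in>lie_coalgebra G. \<forall>b\<in>lie_coalgebra G.
        cobracket G \<kappa> a b = (\<Sum>(\<kappa>1, \<kappa>2)\<leftarrow>ps. a \<kappa>1 * b \<kappa>2))"

definition infinitesimal_momentum_map ::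
  "('g::topological_space, 'e::euclidean_space) poisson_group \<Rightarrow>
   ('m::topological_space, 'f::euclidean_space) poisson_space \<Rightarrow> ('g \<Rightarrow> 'm \<Rightarrow> 'm) \<Rightarrow>
   ('g tvec \<Rightarrow> 'm form1) \<Rightarrow> bool" where
  "infinitesimal_momentum_map G M \<Phi> \<alpha> \<longleftrightarrow>
     (\<forall>\<kappa>\<in>lie_algebra G. one_form (atlas M) (\<alpha> \<kappa>)) \<and>
     (\<forall>m. linear_fun_on (lie_algebra G) (\<lambda>\<kappa>. \<alpha> \<kappa> m)) \<and>
     (\<forall>\<kappa>1\<in>lie_algebra G. \<forall>\<kappa>2\<in>lie_algebra G. \<forall>X. vector_field (atlas M) X \<longrightarrow>
        (\<forall>m. \<alpha> (lie_bracket G \<kappa>1 \<kappa>2) m (X m) = form_bracket M (\<alpha> \<kappa>1) (\<alpha> \<kappa>2) X m)) \<and>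
     (\<forall>\<kappa>\<in>lie_algebra G. \<forall>ps. represents_cobracket G \<kappa> ps \<longrightarrow>
        (\<forall>X Y. vector_field (atlas M) X \<and> vector_field (atlas M) Y \<longrightarrow>
          (\<forall>m. ext_deriv (\<alpha> \<kappa>) X Y m + 1/2 * (\<Sum>(\<kappa>1, \<kappa>2)\<leftarrow>ps. wedge (\<alpha> \<kappa>1) (\<alpha> \<kappa>2) X Y m) = 0))) \<and>
     (\<forall>\<kappa>\<in>lie_algebra G. infinitesimal_generator G M \<Phi> \<kappa> (sharp M (\<alpha> \<kappa>)))"

definition momentum_maps ::
  "('g::topological_space, 'e::euclidean_space) poisson_group \<Rightarrow>
   ('h::topological_space, 'k::euclidean_space) poisson_group \<Rightarrow> ('g tvec \<Rightarrow> 'h covec) \<Rightarrow>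
   ('m::topological_space, 'f::euclidean_space) poisson_space \<Rightarrow>
   ('g tvec \<Rightarrow> 'm form1) \<Rightarrow> ('m \<Rightarrow> 'h) set" where
  "momentum_maps G H D M \<alpha> = {\<mu>. poisson_map M H \<mu> \<and>
     (\<forall>\<kappa>\<in>lie_algebra G. form_pull (atlas M) (atlas H) \<mu> (left_form H (D \<kappa>)) = \<alpha> \<kappa>)}"

text \<open>A free and transitive action of the additive group of reals on a set of maps \<open>M \<rightarrow> H\<close>,
  smooth in the sense that \<open>(t, m) \<mapsto> (t \<cdot> \<mu>)(m)\<close> is smooth, and such that the orbit maps are
  homeomorphisms from the real line to the set for the topology of pointwise convergence
  (the topology of the function type); so the set is one-dimensional.\<close>

definition simply_transitive_real_action ::
  "('m::topological_space, 'f::euclidean_space) poisson_space \<Rightarrow>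
   ('h::topological_space, 'k::euclidean_space) poisson_group \<Rightarrow> ('m \<Rightarrow> 'h) set \<Rightarrow>
   (real \<Rightarrow> ('m \<Rightarrow> 'h) \<Rightarrow> ('m \<Rightarrow> 'h)) \<Rightarrow> bool" where
  "simply_transitive_real_action M H S \<sigma> \<longleftrightarrow>
     (\<forall>\<mu>\<in>S. \<forall>t. \<sigma> t \<mu> \<in> S) \<and>
     (\<forall>\<mu>\<in>S. \<sigma> 0 \<mu> = \<mu>) \<and> (\<forall>\<mu>\<in>S. \<forall>s t. \<sigma> (s + t) \<mu> = \<sigma> s (\<sigma> t \<mu>)) \<and>
     (\<forall>\<mu>\<in>S. \<forall>t. \<sigma> t \<mu> = \<mu> \<longrightarrow> t = 0) \<and>
     (\<forall>\<mu>\<in>S. \<forall>\<nu>\<in>S. \<exists>t. \<sigma> t \<mu> = \<nu>) \<and>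
     (\<forall>\<mu>\<in>S. smooth_map (prod_atlas euclidean_atlas (atlas M)) (atlas H) (\<lambda>(t, m). \<sigma> t \<mu> m)) \<and>
     (\<forall>\<mu>\<in>S. \<exists>\<rho>. homeomorphism UNIV S (\<lambda>t. \<sigma> t \<mu>) \<rho>)"


section \<open>The Heisenberg group\<close>

text \<open>The triple \<open>(a, b, c)\<close> stands for the upper unitriangular 3 by 3 matrix with
  superdiagonal entries \<open>a\<close>, \<open>b\<close> and corner entry \<open>c\<close>.\<close>

type_synonym heis = "real \<times> real \<times> real"

definition heisenberg_group :: "heis bivec \<Rightarrow> (heis, heis) poisson_group" where
  "heisenberg_group \<pi> =
     \<lparr> atlas = euclidean_atlas,
       bivector = \<pi>,
       gmult = (\<lambda>(a, b, c) (a', b', c'). (a + a', b + b', c + c' + a * b')),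
       gone = (0, 0, 0),
       ginv = (\<lambda>(a, b, c). (- a, - b, a * b - c)) \<rparr>"

definition heis_tangent :: "heis \<Rightarrow> heis tvec" where
  "heis_tangent v = (\<lambda>f. if f \<in> smooth_functions euclidean_atlas
     then frechet_derivative f (at (0, 0, 0)) v else 0)"

definition heis_x :: "heis tvec" where "heis_x = heis_tangent (1, 0, 0)"
definition heis_y :: "heis tvec" where "heis_y = heis_tangent (0, 1, 0)"
definition heis_z :: "heis tvec" where "heis_z = heis_tangent (0, 0, 1)"

end

(*
  By duality delta(xi) = delta(eta) = 0 and delta(zeta) = xi wedge eta, so alpha_xi and alpha_eta are
  closed and d alpha_zeta = - alpha_xi wedge alpha_eta. For 1-forms,
    [beta, gamma]_pi(X) = X(pi(beta, gamma)) + d gamma(pi#(beta), X) - d beta(pi#(gamma), X).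
  Hence d(pi(alpha_xi, alpha_eta)) = alpha_[xi,eta] = 0, which gives the constant c, and
    d(pi(alpha_xi, alpha_zeta)) = alpha_[xi,zeta] - c alpha_xi,
    d(pi(alpha_eta, alpha_zeta)) = alpha_[eta,zeta] - c alpha_eta.

  Write mu = (mu1, mu2, mu3) and let theta_i be the left invariant forms da, db, dc - a db.
  Multiplicativity of pi_H makes P12 = pi_H(theta_1, theta_2) a homomorphism with derivative 0 at
  the unit, so P12 = 0; then pi_H(theta_1, theta_3) and pi_H(theta_2, theta_3) are homomorphisms
  too, namely a and b (first bracket) or b and -a (second bracket). The map mu is Poisson iff the
  functions pi(alpha_i, alpha_j) are the pull-backs of the P_ij. This forces c = 0, and for c = 0 it
  determines mu1 and mu2 as, up to sign, the functions pi(alpha_xi, alpha_zeta) and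
  pi(alpha_eta, alpha_zeta), whose differentials are then alpha_xi and alpha_eta. What remains is
  d mu3 = alpha_zeta + mu1 alpha_eta, a closed form, which has a primitive on the simply connected M,
  unique up to an additive constant: the central one-parameter group acts simply transitively.
*)
theory Submission
  imports Defs
begin

section \<open>Smooth functions on open sets\<close>

text \<open>Tangent vectors are derivations of the algebra of globally smooth functions, and charts
  take values in a linear subspace of the ambient space. Two bridges lead from there to ordinary
  calculus: a linear projection onto the model space makes chart expressions smooth on open sets,
  and bump functions with Hadamard's lemma show that every derivation is a directional derivative in
  a chart.

  The two brackets of g can share one argument because ad zeta is invertible on the span of xi and
  eta: the values of P13 and P23 at g determine the first two coordinates of g linearly, whichever
  of the brackets is given.

  The primitive for mu3 comes from monodromy. Local primitives are continued over a square by a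
  Lebesgue number argument, and a null homotopy of a loop then shows that its period
  vanishes.\<close>

lemma Ck_on_subset: "Ck_on k S f \<Longrightarrow> T \<subseteq> S \<Longrightarrow> Ck_on k T f"
proof (induction k arbitrary: f)
  case 0
  then show ?case by (auto intro: continuous_on_subset)
next
  case (Suc k)
  then obtain f' where "\<forall>x\<in>S. (f has_derivative f' x) (at x)" "\<forall>v. Ck_on k S (\<lambda>x. f' x v)"
    by auto
  with Suc show ?case by (auto intro!: exI[of _ f'])
qed

lemma Ck_on_cong:
  assumes "open S" "\<And>x. x \<in> S \<Longrightarrow> f x = g x" "Ck_on k S f"
  shows "Ck_on k S g"
proof (cases k)
  case 0
  with assms show ?thesis by (simp cong: continuous_on_cong)
next
  case (Suc k')
  then obtain f' where f': "\<forall>x\<in>S. (f has_derivative f' x) (at x)" "\<forall>v. Ck_on k' S (\<lambda>x. f' x v)"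
    using assms by auto
  have "\<forall>x\<in>S. (g has_derivative f' x) (at x)"
    using f'(1) assms(1,2) by (metis has_derivative_transform_within_open)
  with f' Suc show ?thesis by auto
qed

text \<open>\<open>Ck_on\<close> hides its derivative behind an existential quantifier; uniqueness
  of derivatives moves the regularity to whichever derivative is at hand.\<close>

lemma Ck_on_Suc_derivative:
  assumes "open S" "Ck_on (Suc k) S f" "\<And>x. x \<in> S \<Longrightarrow> (f has_derivative f' x) (at x)"
  shows "Ck_on k S (\<lambda>x. f' x v)"
proof -
  obtain g where g: "\<forall>x\<in>S. (f has_derivative g x) (at x)" "\<forall>v. Ck_on k S (\<lambda>x. g x v)"
    using assms by auto
  have "\<And>x. x \<in> S \<Longrightarrow> g x v = f' x v"
    using g(1) assms(3) has_derivative_unique by metis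
  then show ?thesis using Ck_on_cong[of S "\<lambda>x. g x v" "\<lambda>x. f' x v"] g(2) assms(1) by blast
qed

lemma Ck_on_lower: "Ck_on (Suc k) S f \<Longrightarrow> Ck_on k S f"
proof (induction k arbitrary: f)
  case 0
  then show ?case
    by (auto intro!: continuous_at_imp_continuous_on dest: has_derivative_continuous)
next
  case (Suc k)
  then obtain f' where "\<forall>x\<in>S. (f has_derivative f' x) (at x)" "\<forall>v. Ck_on (Suc k) S (\<lambda>x. f' x v)"
    by (metis Ck_on.simps(2))
  with Suc.IH show ?case by auto
qed

lemma Ck_on_local:
  "(\<And>x. x \<in> S \<Longrightarrow> \<exists>T. open T \<and> x \<in> T \<and> Ck_on k T f) \<Longrightarrow> Ck_on k S f"
proof (induction k arbitrary: f)
  case 0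
  have "isCont f x" if "x \<in> S" for x
    using 0[OF that] by (auto simp: continuous_on_eq_continuous_at)
  then show ?case by (simp add: continuous_at_imp_continuous_on)
next
  case (Suc k)
  have *: "\<exists>T. open T \<and> x \<in> T \<and> (\<forall>y\<in>T. (f has_derivative frechet_derivative f (at y)) (at y)) \<and>
      (\<forall>v. Ck_on k T (\<lambda>y. frechet_derivative f (at y) v))" if x: "x \<in> S" for x
  proof -
    obtain T where T: "open T" "x \<in> T" "Ck_on (Suc k) T f" using Suc.prems[OF x] by blast
    then have d: "(f has_derivative frechet_derivative f (at y)) (at y)" if "y \<in> T" for y
      using that by (auto simp: frechet_derivative_works[symmetric] differentiable_def)
    then show ?thesis using T Ck_on_Suc_derivative[OF T(1,3) d] by blast
  qed
  show ?case unfolding Ck_on.simps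
  \<comment> \<open>The derivatives on the various neighbourhoods have to come from one function;
    \<open>frechet_derivative\<close> is a choice that does not depend on the neighbourhood.\<close>
  proof (intro exI[of _ "\<lambda>y. frechet_derivative f (at y)"] conjI allI ballI)
    show "(f has_derivative frechet_derivative f (at x)) (at x)" if "x \<in> S" for x
      using *[OF that] by blast
    show "Ck_on k S (\<lambda>x. frechet_derivative f (at x) v)" for v
      by (rule Suc.IH) (use * in blast)
  qed
qed

lemma Ck_on_const: "Ck_on k S (\<lambda>x. c)"
proof (induction k arbitrary: c)
  case (Suc k)
  then show ?case by (auto intro!: exI[of _ "\<lambda>_ _. 0"])
qed auto

lemma Ck_on_bounded_linear: "bounded_linear L \<Longrightarrow> Ck_on k S L"
proof (cases k)
  case 0
  then show "bounded_linear L \<Longrightarrow> ?thesis" by (simp add: linear_continuous_on)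
next
  case (Suc k')
  then show "bounded_linear L \<Longrightarrow> ?thesis"
    by (auto intro!: exI[of _ "\<lambda>_. L"] bounded_linear_imp_has_derivative Ck_on_const)
qed

lemma Ck_on_linear_comp:
  assumes "bounded_linear L"
  shows "Ck_on k S f \<Longrightarrow> Ck_on k S (\<lambda>x. L (f x))"
proof (induction k arbitrary: f)
  case 0
  then show ?case using assms by (simp add: bounded_linear.continuous_on)
next
  case (Suc k)
  then obtain f' where f': "\<forall>x\<in>S. (f has_derivative f' x) (at x)" "\<forall>v. Ck_on k S (\<lambda>x. f' x v)"
    by auto
  show ?case unfolding Ck_on.simps
  proof (intro exI[of _ "\<lambda>x v. L (f' x v)"] conjI ballI allI)
    show "((\<lambda>x. L (f x)) has_derivative (\<lambda>v. L (f' x v))) (at x)" if "x \<in> S" for x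
      using bounded_linear.has_derivative[OF assms] f'(1) that by blast
    show "Ck_on k S (\<lambda>x. L (f' x v))" for v using f'(2) Suc.IH by blast
  qed
qed

lemma Ck_on_add: "Ck_on k S f \<Longrightarrow> Ck_on k S g \<Longrightarrow> Ck_on k S (\<lambda>x. f x + g x)"
proof (induction k arbitrary: f g)
  case 0
  then show ?case by (auto intro: continuous_intros)
next
  case (Suc k)
  then obtain f' g' where
    "\<forall>x\<in>S. (f has_derivative f' x) (at x)" "\<forall>v. Ck_on k S (\<lambda>x. f' x v)"
    "\<forall>x\<in>S. (g has_derivative g' x) (at x)" "\<forall>v. Ck_on k S (\<lambda>x. g' x v)"
    by auto
  with Suc.IH show ?case
    by (auto intro!: exI[of _ "\<lambda>x v. f' x v + g' x v"] derivative_eq_intros)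
qed

lemma Ck_on_bilinear:
  assumes "bounded_bilinear B"
  shows "Ck_on k S f \<Longrightarrow> Ck_on k S g \<Longrightarrow> Ck_on k S (\<lambda>x. B (f x) (g x))"
proof (induction k arbitrary: f g)
  case 0
  then show ?case using bounded_bilinear.continuous_on[OF assms] by auto
next
  case (Suc k)
  then obtain f' g' where *:
    "\<forall>x\<in>S. (f has_derivative f' x) (at x)" "\<forall>v. Ck_on k S (\<lambda>x. f' x v)"
    "\<forall>x\<in>S. (g has_derivative g' x) (at x)" "\<forall>v. Ck_on k S (\<lambda>x. g' x v)"
    by auto
  have "Ck_on k S f" "Ck_on k S g" using Suc.prems Ck_on_lower by auto
  with * Suc.IH have "\<forall>v. Ck_on k S (\<lambda>x. B (f x) (g' x v) + B (f' x v) (g x))"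
    by (auto intro!: Ck_on_add)
  moreover have "\<forall>x\<in>S. ((\<lambda>x. B (f x) (g x)) has_derivative (\<lambda>v. B (f x) (g' x v) + B (f' x v) (g x))) (at x)"
    using * bounded_bilinear.FDERIV[OF assms] by blast
  ultimately show ?case unfolding Ck_on.simps
    by (intro exI[of _ "\<lambda>x v. B (f x) (g' x v) + B (f' x v) (g x)"]) auto
qed

lemma Ck_on_sum: "finite I \<Longrightarrow> (\<And>i. i \<in> I \<Longrightarrow> Ck_on k S (f i)) \<Longrightarrow> Ck_on k S (\<lambda>x. \<Sum>i\<in>I. f i x)"
  by (induction I rule: finite_induct) (auto intro!: Ck_on_add Ck_on_const)

lemma Ck_on_compose:
  fixes f :: "'a::euclidean_space \<Rightarrow> 'b::euclidean_space" and g :: "'b \<Rightarrow> 'c::real_normed_vector"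
  assumes "f ` S \<subseteq> T"
  shows "Ck_on k T g \<Longrightarrow> Ck_on k S f \<Longrightarrow> Ck_on k S (\<lambda>x. g (f x))"
proof (induction k arbitrary: g)
  case 0
  then show ?case using assms by (auto intro: continuous_on_compose2)
next
  case (Suc k)
  then obtain f' g' where *:
    "\<forall>x\<in>S. (f has_derivative f' x) (at x)" "\<forall>v. Ck_on k S (\<lambda>x. f' x v)"
    "\<forall>x\<in>T. (g has_derivative g' x) (at x)" "\<forall>v. Ck_on k T (\<lambda>x. g' x v)"
    by auto
  have f: "Ck_on k S f" using Suc.prems Ck_on_lower by auto
  show ?case unfolding Ck_on.simps
  \<comment> \<open>\<open>Ck_on\<close> speaks about \<open>g' y i\<close> for a fixed direction
    \<open>i\<close> only, while the chain rule produces the moving direction \<open>f' x v\<close>.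
    Expanding it in the basis leaves products to which the induction hypothesis applies.\<close>
  proof (intro exI[of _ "\<lambda>x v. \<Sum>i\<in>Basis. (f' x v \<bullet> i) *\<^sub>R g' (f x) i"] conjI ballI allI)
    fix x assume x: "x \<in> S"
    then have gx: "(g has_derivative g' (f x)) (at (f x))" using * assms by auto
    have "((\<lambda>x. g (f x)) has_derivative (\<lambda>v. g' (f x) (f' x v))) (at x)"
      using has_derivative_compose[of f "f' x" x UNIV g "g' (f x)"] * x gx by simp
    moreover have "g' (f x) (f' x v) = (\<Sum>i\<in>Basis. (f' x v \<bullet> i) *\<^sub>R g' (f x) i)" for v
    proof -
      interpret linear "g' (f x)" using gx has_derivative_linear by blast
      have "g' (f x) (f' x v) = g' (f x) (\<Sum>i\<in>Basis. (f' x v \<bullet> i) *\<^sub>R i)"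
        by (simp add: euclidean_representation)
      then show ?thesis by (simp add: sum scale)
    qed
    ultimately show "((\<lambda>x. g (f x)) has_derivative (\<lambda>v. \<Sum>i\<in>Basis. (f' x v \<bullet> i) *\<^sub>R g' (f x) i)) (at x)"
      by simp
  next
    fix v
    show "Ck_on k S (\<lambda>x. \<Sum>i\<in>Basis. (f' x v \<bullet> i) *\<^sub>R g' (f x) i)"
      using *(2) Suc.IH[OF *(4)[rule_format] f]
      by (intro Ck_on_sum Ck_on_bilinear[OF bounded_bilinear_scaleR]
          Ck_on_linear_comp[OF bounded_linear_inner_left]) auto
  qed
qed

text \<open>The open-set core of \<open>smooth_on\<close>: all derivatives are taken in the ambient
  space, and no local extension has to be chosen.\<close>

definition Cinf_on :: "'a::euclidean_space set \<Rightarrow> ('a \<Rightarrow> 'b::real_normed_vector) \<Rightarrow> bool" where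
  "Cinf_on S f \<longleftrightarrow> (\<forall>k. Ck_on k S f)"

lemma Cinf_on_subset: "Cinf_on S f \<Longrightarrow> T \<subseteq> S \<Longrightarrow> Cinf_on T f"
  by (auto simp: Cinf_on_def intro: Ck_on_subset)

lemma Cinf_on_cong: "open S \<Longrightarrow> (\<And>x. x \<in> S \<Longrightarrow> f x = g x) \<Longrightarrow> Cinf_on S f \<Longrightarrow> Cinf_on S g"
  unfolding Cinf_on_def using Ck_on_cong by blast

lemma Cinf_on_local:
  "(\<And>x. x \<in> S \<Longrightarrow> \<exists>T. open T \<and> x \<in> T \<and> Cinf_on T f) \<Longrightarrow> Cinf_on S f"
  unfolding Cinf_on_def by (intro allI Ck_on_local) blast

lemma Cinf_on_const [simp, intro]: "Cinf_on S (\<lambda>x. c)"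
  by (simp add: Cinf_on_def Ck_on_const)

lemma Cinf_on_bounded_linear: "bounded_linear L \<Longrightarrow> Cinf_on S L"
  by (simp add: Cinf_on_def Ck_on_bounded_linear)

lemma Cinf_on_ident [simp, intro]: "Cinf_on S (\<lambda>x. x)"
  by (rule Cinf_on_bounded_linear) simp

lemma Cinf_on_linear_comp: "bounded_linear L \<Longrightarrow> Cinf_on S f \<Longrightarrow> Cinf_on S (\<lambda>x. L (f x))"
  by (simp add: Cinf_on_def Ck_on_linear_comp)

lemma Cinf_on_add [intro]: "Cinf_on S f \<Longrightarrow> Cinf_on S g \<Longrightarrow> Cinf_on S (\<lambda>x. f x + g x)"
  by (simp add: Cinf_on_def Ck_on_add)

lemma Cinf_on_bilinear:
  "bounded_bilinear B \<Longrightarrow> Cinf_on S f \<Longrightarrow> Cinf_on S g \<Longrightarrow> Cinf_on S (\<lambda>x. B (f x) (g x))"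
  by (simp add: Cinf_on_def Ck_on_bilinear)

lemma Cinf_on_scaleR [intro]:
  "Cinf_on S f \<Longrightarrow> Cinf_on S g \<Longrightarrow> Cinf_on S (\<lambda>x. f x *\<^sub>R g x)"
  by (rule Cinf_on_bilinear[OF bounded_bilinear_scaleR])

lemma Cinf_on_mult [intro]:
  fixes f g :: "'a::euclidean_space \<Rightarrow> real"
  shows "Cinf_on S f \<Longrightarrow> Cinf_on S g \<Longrightarrow> Cinf_on S (\<lambda>x. f x * g x)"
  by (rule Cinf_on_bilinear[OF bounded_bilinear_mult])

lemma Cinf_on_inner_const [intro]: "Cinf_on S f \<Longrightarrow> Cinf_on S (\<lambda>x. f x \<bullet> i)"
  by (rule Cinf_on_linear_comp[OF bounded_linear_inner_left])

lemma Cinf_on_inner [intro]: "Cinf_on S f \<Longrightarrow> Cinf_on S g \<Longrightarrow> Cinf_on S (\<lambda>x. f x \<bullet> g x)"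
  by (rule Cinf_on_bilinear[OF bounded_bilinear_inner])

lemma Cinf_on_minus [intro]: "Cinf_on S f \<Longrightarrow> Cinf_on S (\<lambda>x. - f x)"
  by (rule Cinf_on_linear_comp[OF bounded_linear_minus[OF bounded_linear_ident]])

lemma Cinf_on_diff [intro]: "Cinf_on S f \<Longrightarrow> Cinf_on S g \<Longrightarrow> Cinf_on S (\<lambda>x. f x - g x)"
  using Cinf_on_add[OF _ Cinf_on_minus[of S g], of f] by (simp only: diff_conv_add_uminus)

lemma Cinf_on_fst [intro]: "Cinf_on S f \<Longrightarrow> Cinf_on S (\<lambda>x. fst (f x))"
  by (rule Cinf_on_linear_comp[OF bounded_linear_fst])

lemma Cinf_on_snd [intro]: "Cinf_on S f \<Longrightarrow> Cinf_on S (\<lambda>x. snd (f x))"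
  by (rule Cinf_on_linear_comp[OF bounded_linear_snd])

lemma Cinf_on_Pair [intro]:
  assumes "Cinf_on S f" "Cinf_on S g" shows "Cinf_on S (\<lambda>x. (f x, g x))"
proof -
  have "Cinf_on S (\<lambda>x. (f x, 0) + (0, g x))"
    using assms
    by (intro Cinf_on_add Cinf_on_linear_comp[of "\<lambda>y. (y, 0)"] Cinf_on_linear_comp[of "\<lambda>y. (0, y)"])
      (auto intro!: bounded_linear_Pair bounded_linear_ident bounded_linear_zero)
  then show ?thesis by simp
qed

lemma Cinf_on_sum [intro]:
  "finite I \<Longrightarrow> (\<And>i. i \<in> I \<Longrightarrow> Cinf_on S (f i)) \<Longrightarrow> Cinf_on S (\<lambda>x. \<Sum>i\<in>I. f i x)"
  by (simp add: Cinf_on_def Ck_on_sum)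

lemma Cinf_on_compose:
  fixes f :: "'a::euclidean_space \<Rightarrow> 'b::euclidean_space" and g :: "'b \<Rightarrow> 'c::real_normed_vector"
  shows "Cinf_on T g \<Longrightarrow> Cinf_on S f \<Longrightarrow> f ` S \<subseteq> T \<Longrightarrow> Cinf_on S (\<lambda>x. g (f x))"
  by (simp add: Cinf_on_def Ck_on_compose)

lemma Cinf_on_has_derivative:
  assumes "Cinf_on S f" "x \<in> S"
  shows "(f has_derivative frechet_derivative f (at x)) (at x)"
proof -
  have "Ck_on (Suc 0) S f" using assms by (auto simp: Cinf_on_def simp del: Ck_on.simps)
  then show ?thesis
    using assms(2) by (auto simp: frechet_derivative_works[symmetric] differentiable_def)
qed

lemma Cinf_on_continuous: "Cinf_on S f \<Longrightarrow> continuous_on S f"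
  unfolding Cinf_on_def by (metis Ck_on.simps(1))

lemma Cinf_on_derivative:
  assumes "open S" "Cinf_on S f" shows "Cinf_on S (\<lambda>x. frechet_derivative f (at x) v)"
  using Ck_on_Suc_derivative[OF assms(1) _ Cinf_on_has_derivative[OF assms(2)]] assms(2)
  by (auto simp: Cinf_on_def simp del: Ck_on.simps)

lemma Cinf_onI_derivative:
  assumes "\<And>x. x \<in> S \<Longrightarrow> (f has_derivative f' x) (at x)" "\<And>v. Cinf_on S (\<lambda>x. f' x v)"
  shows "Cinf_on S f"
proof -
  have "Ck_on (Suc k) S f" for k using assms by (auto simp: Cinf_on_def)
  then show ?thesis unfolding Cinf_on_def using Ck_on_lower by blast
qed

lemma smooth_on_if_Cinf_on: "open T \<Longrightarrow> Cinf_on T g \<Longrightarrow> S \<subseteq> T \<Longrightarrow> (\<And>y. y \<in> S \<Longrightarrow> f y = g y) \<Longrightarrow> smooth_on S f"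
  unfolding smooth_on_def Cinf_on_def by blast

section \<open>Smooth bump functions\<close>

lemma Cinf_on_inverse: "Cinf_on {0<..} (inverse :: real \<Rightarrow> real)"
proof -
  have "Ck_on k {0<..} (inverse :: real \<Rightarrow> real)" for k
  proof (induction k)
    case 0
    then show ?case by (auto intro!: continuous_intros)
  next
    case (Suc k)
    \<comment> \<open>The derivative is a polynomial in \<open>inverse\<close> itself, so the
      induction hypothesis covers it.\<close>
    have "(inverse has_derivative (\<lambda>v. - (inverse x * inverse x) * v)) (at x)" if "x > 0" for x :: real
      using that by (auto intro!: derivative_eq_intros)
    moreover have "Ck_on k {0<..} (\<lambda>x::real. - (inverse x * inverse x) * v)" for v :: real
      using Suc Ck_on_linear_comp[OF bounded_linear_mult_left[of "-v"] 
          Ck_on_bilinear[OF bounded_bilinear_mult Suc Suc]] by simp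
    ultimately show ?case
      by (auto intro!: exI[of _ "\<lambda>x v. - (inverse x * inverse x) * v"])
  qed
  then show ?thesis by (simp add: Cinf_on_def)
qed

text \<open>The classical flat function is the case \<open>n = 0\<close>. With the factors
  \<open>inverse x ^ n\<close> the family is closed under differentiation up to linear combinations,
  which is what an induction over the order of smoothness needs.\<close>

definition flat_exp :: "nat \<Rightarrow> real \<Rightarrow> real" where
  "flat_exp n x = (if x > 0 then inverse x ^ n * exp (- inverse x) else 0)"

lemma flat_exp_tendsto_0: "(flat_exp n \<longlongrightarrow> 0) (at_right 0)"
proof -
  have "((\<lambda>y::real. y ^ n / exp y) \<longlongrightarrow> 0) at_top" by (rule tendsto_power_div_exp_0)
  then have "((\<lambda>x::real. inverse x ^ n / exp (inverse x)) \<longlongrightarrow> 0) (at_right 0)"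
    by (rule filterlim_compose[OF _ filterlim_inverse_at_top_right])
  moreover have "\<forall>\<^sub>F x in at_right 0. inverse x ^ n / exp (inverse x) = flat_exp n x"
    unfolding eventually_at_right_field
    by (rule exI[of _ 1]) (simp add: flat_exp_def exp_minus divide_inverse)
  ultimately show ?thesis by (rule Lim_transform_eventually)
qed

lemma flat_exp_tendsto_0_at: "(flat_exp n \<longlongrightarrow> 0) (at 0)"
proof -
  have "(flat_exp n \<longlongrightarrow> 0) (at_left 0)"
    unfolding tendsto_iff eventually_at_left_field
    by (auto simp: flat_exp_def intro!: exI[of _ "-1"])
  then show ?thesis using flat_exp_tendsto_0 by (simp add: filterlim_split_at)
qed

lemma flat_exp_derivative:
  "(flat_exp n has_real_derivative (flat_exp (n + 2) x - of_nat n * flat_exp (Suc n) x)) (at x)"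
proof -
  consider "x > 0" | "x < 0" | "x = 0" by linarith
  then show ?thesis
  proof cases
    case 1
    have "((\<lambda>x. inverse x ^ n * exp (- inverse x)) has_real_derivative
        (flat_exp (n + 2) x - of_nat n * flat_exp (Suc n) x)) (at x)"
    proof (cases n)
      case 0
      then show ?thesis using 1
        by (auto intro!: derivative_eq_intros simp: flat_exp_def power2_eq_square)
    next
      case (Suc m)
      have "((\<lambda>x. inverse x ^ n * exp (- inverse x)) has_real_derivative
          (of_nat n * inverse x ^ m * (- (inverse x * inverse x))) * exp (- inverse x)
          + exp (- inverse x) * (inverse x * inverse x) * inverse x ^ n) (at x)"
        using 1 by (auto intro!: derivative_eq_intros simp: Suc simp del: power_Suc)
      moreover have "(of_nat n * inverse x ^ m * (- (inverse x * inverse x))) * exp (- inverse x)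
          + exp (- inverse x) * (inverse x * inverse x) * inverse x ^ n
          = flat_exp (n + 2) x - of_nat n * flat_exp (Suc n) x"
        using 1 Suc by (simp add: flat_exp_def algebra_simps)
      ultimately show ?thesis by simp
    qed
    then show ?thesis
      by (rule has_field_derivative_transform_within_open[of _ _ _ "{0<..}"]) (use 1 in \<open>auto simp: flat_exp_def\<close>)
  next
    case 2
    have "((\<lambda>x. 0) has_real_derivative (flat_exp (n + 2) x - of_nat n * flat_exp (Suc n) x)) (at x)"
      using 2 by (auto simp: flat_exp_def)
    then show ?thesis
      by (rule has_field_derivative_transform_within_open[of _ _ _ "{..<0}"]) (use 2 in \<open>auto simp: flat_exp_def\<close>)
  next
    case 3
    \<comment> \<open>The difference quotient at 0 is the next member of the family, which tends to
      0.\<close>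
    have "((\<lambda>h. (flat_exp n h - flat_exp n 0) / (h - 0)) \<longlongrightarrow> 0) (at 0)"
    proof (rule Lim_transform_eventually[OF flat_exp_tendsto_0_at[of "Suc n"]])
      show "\<forall>\<^sub>F h in at 0. flat_exp (Suc n) h = (flat_exp n h - flat_exp n 0) / (h - 0)"
        by (auto simp: eventually_at_filter flat_exp_def divide_inverse)
    qed
    then have "(flat_exp n has_real_derivative 0) (at 0)"
      by (simp add: has_field_derivative_iff)
    then show ?thesis using 3 by (simp add: flat_exp_def)
  qed
qed

lemma Cinf_on_flat_exp: "Cinf_on UNIV (flat_exp n)"
proof -
  have "Ck_on k UNIV (flat_exp n)" for k
  proof (induction k arbitrary: n)
    case 0
    have "isCont (flat_exp n) x" for x using flat_exp_derivative by (rule DERIV_isCont)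
    then show ?case by (simp add: continuous_at_imp_continuous_on)
  next
    case (Suc k)
    have "Ck_on k UNIV (\<lambda>x. (flat_exp (n + 2) x - of_nat n * flat_exp (Suc n) x) * v)" for v
      using Ck_on_linear_comp[OF bounded_linear_mult_left[of v] Ck_on_add[OF Suc[of "n+2"]
          Ck_on_linear_comp[OF bounded_linear_mult_right[of "- of_nat n"] Suc[of "Suc n"]]]]
      by simp
    then show ?case
      using flat_exp_derivative[of n] unfolding has_field_derivative_def Ck_on.simps
      by (intro exI[of _ "\<lambda>x v. (flat_exp (n + 2) x - of_nat n * flat_exp (Suc n) x) * v"]) auto
  qed
  then show ?thesis by (simp add: Cinf_on_def)
qed

text \<open>A quotient \<open>u / (u + w)\<close>: \<open>u\<close> vanishes off the ball of radius
  \<open>2 * r\<close>, \<open>w\<close> vanishes on the ball of radius \<open>r\<close>, and at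
  every point one of them is positive. Both depend on the squared distance, which is smooth at the
  centre too.\<close>

lemma smooth_bump:
  fixes y :: "'a::euclidean_space"
  assumes "r > 0"
  obtains \<rho> :: "'a \<Rightarrow> real" where "Cinf_on UNIV \<rho>" "\<And>x. dist y x \<le> r \<Longrightarrow> \<rho> x = 1"
    "\<And>x. dist y x \<ge> 2 * r \<Longrightarrow> \<rho> x = 0"
proof -
  define s where "s x = (x - y) \<bullet> (x - y)" for x
  have s: "s x = (dist y x)\<^sup>2" for x
    by (simp add: s_def dist_commute dist_norm power2_norm_eq_inner)
  define u where "u x = flat_exp 0 (4 * r\<^sup>2 - s x)" for x
  define w where "w x = flat_exp 0 (s x - r\<^sup>2)" for x
  have cs: "Cinf_on UNIV s" unfolding s_def
    by (intro Cinf_on_inner Cinf_on_diff Cinf_on_ident Cinf_on_const)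
  have cu: "Cinf_on UNIV u" "Cinf_on UNIV w" unfolding u_def w_def
    using cs by (auto intro!: Cinf_on_compose[OF Cinf_on_flat_exp])
  have nn: "u x \<ge> 0" "w x \<ge> 0" for x by (auto simp: u_def w_def flat_exp_def)
  have uw: "u x + w x > 0" for x
  proof -
    have "u x > 0 \<or> w x > 0"
    proof (cases "s x < 4 * r\<^sup>2")
      case True then show ?thesis by (simp add: u_def flat_exp_def)
    next
      case False
      moreover have "0 < r\<^sup>2" using assms by simp
      ultimately have "s x - r\<^sup>2 > 0" by linarith
      then show ?thesis by (simp add: w_def flat_exp_def)
    qed
    with nn[of x] show ?thesis by linarith
  qed
  show ?thesis
  proof (rule that[of "\<lambda>x. u x * inverse (u x + w x)"])
    show "Cinf_on UNIV (\<lambda>x. u x * inverse (u x + w x))"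
      using cu uw by (intro Cinf_on_mult Cinf_on_compose[OF Cinf_on_inverse] Cinf_on_add) auto
    show "u x * inverse (u x + w x) = 1" if "dist y x \<le> r" for x
    proof -
      have "s x \<le> r\<^sup>2" using that by (simp add: s power_mono)
      then have "w x = 0" by (simp add: w_def flat_exp_def)
      then show ?thesis using uw[of x] by simp
    qed
    show "u x * inverse (u x + w x) = 0" if "dist y x \<ge> 2 * r" for x
    proof -
      have "(2 * r)\<^sup>2 \<le> s x" using that assms unfolding s by (intro power_mono) auto
      then have "u x = 0" by (simp add: u_def flat_exp_def)
      then show ?thesis by simp
    qed
  qed
qed

lemmas Cinf_on_intros = Cinf_on_const Cinf_on_ident Cinf_on_add Cinf_on_diff Cinf_on_minus Cinf_on_mult
  Cinf_on_scaleR Cinf_on_inner_const Cinf_on_fst Cinf_on_snd Cinf_on_Pair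

section \<open>Integrals with a parameter; the lemmas of Hadamard and Poincare on balls\<close>

lemma has_derivative_integral_param:
  fixes f :: "'a::euclidean_space \<times> real \<Rightarrow> real"
  assumes "open S" "convex S" "{0..1} \<subseteq> T"
    and f': "\<And>z. z \<in> S \<times> T \<Longrightarrow> (f has_derivative f' z) (at z)"
    and cont: "\<And>v. continuous_on (S \<times> T) (\<lambda>z. f' z v)"
    and x: "x \<in> S"
  shows "((\<lambda>x. integral {0..1} (\<lambda>t. f (x, t))) has_derivative
      (\<lambda>v. integral {0..1} (\<lambda>t. f' (x, t) (v, 0)))) (at x)"
proof -
  \<comment> \<open>The Leibniz rule wants the derivative as a continuous map into bounded linear
    functions; in finite dimension continuity on each basis vector suffices.\<close>
  define fx where "fx x t = Blinfun (\<lambda>v. f' (x, t) (v, 0))" for x t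
  have bl: "bounded_linear (\<lambda>v. f' (x, t) (v, 0))" if "x \<in> S" "t \<in> T" for x t
    using has_derivative_bounded_linear[OF f', of "(x, t)"] that
    by (auto intro!: bounded_linear_compose[of "f' (x, t)"] bounded_linear_Pair
        bounded_linear_ident bounded_linear_zero)
  have fx: "blinfun_apply (fx x t) v = f' (x, t) (v, 0)" if "x \<in> S" "t \<in> T" for x t v
    using bounded_linear_Blinfun_apply[OF bl[OF that]] by (simp add: fx_def)
  have sub: "S \<times> cbox 0 1 \<subseteq> S \<times> T" using assms(3) by auto
  have cfx: "continuous_on (S \<times> cbox 0 1) (\<lambda>(x, t). fx x t)"
  proof (rule continuous_on_blinfun_componentwise)
    fix i :: 'a assume "i \<in> Basis"
    have "continuous_on (S \<times> cbox 0 1) (\<lambda>z. f' z (i, 0))"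
      using continuous_on_subset[OF cont sub] .
    then show "continuous_on (S \<times> cbox 0 1) (\<lambda>z. blinfun_apply (case z of (x, t) \<Rightarrow> fx x t) i)"
      by (rule continuous_on_eq) (use fx assms(3) in auto)
  qed
  have cf: "continuous_on (cbox 0 1) (\<lambda>t. f (x, t))" if "x \<in> S" for x
  proof -
    have "continuous_on (S \<times> T) f"
      using f' has_derivative_continuous by (blast intro: continuous_at_imp_continuous_on)
    then show ?thesis
      by (rule continuous_on_compose2) (use that assms(3) in \<open>auto intro!: continuous_intros\<close>)
  qed
  have "((\<lambda>x. integral (cbox 0 1) (\<lambda>t. f (x, t))) has_derivative
      blinfun_apply (integral (cbox 0 1) (fx x))) (at x within S)"
  proof (rule leibniz_rule[OF _ _ cfx x assms(2)])
    fix x t assume xt: "x \<in> S" "t \<in> cbox 0 (1::real)"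
    then have t: "t \<in> T" using assms(3) by auto
    have "((\<lambda>x. f (x, t)) has_derivative (\<lambda>v. f' (x, t) (v, 0))) (at x within S)"
    proof (rule has_derivative_in_compose[of "\<lambda>x. (x, t)" "\<lambda>v. (v, 0)" x S f "f' (x, t)"])
      show "((\<lambda>x. (x, t)) has_derivative (\<lambda>v. (v, 0))) (at x within S)"
        by (auto intro!: derivative_eq_intros)
      show "(f has_derivative f' (x, t)) (at (x, t) within (\<lambda>x. (x, t)) ` S)"
        using f'[of "(x, t)"] xt(1) t by (simp add: has_derivative_at_withinI)
    qed
    then show "((\<lambda>x. f (x, t)) has_derivative blinfun_apply (fx x t)) (at x within S)"
      using fx[OF xt(1) t] by presburger
  qed (rule integrable_continuous[OF cf])
  moreover have int: "fx x integrable_on cbox 0 1"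
  proof -
    have "continuous_on (cbox 0 1) (\<lambda>t. (\<lambda>(x, t). fx x t) (x, t))"
      by (rule continuous_on_compose2[OF cfx]) (use x in \<open>auto intro!: continuous_intros\<close>)
    then show ?thesis by (intro integrable_continuous) simp
  qed
  moreover have "blinfun_apply (integral (cbox 0 1) (fx x)) = (\<lambda>v. integral {0..1} (\<lambda>t. f' (x, t) (v, 0)))"
    unfolding blinfun_apply_integral[OF int] fun_eq_iff unfolding cbox_interval
    by (intro allI integral_cong) (use fx x assms(3) in auto)
  ultimately show ?thesis using assms(1) x by (simp add: at_within_open[of x S] cbox_interval)
qed

lemma Ck_on_integral_param:
  fixes f :: "'a::euclidean_space \<times> real \<Rightarrow> real"
  assumes "open S" "convex S" "{0..1} \<subseteq> T"
  shows "Ck_on k (S \<times> T) f \<Longrightarrow> Ck_on k S (\<lambda>x. integral {0..1} (\<lambda>t. f (x, t)))"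
proof (induction k arbitrary: f)
  case 0
  have "continuous_on (S \<times> cbox 0 1) f"
    using continuous_on_subset[of "S \<times> T" f "S \<times> cbox 0 1"] 0 assms(3) by fastforce
  then have "continuous_on S (\<lambda>x. integral (cbox 0 1) (\<lambda>t. f (x, t)))"
    by (intro integral_continuous_on_param) simp
  then show ?case by (simp add: cbox_interval)
next
  case (Suc k)
  then obtain f' where f': "\<And>z. z \<in> S \<times> T \<Longrightarrow> (f has_derivative f' z) (at z)"
    "\<And>v. Ck_on k (S \<times> T) (\<lambda>z. f' z v)" by auto
  have "continuous_on (S \<times> T) (\<lambda>z. f' z v)" for v
  proof -
    have "Ck_on j (S \<times> T) g \<Longrightarrow> continuous_on (S \<times> T) g" for j and g :: "'a \<times> real \<Rightarrow> real"
      by (induction j) (auto simp del: Ck_on.simps(2) dest: Ck_on_lower)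
    then show ?thesis using f'(2) by blast
  qed
  then show ?case
    using has_derivative_integral_param[OF assms f'(1)] Suc.IH[OF f'(2)]
    by (auto intro!: exI[of _ "\<lambda>x v. integral {0..1} (\<lambda>t. f' (x, t) (v, 0))"])
qed

lemma Cinf_on_integral_param:
  fixes f :: "'a::euclidean_space \<times> real \<Rightarrow> real"
  assumes "open S" "convex S" "{0..1} \<subseteq> T" "Cinf_on (S \<times> T) f"
  shows "Cinf_on S (\<lambda>x. integral {0..1} (\<lambda>t. f (x, t)))"
  using assms unfolding Cinf_on_def by (blast intro: Ck_on_integral_param)

text \<open>The parameter range is an open neighbourhood of the unit interval, so that derivatives
  at its endpoints are two-sided. Since \<open>t\<close> stays below 2 in absolute value, halving
  the radius keeps the point in the ball.\<close>

lemma segment_in_ball: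
  fixes y :: "'a::real_normed_vector"
  assumes "x \<in> ball y (r/2)" "t \<in> {-1<..<2::real}"
  shows "y + t *\<^sub>R (x - y) \<in> ball y r"
proof -
  have "\<bar>t\<bar> * norm (x - y) \<le> 2 * norm (x - y)" using assms(2) by (intro mult_right_mono) auto
  also have "\<dots> < r" using assms(1) by (simp add: dist_norm norm_minus_commute)
  finally show ?thesis by (simp add: dist_norm)
qed

lemma Cinf_on_segment:
  assumes "Cinf_on (ball y r) f"
  shows "Cinf_on (ball y (r/2) \<times> {-1<..<2::real}) (\<lambda>z. f (y + snd z *\<^sub>R (fst z - y)))"
proof (rule Cinf_on_compose[OF assms])
  show "Cinf_on (ball y (r/2) \<times> {-1<..<2::real}) (\<lambda>z. y + snd z *\<^sub>R (fst z - y))"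
    by (intro Cinf_on_intros)
qed (auto simp del: mem_ball intro!: segment_in_ball)

lemma line_has_derivative:
  fixes f :: "'a::euclidean_space \<Rightarrow> real"
  assumes "Cinf_on S f" "c + s *\<^sub>R u \<in> S"
  shows "((\<lambda>s. f (c + s *\<^sub>R u)) has_real_derivative frechet_derivative f (at (c + s *\<^sub>R u)) u) (at s)"
proof -
  let ?p = "c + s *\<^sub>R u"
  have d: "(f has_derivative frechet_derivative f (at ?p)) (at ?p)"
    by (rule Cinf_on_has_derivative[OF assms])
  then interpret linear "frechet_derivative f (at ?p)" by (rule has_derivative_linear)
  have "((\<lambda>s. f (c + s *\<^sub>R u)) has_derivative (\<lambda>h. frechet_derivative f (at ?p) (h *\<^sub>R u))) (at s)"
    by (rule has_derivative_compose[of "\<lambda>s. c + s *\<^sub>R u" _ s UNIV f, OF _ d])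
      (auto intro!: derivative_eq_intros)
  then show ?thesis by (simp add: has_field_derivative_def scale mult_commute_abs)
qed

lemma segment_has_derivative:
  fixes f :: "'a::euclidean_space \<Rightarrow> real"
  assumes "Cinf_on (ball y r) f" "x \<in> ball y (r/2)" "t \<in> {0..1}"
  shows "((\<lambda>t. f (y + t *\<^sub>R (x - y))) has_real_derivative
     frechet_derivative f (at (y + t *\<^sub>R (x - y))) (x - y)) (at t within {0..1})"
  by (rule has_field_derivative_at_within[OF line_has_derivative[OF assms(1) segment_in_ball[OF assms(2)]]])
    (use assms(3) in auto)

text \<open>The derivative is integrated along the segment from \<open>y\<close> to
  \<open>x\<close>: \<open>g i\<close> is the mean of the partial derivative in direction
  \<open>i\<close>, and for \<open>x = y\<close> the integrand is constant. The shape suits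
  derivations at \<open>y\<close>: each summand has a factor vanishing there, so the Leibniz rule
  retains only the value \<open>g i y\<close>.\<close>

lemma hadamard:
  fixes f :: "'a::euclidean_space \<Rightarrow> real"
  assumes "r > 0" "Cinf_on (ball y r) f"
  obtains g where "\<And>i. Cinf_on (ball y (r/2)) (g i)"
    "\<And>x. x \<in> ball y (r/2) \<Longrightarrow> f x = f y + (\<Sum>i\<in>Basis. ((x - y) \<bullet> i) * g i x)"
    "\<And>i. g i y = frechet_derivative f (at y) i"
proof -
  define h where "h i z = frechet_derivative f (at (y + snd z *\<^sub>R (fst z - y))) i" for i z
  have ch: "Cinf_on (ball y (r/2) \<times> {-1<..<2::real}) (h i)" for i unfolding h_def
    by (rule Cinf_on_segment[OF Cinf_on_derivative[OF open_ball assms(2)]])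
  define g where "g i x = integral {0..1} (\<lambda>t. h i (x, t))" for i x
  show ?thesis
  proof (rule that[of g])
    show "Cinf_on (ball y (r/2)) (g i)" for i unfolding g_def
      by (rule Cinf_on_integral_param[OF _ _ _ ch]) auto
    show "g i y = frechet_derivative f (at y) i" for i by (simp add: g_def h_def)
    fix x assume x: "x \<in> ball y (r/2)"
    have lin: "linear (frechet_derivative f (at (y + t *\<^sub>R (x - y))))" if "t \<in> {0..1}" for t
      by (rule has_derivative_linear[OF Cinf_on_has_derivative[OF assms(2) segment_in_ball[OF x]]])
        (use that in auto)
    have "((\<lambda>t. frechet_derivative f (at (y + t *\<^sub>R (x - y))) (x - y)) has_integral
        f (y + 1 *\<^sub>R (x - y)) - f (y + 0 *\<^sub>R (x - y))) {0..1}"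
      by (rule fundamental_theorem_of_calculus)
        (use segment_has_derivative[OF assms(2) x] in
          \<open>auto simp: has_real_derivative_iff_has_vector_derivative[symmetric]\<close>)
    then have "f x - f y = integral {0..1} (\<lambda>t. frechet_derivative f (at (y + t *\<^sub>R (x - y))) (x - y))"
      by (simp add: integral_unique)
    also have "\<dots> = integral {0..1} (\<lambda>t. \<Sum>i\<in>Basis. ((x - y) \<bullet> i) * h i (x, t))"
    proof (rule integral_cong)
      fix t :: real assume "t \<in> {0..1}"
      then interpret linear "frechet_derivative f (at (y + t *\<^sub>R (x - y)))" using lin by blast
      have "frechet_derivative f (at (y + t *\<^sub>R (x - y))) (x - y)
        = frechet_derivative f (at (y + t *\<^sub>R (x - y))) (\<Sum>i\<in>Basis. ((x - y) \<bullet> i) *\<^sub>R i)"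
        by (simp only: euclidean_representation)
      then show "frechet_derivative f (at (y + t *\<^sub>R (x - y))) (x - y)
        = (\<Sum>i\<in>Basis. ((x - y) \<bullet> i) * h i (x, t))"
        by (simp add: sum scale h_def)
    qed
    also have "\<dots> = (\<Sum>i\<in>Basis. integral {0..1} (\<lambda>t. ((x - y) \<bullet> i) * h i (x, t)))"
    proof (rule integral_sum)
      fix i :: 'a
      have "continuous_on {0..1} (\<lambda>t. h i (x, t))"
        by (rule continuous_on_compose2[OF Cinf_on_continuous[OF ch]])
          (use x in \<open>auto intro!: continuous_intros\<close>)
      then show "(\<lambda>t. ((x - y) \<bullet> i) * h i (x, t)) integrable_on {0..1}"
        by (intro integrable_continuous_real continuous_intros)
    qed simp
    finally show "f x = f y + (\<Sum>i\<in>Basis. ((x - y) \<bullet> i) * g i x)"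
      by (simp add: g_def)
  qed
qed

text \<open>The primitive integrates \<open>b\<close> along the segment from the centre. After
  differentiation under the integral, closedness turns the integrand into the
  \<open>t\<close>-derivative of \<open>t * b (y + t *\<^sub>R (x - y)) v\<close>, whose integral
  over the unit interval is \<open>b x v\<close>.\<close>

lemma poincare_ball:
  fixes b :: "'a::euclidean_space \<Rightarrow> 'a \<Rightarrow> real"
  assumes "r > 0" and cb: "\<And>w. Cinf_on (ball y r) (\<lambda>x. b x w)"
    and lin: "\<And>x. x \<in> ball y r \<Longrightarrow> linear (b x)"
    and closed: "\<And>x u w. x \<in> ball y r \<Longrightarrow>
      frechet_derivative (\<lambda>x. b x w) (at x) u = frechet_derivative (\<lambda>x. b x u) (at x) w"
  obtains F where "Cinf_on (ball y (r/2)) F" "\<forall>x\<in>ball y (r/2). (F has_derivative b x) (at x)"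
proof -
  define S where "S = ball y (r/2)"
  define T where "T = {-1<..<2::real}"
  define h where "h z = (\<Sum>i\<in>Basis. ((fst z - y) \<bullet> i) * b (y + snd z *\<^sub>R (fst z - y)) i)"
    for z :: "'a \<times> real"
  have ST: "open S" "convex S" "{0..1} \<subseteq> T" "open (S \<times> T)" by (auto simp: S_def T_def open_Times)
  have ch: "Cinf_on (S \<times> T) h" unfolding h_def S_def T_def
    by (intro Cinf_on_sum Cinf_on_mult Cinf_on_segment[OF cb] finite_Basis Cinf_on_intros)
  have hd: "(h has_derivative frechet_derivative h (at z)) (at z)" if "z \<in> S \<times> T" for z
    by (rule Cinf_on_has_derivative[OF ch that])
  define F where "F x = integral {0..1} (\<lambda>t. h (x, t))" for x
  have F: "(F has_derivative b x) (at x)" if x: "x \<in> S" for x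
  proof -
    have "(F has_derivative (\<lambda>v. integral {0..1} (\<lambda>t. frechet_derivative h (at (x, t)) (v, 0)))) (at x)"
      unfolding F_def
      by (rule has_derivative_integral_param[OF ST(1-3) hd _ x])
        (use Cinf_on_continuous[OF Cinf_on_derivative[OF ST(4) ch]] in auto)
    moreover have "integral {0..1} (\<lambda>t. frechet_derivative h (at (x, t)) (v, 0)) = b x v" for v
    proof -
      have key: "frechet_derivative h (at (x, t)) (v, 0) =
          b (y + t *\<^sub>R (x - y)) v + t * frechet_derivative (\<lambda>x. b x v) (at (y + t *\<^sub>R (x - y))) (x - y)"
        if t: "t \<in> {0..1}" for t
      proof -
        let ?p = "y + t *\<^sub>R (x - y)"
        have p: "?p \<in> ball y r" by (rule segment_in_ball) (use x t in \<open>auto simp: S_def\<close>)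
        have db: "((\<lambda>x. b x w) has_derivative frechet_derivative (\<lambda>x. b x w) (at ?p)) (at ?p)" for w
          by (rule Cinf_on_has_derivative[OF cb p])
        have "((\<lambda>x. h (x, t)) has_derivative (\<lambda>v. frechet_derivative h (at (x, t)) (v, 0))) (at x)"
        proof (rule has_derivative_compose[of "\<lambda>x. (x, t)" _ x UNIV h "frechet_derivative h (at (x, t))"])
          show "((\<lambda>x. (x, t)) has_derivative (\<lambda>v. (v, 0))) (at x)"
            by (auto intro!: derivative_eq_intros)
          show "(h has_derivative frechet_derivative h (at (x, t))) (at (x, t))"
            using x t ST(3) by (intro hd) auto
        qed
        moreover have "((\<lambda>x. h (x, t)) has_derivative (\<lambda>v. \<Sum>i\<in>Basis.
            ((x - y) \<bullet> i) * frechet_derivative (\<lambda>x. b x i) (at ?p) (t *\<^sub>R v) + (v \<bullet> i) * b ?p i)) (at x)"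
        proof -
          have "((\<lambda>x. b (y + t *\<^sub>R (x - y)) i) has_derivative
              (\<lambda>v. frechet_derivative (\<lambda>x. b x i) (at ?p) (t *\<^sub>R v))) (at x)" for i
            by (rule has_derivative_compose[of "\<lambda>x. y + t *\<^sub>R (x - y)" _ x UNIV "\<lambda>x. b x i", OF _ db])
              (auto intro!: derivative_eq_intros)
          then show ?thesis unfolding h_def fst_conv snd_conv
            by (auto intro!: derivative_eq_intros)
        qed
        ultimately have "(\<lambda>v. frechet_derivative h (at (x, t)) (v, 0)) = (\<lambda>v. \<Sum>i\<in>Basis.
            ((x - y) \<bullet> i) * frechet_derivative (\<lambda>x. b x i) (at ?p) (t *\<^sub>R v) + (v \<bullet> i) * b ?p i)"
          by (rule has_derivative_unique)
        then have "frechet_derivative h (at (x, t)) (v, 0) = (\<Sum>i\<in>Basis.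
            ((x - y) \<bullet> i) * frechet_derivative (\<lambda>x. b x i) (at ?p) (t *\<^sub>R v) + (v \<bullet> i) * b ?p i)"
          by (rule fun_cong)
        \<comment> \<open>Closedness exchanges the basis direction \<open>i\<close> with
          \<open>v\<close>; the sum over \<open>i\<close> can then be reassembled to the direction
          \<open>x - y\<close>.\<close>
        also have "\<dots> = (\<Sum>i\<in>Basis.
            ((x - y) \<bullet> i) * (t * frechet_derivative (\<lambda>x. b x v) (at ?p) i)) + (\<Sum>i\<in>Basis. (v \<bullet> i) * b ?p i)"
          by (simp add: sum.distrib closed[OF p, of v] linear_scale[OF has_derivative_linear[OF db]])
        also have "(\<Sum>i\<in>Basis. (v \<bullet> i) * b ?p i) = b ?p v"
        proof -
          interpret linear "b ?p" using lin[OF p] .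
          have "b ?p v = b ?p (\<Sum>i\<in>Basis. (v \<bullet> i) *\<^sub>R i)" by (simp only: euclidean_representation)
          then show ?thesis by (simp add: sum scale)
        qed
        also have "(\<Sum>i\<in>Basis. ((x - y) \<bullet> i) * (t * frechet_derivative (\<lambda>x. b x v) (at ?p) i))
          = t * frechet_derivative (\<lambda>x. b x v) (at ?p) (x - y)"
        proof -
          interpret linear "frechet_derivative (\<lambda>x. b x v) (at ?p)"
            using db has_derivative_linear by blast
          have "frechet_derivative (\<lambda>x. b x v) (at ?p) (x - y)
              = frechet_derivative (\<lambda>x. b x v) (at ?p) (\<Sum>i\<in>Basis. ((x - y) \<bullet> i) *\<^sub>R i)"
            by (simp only: euclidean_representation)
          also have "\<dots> = (\<Sum>i\<in>Basis. ((x - y) \<bullet> i) * frechet_derivative (\<lambda>x. b x v) (at ?p) i)"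
            by (simp only: sum scale real_scaleR_def)
          finally show ?thesis by (simp add: sum_distrib_left mult.left_commute)
        qed
        finally show ?thesis by simp
      qed
      have "((\<lambda>t. b (y + t *\<^sub>R (x - y)) v + t * frechet_derivative (\<lambda>x. b x v) (at (y + t *\<^sub>R (x - y))) (x - y))
          has_integral 1 * b (y + 1 *\<^sub>R (x - y)) v - 0 * b (y + 0 *\<^sub>R (x - y)) v) {0..1}"
      proof (rule fundamental_theorem_of_calculus)
        fix t :: real assume t: "t \<in> {0..1}"
        have "((\<lambda>t. t * b (y + t *\<^sub>R (x - y)) v) has_real_derivative
          1 * b (y + t *\<^sub>R (x - y)) v + frechet_derivative (\<lambda>x. b x v) (at (y + t *\<^sub>R (x - y))) (x - y) * t)
          (at t within {0..1})"
          by (intro DERIV_mult DERIV_ident segment_has_derivative[OF cb _ t]) (use x S_def in auto)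
        then show "((\<lambda>t. t * b (y + t *\<^sub>R (x - y)) v) has_vector_derivative
          b (y + t *\<^sub>R (x - y)) v + t * frechet_derivative (\<lambda>x. b x v) (at (y + t *\<^sub>R (x - y))) (x - y))
          (at t within {0..1})"
          by (simp add: has_real_derivative_iff_has_vector_derivative[symmetric] mult.commute)
      qed simp
      then have "integral {0..1} (\<lambda>t. b (y + t *\<^sub>R (x - y)) v
          + t * frechet_derivative (\<lambda>x. b x v) (at (y + t *\<^sub>R (x - y))) (x - y)) = b x v"
        by (simp add: integral_unique)
      then show ?thesis using key integral_cong by (metis (no_types, lifting))
    qed
    ultimately show ?thesis by simp
  qed
  have "Cinf_on S F"
    by (rule Cinf_onI_derivative[OF F Cinf_on_subset[OF cb]]) (use assms(1) in \<open>auto simp: S_def\<close>)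
  then show ?thesis using F that S_def by blast
qed

text \<open>The mean value theorem is used twice: along \<open>u\<close> for a difference taken in
  direction \<open>v\<close>, then along \<open>v\<close> for the derivative in direction
  \<open>u\<close>. The second difference itself is symmetric in \<open>u\<close> and
  \<open>v\<close>.\<close>

lemma second_difference:
  fixes f :: "'a::euclidean_space \<Rightarrow> real"
  assumes f: "Cinf_on (ball x d) f" and h: "h > 0" "h * (norm u + norm v) < d"
  shows "\<exists>y\<in>ball x d. f (x + h *\<^sub>R u + h *\<^sub>R v) - f (x + h *\<^sub>R u) - f (x + h *\<^sub>R v) + f x
    = h\<^sup>2 * frechet_derivative (\<lambda>y. frechet_derivative f (at y) u) (at y) v"
proof -
  have mem: "x + t *\<^sub>R v + s *\<^sub>R u \<in> ball x d" if "0 \<le> s" "s \<le> h" "0 \<le> t" "t \<le> h" for s t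
  proof -
    have "norm (t *\<^sub>R v + s *\<^sub>R u) \<le> norm (t *\<^sub>R v) + norm (s *\<^sub>R u)" by (rule norm_triangle_ineq)
    also have "\<dots> \<le> h * norm v + h * norm u" using that by (auto intro!: add_mono mult_right_mono)
    also have "\<dots> < d" using h(2) by (simp add: algebra_simps)
    moreover have "dist x (x + t *\<^sub>R v + s *\<^sub>R u) = norm (t *\<^sub>R v + s *\<^sub>R u)"
      by (metis add.assoc add_diff_cancel_left' dist_commute dist_norm)
    ultimately show ?thesis by simp
  qed
  let ?D = "\<lambda>y. frechet_derivative f (at y) u"
  have "\<exists>s>0. s < h \<and> (f (x + h *\<^sub>R v + h *\<^sub>R u) - f (x + 0 *\<^sub>R v + h *\<^sub>R u))
      - (f (x + h *\<^sub>R v + 0 *\<^sub>R u) - f (x + 0 *\<^sub>R v + 0 *\<^sub>R u))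
      = (h - 0) * (?D (x + h *\<^sub>R v + s *\<^sub>R u) - ?D (x + 0 *\<^sub>R v + s *\<^sub>R u))"
    by (rule MVT2[OF h(1)]) (intro DERIV_diff line_has_derivative[OF f] mem; use h(1) in simp)
  then obtain s where s: "0 < s" "s < h" "(f (x + h *\<^sub>R v + h *\<^sub>R u) - f (x + 0 *\<^sub>R v + h *\<^sub>R u))
      - (f (x + h *\<^sub>R v + 0 *\<^sub>R u) - f (x + 0 *\<^sub>R v + 0 *\<^sub>R u))
      = (h - 0) * (?D (x + h *\<^sub>R v + s *\<^sub>R u) - ?D (x + 0 *\<^sub>R v + s *\<^sub>R u))" by blast
  have mem': "x + s *\<^sub>R u + t *\<^sub>R v \<in> ball x d" if "0 \<le> t" "t \<le> h" for t
    using mem[of s t] s that by (simp add: algebra_simps)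
  have "\<exists>t>0. t < h \<and> ?D (x + s *\<^sub>R u + h *\<^sub>R v) - ?D (x + s *\<^sub>R u + 0 *\<^sub>R v)
      = (h - 0) * frechet_derivative ?D (at (x + s *\<^sub>R u + t *\<^sub>R v)) v"
    by (rule MVT2[OF h(1)]) (intro line_has_derivative[OF Cinf_on_derivative[OF open_ball f]] mem'; simp)
  then obtain t where t: "0 < t" "t < h" "?D (x + s *\<^sub>R u + h *\<^sub>R v) - ?D (x + s *\<^sub>R u + 0 *\<^sub>R v)
      = (h - 0) * frechet_derivative ?D (at (x + s *\<^sub>R u + t *\<^sub>R v)) v" by blast
  show ?thesis
  proof (rule bexI[OF _ mem'[of t]])
    have "f (x + h *\<^sub>R u + h *\<^sub>R v) - f (x + h *\<^sub>R u) - f (x + h *\<^sub>R v) + f x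
        = h * (?D (x + s *\<^sub>R u + h *\<^sub>R v) - ?D (x + s *\<^sub>R u))"
      using s(3) by (simp add: add.commute add.left_commute)
    then show "f (x + h *\<^sub>R u + h *\<^sub>R v) - f (x + h *\<^sub>R u) - f (x + h *\<^sub>R v) + f x
        = h\<^sup>2 * frechet_derivative ?D (at (x + s *\<^sub>R u + t *\<^sub>R v)) v"
      using t(3) by (simp add: power2_eq_square)
  qed (use t in auto)
qed

text \<open>If the mixed derivatives differed at \<open>x\<close>, continuity would keep them apart
  on a whole ball, with values taken at possibly different points of it. The symmetric second
  difference forces two such values to coincide.\<close>

lemma symmetric_second_derivative:
  fixes f :: "'a::euclidean_space \<Rightarrow> real"
  assumes S: "open S" "x \<in> S" and f: "Cinf_on S f"
  shows "frechet_derivative (\<lambda>y. frechet_derivative f (at y) u) (at x) v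
    = frechet_derivative (\<lambda>y. frechet_derivative f (at y) v) (at x) u"
proof (rule ccontr)
  define a where "a u v y = frechet_derivative (\<lambda>y. frechet_derivative f (at y) u) (at y) v" for u v y
  assume "\<not> ?thesis"
  then have e: "\<bar>a u v x - a v u x\<bar> / 2 > 0" by (simp add: a_def)
  have "continuous_on S (a u v)" for u v unfolding a_def
    by (rule Cinf_on_continuous[OF Cinf_on_derivative[OF S(1) Cinf_on_derivative[OF S(1) f]]])
  then have "isCont (a u v) x" for u v using S continuous_on_eq_continuous_at by blast
  then have lim: "(a u v \<longlongrightarrow> a u v x) (nhds x)" for u v
    by (simp add: continuous_at tendsto_at_iff_tendsto_nhds)
  have "\<forall>\<^sub>F y in nhds x. dist (a u v y) (a u v x) < \<bar>a u v x - a v u x\<bar> / 2"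
    by (rule tendstoD[OF lim e])
  moreover have "\<forall>\<^sub>F y in nhds x. dist (a v u y) (a v u x) < \<bar>a u v x - a v u x\<bar> / 2"
    by (rule tendstoD[OF lim e])
  moreover have "\<forall>\<^sub>F y in nhds x. y \<in> S" using S by (intro eventually_nhds_in_open)
  ultimately have "\<forall>\<^sub>F y in nhds x. y \<in> S \<and> dist (a u v y) (a u v x) < \<bar>a u v x - a v u x\<bar> / 2
      \<and> dist (a v u y) (a v u x) < \<bar>a u v x - a v u x\<bar> / 2"
    by eventually_elim simp
  then obtain d where d: "d > 0" "\<And>y. dist y x < d \<Longrightarrow> y \<in> S \<and> dist (a u v y) (a u v x) < \<bar>a u v x - a v u x\<bar> / 2
      \<and> dist (a v u y) (a v u x) < \<bar>a u v x - a v u x\<bar> / 2"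
    unfolding eventually_nhds_metric by blast
  have fd: "Cinf_on (ball x d) f"
    by (rule Cinf_on_subset[OF f]) (use d(2) in \<open>auto simp: dist_commute\<close>)
  \<comment> \<open>The summand 1 keeps the denominator positive when both vectors vanish and makes
    the bound by \<open>d\<close> strict.\<close>
  define h where "h = d / (norm u + norm v + 1)"
  have h: "h > 0" "h * (norm u + norm v) < d" "h * (norm v + norm u) < d"
    using d(1) by (auto simp: h_def field_simps add_pos_nonneg intro!: divide_pos_pos)
  obtain y1 where y1: "y1 \<in> ball x d" "f (x + h *\<^sub>R u + h *\<^sub>R v) - f (x + h *\<^sub>R u) - f (x + h *\<^sub>R v) + f x
    = h\<^sup>2 * a u v y1" using second_difference[OF fd h(1,2)] unfolding a_def by blast
  obtain y2 where y2: "y2 \<in> ball x d" "f (x + h *\<^sub>R v + h *\<^sub>R u) - f (x + h *\<^sub>R v) - f (x + h *\<^sub>R u) + f x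
    = h\<^sup>2 * a v u y2" using second_difference[OF fd h(1,3)] unfolding a_def by blast
  have "f (x + h *\<^sub>R v + h *\<^sub>R u) = f (x + h *\<^sub>R u + h *\<^sub>R v)" by (simp add: add.commute add.left_commute)
  with y1(2) y2(2) have "h\<^sup>2 * a u v y1 = h\<^sup>2 * a v u y2" by linarith
  then have "a u v y1 = a v u y2" using h(1) by simp
  moreover have "dist (a u v y1) (a u v x) < \<bar>a u v x - a v u x\<bar> / 2" "dist (a v u y2) (a v u x) < \<bar>a u v x - a v u x\<bar> / 2"
    using d(2)[of y1] d(2)[of y2] y1(1) y2(1) by (simp_all add: dist_commute[of x])
  moreover have "\<bar>a u v x - a v u x\<bar> \<le> dist (a u v y1) (a u v x) + dist (a u v y1) (a v u x)"
    using dist_triangle3[of "a u v x" "a v u x" "a u v y1"] by (simp add: dist_real_def)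
  ultimately show False by simp
qed

section \<open>Monodromy on simply connected spaces\<close>

text \<open>A cover by open sets carrying real functions whose differences are locally constant:
  the primitives of a closed form are the example. A section over a map \<open>k\<close> differs from each
  \<open>F \<circ> k\<close> by a locally constant function.\<close>

locale local_primitives =
  fixes \<F> :: "('m::topological_space set \<times> ('m \<Rightarrow> real)) set"
  assumes open_dom: "(N, F) \<in> \<F> \<Longrightarrow> open N"
    and cover: "\<exists>N F. (N, F) \<in> \<F> \<and> q \<in> N"
    and compat: "(N, F) \<in> \<F> \<Longrightarrow> (N', F') \<in> \<F> \<Longrightarrow> q \<in> N \<Longrightarrow> q \<in> N' \<Longrightarrow>
      \<forall>\<^sub>F x in nhds q. F x - F' x = F q - F' q"
begin

definition section_over :: "'a::topological_space set \<Rightarrow> ('a \<Rightarrow> 'm) \<Rightarrow> ('a \<Rightarrow> real) \<Rightarrow> bool" where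
  "section_over S k h \<longleftrightarrow> (\<forall>s\<in>S. \<forall>(N, F)\<in>\<F>. k s \<in> N \<longrightarrow>
     (\<forall>\<^sub>F t in at s within S. h t - F (k t) = h s - F (k s)))"

lemma section_overD:
  "section_over S k h \<Longrightarrow> s \<in> S \<Longrightarrow> (N, F) \<in> \<F> \<Longrightarrow> k s \<in> N \<Longrightarrow>
     \<forall>\<^sub>F t in at s within S. h t - F (k t) = h s - F (k s)"
  unfolding section_over_def by blast

lemma eventually_pullback:
  assumes "continuous_on S k" "s \<in> S" "\<forall>\<^sub>F x in nhds (k s). Q x"
  shows "\<forall>\<^sub>F t in at s within S. Q (k t)"
proof (rule eventually_compose_filterlim[OF assms(3)])
  show "filterlim k (nhds (k s)) (at s within S)"
    using assms(1,2) by (simp add: continuous_on_def)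
qed

lemma section_over_local:
  assumes "(N, F) \<in> \<F>" "continuous_on S k" "k ` S \<subseteq> N"
  shows "section_over S k (\<lambda>t. F (k t))"
  unfolding section_over_def
proof clarify
  fix s N' F' assume "s \<in> S" "(N', F') \<in> \<F>" "k s \<in> N'"
  then show "\<forall>\<^sub>F t in at s within S. F (k t) - F' (k t) = F (k s) - F' (k s)"
    using eventually_pullback[OF assms(2) _ compat[OF assms(1)]] assms(3) by blast
qed

lemma section_over_compose:
  assumes "section_over S k h" "continuous_on S' j" "j ` S' \<subseteq> S"
  shows "section_over S' (\<lambda>t. k (j t)) (\<lambda>t. h (j t))"
  unfolding section_over_def
proof clarify
  fix s N F assume s: "s \<in> S'" and N: "(N, F) \<in> \<F>" "k (j s) \<in> N"
  have "\<forall>\<^sub>F t in at (j s) within S. h t - F (k t) = h (j s) - F (k (j s))"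
    by (rule section_overD[OF assms(1) _ N]) (use s assms(3) in auto)
  \<comment> \<open>\<open>j\<close> may take the value \<open>j s\<close> at points other than
    \<open>s\<close>, so the punctured filter is first replaced by the full neighbourhood filter; at
    \<open>j s\<close> itself the equation is trivial.\<close>
  then have "\<forall>\<^sub>F t in nhds (j s). t \<in> S \<longrightarrow> h t - F (k t) = h (j s) - F (k (j s))"
    unfolding eventually_at_filter by (rule eventually_mono) auto
  from eventually_pullback[OF assms(2) s this]
  show "\<forall>\<^sub>F t in at s within S'. h (j t) - F (k (j t)) = h (j s) - F (k (j s))"
    unfolding eventually_at_filter by (rule eventually_mono) (use assms(3) in auto)
qed

lemma section_over_unique:
  assumes "section_over S k h" "section_over S k h'" "connected S" "s \<in> S" "t \<in> S"
  shows "h s - h' s = h t - h' t"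
proof (rule connected_local_const[OF assms(3-5), of "\<lambda>s. h s - h' s"])
  show "\<forall>s\<in>S. \<forall>\<^sub>F t in at s within S. h s - h' s = h t - h' t"
  proof
    fix s assume s: "s \<in> S"
    obtain N F where N: "(N, F) \<in> \<F>" "k s \<in> N" using cover by blast
    show "\<forall>\<^sub>F t in at s within S. h s - h' s = h t - h' t"
      using section_overD[OF assms(1) s N] section_overD[OF assms(2) s N]
      by eventually_elim simp
  qed
qed

lemma section_over_cong:
  "section_over S k h \<Longrightarrow> (\<And>t. t \<in> S \<Longrightarrow> k t = k' t) \<Longrightarrow> section_over S k' h"
  unfolding section_over_def eventually_at_filter
  by (fastforce elim!: eventually_mono)

text \<open>On the connected overlap the two sections differ by a constant, and the second one is
  shifted by it; for an empty overlap any constant will do. Closedness handles a point outside one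
  of the sets: the condition within that set is void near it.\<close>

lemma section_over_union:
  assumes 1: "section_over S1 k h1" "closed S1" and 2: "section_over S2 k h2" "closed S2"
    and conn: "connected (S1 \<inter> S2)"
  shows "\<exists>h. section_over (S1 \<union> S2) k h"
proof -
  have sub: "section_over (S1 \<inter> S2) k h1" "section_over (S1 \<inter> S2) k h2"
    using section_over_compose[OF 1(1), of "S1 \<inter> S2" "\<lambda>x. x"]
      section_over_compose[OF 2(1), of "S1 \<inter> S2" "\<lambda>x. x"] by auto
  obtain c where c: "\<And>s. s \<in> S1 \<Longrightarrow> s \<in> S2 \<Longrightarrow> h1 s = h2 s + c"
  proof (cases "S1 \<inter> S2 = {}")
    case False
    then obtain s0 where "s0 \<in> S1 \<inter> S2" by blast
    then have "h1 s - h2 s = h1 s0 - h2 s0" if "s \<in> S1" "s \<in> S2" for s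
      using section_over_unique[OF sub conn, of s s0] that by blast
    then show ?thesis by (intro that[of "h1 s0 - h2 s0"]) (simp add: algebra_simps)
  qed (use that in blast)
  define h where "h t = (if t \<in> S1 then h1 t else h2 t + c)" for t
  have on2: "h t = h2 t + c" if "t \<in> S2" for t using c that by (auto simp: h_def)
  have triv: "\<forall>\<^sub>F t in at s within S. Q t" if "closed S" "s \<notin> S" for S :: "'a set" and s Q
  proof -
    have "\<forall>\<^sub>F t in nhds s. t \<in> - S" using that by (intro eventually_nhds_in_open) auto
    then show ?thesis unfolding eventually_at_filter by (rule eventually_mono) auto
  qed
  have "section_over (S1 \<union> S2) k h" unfolding section_over_def
  proof clarify
    fix s N F assume s: "s \<in> S1 \<union> S2" and N: "(N, F) \<in> \<F>" "k s \<in> N"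
    have "\<forall>\<^sub>F t in at s within S1. h t - F (k t) = h s - F (k s)"
    proof (cases "s \<in> S1")
      case True
      show ?thesis using section_overD[OF 1(1) True N]
        unfolding eventually_at_filter by (rule eventually_mono) (auto simp: h_def True)
    qed (use triv 1 in blast)
    moreover have "\<forall>\<^sub>F t in at s within S2. h t - F (k t) = h s - F (k s)"
    proof (cases "s \<in> S2")
      case True
      show ?thesis using section_overD[OF 2(1) True N]
        unfolding eventually_at_filter by (rule eventually_mono) (auto simp: on2 True)
    qed (use triv 2 in blast)
    ultimately show "\<forall>\<^sub>F t in at s within S1 \<union> S2. h t - F (k t) = h s - F (k s)"
      by (simp add: at_within_union eventually_sup)
  qed
  then show ?thesis by blast
qed

text \<open>\<open>B a b\<close> stands for the block over the interval from \<open>a\<close> to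
  \<open>b\<close>, and bisection by \<open>Bolzano\<close> replaces an explicit subdivision. The
  family is left general so that it can run over either coordinate of a square.\<close>

lemma section_over_subdivision:
  assumes e: "(\<epsilon>::real) > 0"
    and small: "\<And>a b. 0 \<le> a \<Longrightarrow> a \<le> b \<Longrightarrow> b \<le> 1 \<Longrightarrow> b - a < \<epsilon> \<Longrightarrow> \<exists>h. section_over (B a b) k h"
    and glue: "\<And>x y z. x \<le> y \<Longrightarrow> y \<le> z \<Longrightarrow> B x y \<union> B y z = B x z \<and> connected (B x y \<inter> B y z)"
    and cl: "\<And>x y. closed (B x y)"
  shows "\<exists>h. section_over (B 0 1) k h"
proof -
  have "(0::real) \<le> 1" by simp
  then have "0 \<le> (0::real) \<and> (0::real) \<le> 1 \<and> 1 \<le> (1::real) \<longrightarrow> (\<exists>h. section_over (B 0 1) k h)"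
  proof (induction rule: Bolzano[where P = "\<lambda>c d. 0 \<le> c \<and> c \<le> d \<and> d \<le> 1 \<longrightarrow> (\<exists>h. section_over (B c d) k h)"])
    case (trans x y z)
    show ?case
    proof
      assume xz: "0 \<le> x \<and> x \<le> z \<and> z \<le> 1"
      obtain h1 h2 where h: "section_over (B x y) k h1" "section_over (B y z) k h2"
        using trans xz by auto
      show "\<exists>h. section_over (B x z) k h"
        using section_over_union[OF h(1) cl h(2) cl] glue[OF trans(3,4)] by metis
    qed
  next
    case (local x)
    show ?case using e small by (intro exI[of _ \<epsilon>]) auto
  qed
  then show ?thesis by simp
qed

text \<open>A rectangle below the Lebesgue number of the cover is mapped into a single domain and
  carries a section. Rectangles are glued to strips along one coordinate and strips to the square
  along the other; consecutive blocks meet in a segment or a point, which is connected.\<close>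

lemma section_over_square:
  fixes k :: "real \<times> real \<Rightarrow> 'm"
  assumes k: "continuous_on ({0..1} \<times> {0..1}) k"
  shows "\<exists>h. section_over ({0..1} \<times> {0..1}) k h"
proof -
  let ?Q = "{0..1::real} \<times> {0..1::real}"
  define \<G> where "\<G> = {T. open T \<and> (\<exists>N F. (N, F) \<in> \<F> \<and> k ` (?Q \<inter> T) \<subseteq> N)}"
  have "?Q \<subseteq> \<Union>\<G>"
  proof
    fix x assume x: "x \<in> ?Q"
    obtain N F where N: "(N, F) \<in> \<F>" "k x \<in> N" using cover by blast
    obtain T where "open T" "T \<inter> ?Q = k -` N \<inter> ?Q"
      using k open_dom[OF N(1)] unfolding continuous_on_open_invariant by blast
    then have "T \<in> \<G>" "x \<in> T" using N x by (auto simp: \<G>_def)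
    then show "x \<in> \<Union>\<G>" by blast
  qed
  moreover have "compact ?Q" by (intro compact_Times) auto
  moreover have "open T" if "T \<in> \<G>" for T using that by (simp add: \<G>_def)
  ultimately obtain \<epsilon> where e: "\<epsilon> > 0" "\<And>x. x \<in> ?Q \<Longrightarrow> \<exists>T\<in>\<G>. ball x \<epsilon> \<subseteq> T"
    by (metis Heine_Borel_lemma)
  \<comment> \<open>Each side gets half the Lebesgue number, because the product distance is at most
    the sum of the coordinate distances.\<close>
  have small: "\<exists>h. section_over ({a..b} \<times> {c..d}) k h"
    if ab: "0 \<le> a" "a \<le> b" "b \<le> 1" "b - a < \<epsilon>/2" and cd: "0 \<le> c" "c \<le> d" "d \<le> 1" "d - c < \<epsilon>/2"
    for a b c d
  proof -
    obtain T where T: "T \<in> \<G>" "ball (a, c) \<epsilon> \<subseteq> T" using e(2)[of "(a, c)"] ab cd by auto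
    obtain N F where N: "(N, F) \<in> \<F>" "k ` (?Q \<inter> T) \<subseteq> N" using T by (auto simp: \<G>_def)
    have "(x, y) \<in> ball (a, c) \<epsilon>" if "x \<in> {a..b}" "y \<in> {c..d}" for x y
    proof -
      have "dist (a, c) (x, y) \<le> dist a x + dist c y"
        unfolding dist_Pair_Pair by (rule sqrt_sum_squares_le_sum) auto
      also have "\<dots> < \<epsilon>" using that ab(4) cd(4) by (auto simp: dist_real_def)
      finally show ?thesis by simp
    qed
    then have sub: "{a..b} \<times> {c..d} \<subseteq> ?Q \<inter> T" using T(2) ab cd by fastforce
    have "section_over ({a..b} \<times> {c..d}) k (\<lambda>t. F (k t))"
      by (rule section_over_local[OF N(1) continuous_on_subset[OF k]]) (use sub N(2) in blast)+
    then show ?thesis by blast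
  qed
  have conn: "connected ({a..b} \<times> {c..d})" for a b c d :: real
    by (intro convex_connected convex_Times convex_real_interval)
  have strip: "\<exists>h. section_over ({a..b} \<times> {0..1}) k h"
    if ab: "0 \<le> a" "a \<le> b" "b \<le> 1" "b - a < \<epsilon>/2" for a b
  proof (rule section_over_subdivision[where B = "\<lambda>c d. {a..b} \<times> {c..d}" and \<epsilon> = "\<epsilon>/2"])
    fix x y z :: real assume "x \<le> y" "y \<le> z"
    then have "{a..b} \<times> {x..y} \<union> {a..b} \<times> {y..z} = {a..b} \<times> {x..z}"
      "{a..b} \<times> {x..y} \<inter> {a..b} \<times> {y..z} = {a..b} \<times> {y..y}" by auto
    then show "{a..b} \<times> {x..y} \<union> {a..b} \<times> {y..z} = {a..b} \<times> {x..z} \<and>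
        connected ({a..b} \<times> {x..y} \<inter> {a..b} \<times> {y..z})" using conn[of a b y y] by presburger
  qed (use e(1) small[OF ab] in \<open>auto intro: closed_Times\<close>)
  show ?thesis
  proof (rule section_over_subdivision[where B = "\<lambda>c d. {c..d} \<times> {0..1}" and \<epsilon> = "\<epsilon>/2"])
    fix x y z :: real assume "x \<le> y" "y \<le> z"
    then have "{x..y} \<times> {0..1} \<union> {y..z} \<times> {0..1} = {x..z} \<times> {0..1::real}"
      "{x..y} \<times> {0..1} \<inter> {y..z} \<times> {0..1} = {y..y} \<times> {0..1::real}" by auto
    then show "{x..y} \<times> {0..1} \<union> {y..z} \<times> {0..1} = {x..z} \<times> {0..1::real} \<and>
        connected ({x..y} \<times> {0..1} \<inter> {y..z} \<times> {0..1::real})" using conn[of y y 0 1] by presburger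
  qed (use e(1) strip in \<open>auto intro: closed_Times\<close>)
qed

text \<open>The path is read as a square that is constant in its first coordinate, and the section
  is restricted to one side.\<close>

lemma section_over_path:
  assumes "path g" shows "\<exists>h. section_over {0..1::real} g h"
proof -
  have "continuous_on ({0..1} \<times> {0..1}) (\<lambda>z::real\<times>real. g (snd z))"
    by (rule continuous_on_compose2[OF assms[unfolded path_def]]) (auto intro!: continuous_intros)
  then obtain h where "section_over ({0..1} \<times> {0..1}) (\<lambda>z::real\<times>real. g (snd z)) h"
    using section_over_square by blast
  then have "section_over {0..1} (\<lambda>t. g (snd (0::real, t))) (\<lambda>t. h (0, t))"
    by (rule section_over_compose) (auto intro!: continuous_intros)
  then show ?thesis by auto
qed

text \<open>For local primitives of a closed form this is its integral along the path; by
  \<open>period_eq\<close> the choice of the section does not matter.\<close>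

definition period :: "(real \<Rightarrow> 'm) \<Rightarrow> real" where
  "period g = (let h = SOME h. section_over {0..1} g h in h 1 - h 0)"

lemma period_eq:
  assumes "section_over {0..1} g h" shows "period g = h 1 - h 0"
proof -
  have s: "section_over {0..1} g (SOME h. section_over {0..1} g h)" by (rule someI[of "section_over {0..1} g", OF assms])
  show ?thesis using section_over_unique[OF s assms, of 0 1] by (simp add: period_def Let_def)
qed

lemma period_join:
  assumes "path g" "path g'" "pathfinish g = pathstart g'"
  shows "period (g +++ g') = period g + period g'"
proof -
  obtain h where h: "section_over {0..1} (g +++ g') h"
    using section_over_path path_join assms by blast
  have "section_over {0..1} (\<lambda>t. (g +++ g') (t / 2)) (\<lambda>t. h (t / 2))"
    by (rule section_over_compose[OF h]) (auto intro!: continuous_intros)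
  then have 1: "section_over {0..1} g (\<lambda>t. h (t / 2))"
    by (rule section_over_cong) (auto simp: joinpaths_def)
  have "section_over {0..1} (\<lambda>t. (g +++ g') ((t + 1) / 2)) (\<lambda>t. h ((t + 1) / 2))"
    by (rule section_over_compose[OF h]) (auto intro!: continuous_intros)
  then have 2: "section_over {0..1} g' (\<lambda>t. h ((t + 1) / 2))"
    by (rule section_over_cong)
      (use assms(3) in \<open>auto simp: joinpaths_def pathstart_def pathfinish_def field_simps\<close>)
  show ?thesis using period_eq[OF h] period_eq[OF 1] period_eq[OF 2] by simp
qed

lemma period_reversepath:
  assumes "path g" shows "period (reversepath g) = - period g"
proof -
  obtain h where h: "section_over {0..1} g h" using section_over_path assms by blast
  have "section_over {0..1} (\<lambda>t. g (1 - t)) (\<lambda>t. h (1 - t))"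
    by (rule section_over_compose[OF h]) (auto intro!: continuous_intros)
  from period_eq[OF this] show ?thesis
    using period_eq[OF h] by (simp add: reversepath_def)
qed

lemma period_local:
  assumes "(N, F) \<in> \<F>" "path g" "path_image g \<subseteq> N"
  shows "period g = F (pathfinish g) - F (pathstart g)"
  using period_eq[OF section_over_local[OF assms(1), of "{0..1}" g]] assms(2,3)
  by (simp add: path_def path_image_def pathstart_def pathfinish_def)

text \<open>A section over a homotopy to a constant loop is compared on its boundary. The two sides
  traced by the base point are the same path, so the increment around the loop is equal at both ends
  of the homotopy, and on the constant loop it is 0.\<close>

lemma period_loop:
  assumes sc: "simply_connected (UNIV :: 'm set)" and g: "path g" "pathfinish g = pathstart g"
  shows "period g = 0"
proof -
  have "homotopic_loops UNIV g (\<lambda>t. g 0)"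
    using sc g unfolding simply_connected_def
    by (simp add: path_def pathstart_def pathfinish_def continuous_on_const)
  then obtain K :: "real \<times> real \<Rightarrow> 'm" where K: "continuous_on ({0..1} \<times> {0..1}) K"
    "\<And>x. x \<in> {0..1} \<Longrightarrow> K (0, x) = g x" "\<And>x. x \<in> {0..1} \<Longrightarrow> K (1, x) = g 0"
    "\<And>t. t \<in> {0..1} \<Longrightarrow> K (t, 1) = K (t, 0)"
    unfolding homotopic_loops by (auto simp: pathfinish_def pathstart_def)
  obtain H where H: "section_over ({0..1} \<times> {0..1}) K H" using section_over_square[OF K(1)] by blast
  have H1: "section_over {0..1} (\<lambda>t. K (t, 1)) (\<lambda>t. H (t, 1))"
    by (rule section_over_compose[OF H]) (auto intro!: continuous_intros)
  have "section_over {0..1} (\<lambda>t. K (t, 0)) (\<lambda>t. H (t, 0))"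
    by (rule section_over_compose[OF H]) (auto intro!: continuous_intros)
  then have H0: "section_over {0..1} (\<lambda>t. K (t, 1)) (\<lambda>t. H (t, 0))"
    by (rule section_over_cong) (use K(4) in auto)
  have a: "H (0, 1) - H (0, 0) = H (1, 1) - H (1, 0)"
    using section_over_unique[OF H1 H0, of 0 1] by auto
  have "section_over {0..1} (\<lambda>t. K (1, t)) (\<lambda>t. H (1, t))"
    by (rule section_over_compose[OF H]) (auto intro!: continuous_intros)
  then have c: "section_over {0..1} (\<lambda>t. g 0) (\<lambda>t. H (1, t))"
    by (rule section_over_cong) (use K(3) in auto)
  obtain N F where N: "(N, F) \<in> \<F>" "g 0 \<in> N" using cover by blast
  have "section_over {0..1} (\<lambda>t::real. g 0) (\<lambda>t. F (g 0))"
    by (rule section_over_local[OF N(1)]) (use N in auto)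
  from section_over_unique[OF c this, of 0 1] have b: "H (1, 1) = H (1, 0)"
    by simp
  have "section_over {0..1} (\<lambda>t. K (0, t)) (\<lambda>t. H (0, t))"
    by (rule section_over_compose[OF H]) (auto intro!: continuous_intros)
  then have "section_over {0..1} g (\<lambda>t. H (0, t))"
    by (rule section_over_cong) (use K(2) in auto)
  from period_eq[OF this] a b show ?thesis by simp
qed

text \<open>The value at \<open>m\<close> is the period of a chosen path from a base point to
  \<open>m\<close>. Choices made at nearby points are unrelated, but they close up to a loop with a
  short path inside a path connected neighbourhood, and the period of that loop vanishes.\<close>

lemma global_primitive:
  assumes sc: "simply_connected (UNIV :: 'm set)" and pc: "path_connected (UNIV :: 'm set)"
    and lpc: "\<And>(q :: 'm) N. open N \<Longrightarrow> q \<in> N \<Longrightarrow> \<exists>W. open W \<and> q \<in> W \<and> W \<subseteq> N \<and> path_connected W"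
  shows "\<exists>f. \<forall>(N, F)\<in>\<F>. \<forall>q\<in>N. \<forall>\<^sub>F x in nhds q. f x - F x = f q - F q"
proof -
  obtain p0 :: 'm where True by blast
  have "\<forall>m. \<exists>g. path g \<and> pathstart g = p0 \<and> pathfinish g = m"
    using pc unfolding path_connected_def by auto
  then obtain g where g: "\<And>m. path (g m)" "\<And>m. pathstart (g m) = p0" "\<And>m. pathfinish (g m) = m"
    by metis
  show ?thesis
  proof (rule exI[of _ "\<lambda>m. period (g m)"], clarify)
    fix N F q assume N: "(N, F) \<in> \<F>" "q \<in> N"
    obtain W where W: "open W" "q \<in> W" "W \<subseteq> N" "path_connected W" using lpc[OF open_dom[OF N(1)] N(2)] by blast
    have "period (g x) - F x = period (g q) - F q" if x: "x \<in> W" for x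
    proof -
      obtain d where d: "path d" "path_image d \<subseteq> W" "pathstart d = q" "pathfinish d = x"
        using W(4)[unfolded path_connected_def, rule_format, OF W(2) x] by blast
      have "period (g q +++ (d +++ reversepath (g x))) = 0"
        by (rule period_loop[OF sc]) (use g d in auto)
      then have "period (g q) + (period d - period (g x)) = 0"
        using g d by (simp add: period_join period_reversepath)
      moreover have "period d = F x - F q"
        using period_local[OF N(1) d(1)] d W(3) by auto
      ultimately show ?thesis by simp
    qed
    then show "\<forall>\<^sub>F x in nhds q. period (g x) - F x = period (g q) - F q"
      using W(1,2) unfolding eventually_nhds by blast
  qed
qed

end

text \<open>Simple connectedness is a statement on free homotopy of loops. For two constant loops,
  the track of the base point during the homotopy is a path between their values.\<close>

lemma simply_connected_UNIV_imp_path_connected: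
  assumes "simply_connected (UNIV :: 'm::topological_space set)"
  shows "path_connected (UNIV :: 'm set)"
  unfolding path_connected_def
proof (intro ballI)
  fix x y :: 'm
  have "homotopic_loops UNIV (\<lambda>t. x) (\<lambda>t. y)"
    using assms unfolding simply_connected_def by (simp add: path_def pathstart_def pathfinish_def)
  then obtain K :: "real \<times> real \<Rightarrow> 'm" where K: "continuous_on ({0..1} \<times> {0..1}) K"
    "\<And>t. t \<in> {0..1} \<Longrightarrow> K (0, t) = x" "\<And>t. t \<in> {0..1} \<Longrightarrow> K (1, t) = y"
    unfolding homotopic_loops by auto
  have "path (\<lambda>t. K (t, 0))" unfolding path_def
    by (rule continuous_on_compose2[OF K(1)]) (auto intro!: continuous_intros)
  then show "\<exists>g. path g \<and> path_image g \<subseteq> UNIV \<and> pathstart g = x \<and> pathfinish g = y"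
    using K(2,3) by (intro exI[of _ "\<lambda>t. K (t, 0)"]) (simp add: pathstart_def pathfinish_def)
qed

section \<open>Smooth manifolds in charts\<close>

lemma projection_onto_subspace:
  fixes V :: "'a::euclidean_space set"
  assumes "subspace V"
  obtains P where "linear P" "\<And>x. P x \<in> V" "\<And>x. x \<in> V \<Longrightarrow> P x = x"
proof -
  obtain B where B: "B \<subseteq> V" "pairwise orthogonal B" "\<And>x. x \<in> B \<Longrightarrow> norm x = 1"
    "independent B" "card B = dim V" "span B = V"
    using orthonormal_basis_subspace[OF assms] by metis
  have fin: "finite B" using B(4) independent_imp_finite by blast
  define P where "P x = (\<Sum>b\<in>B. (x \<bullet> b) *\<^sub>R b)" for x
  have lin: "linear P" unfolding P_def
    by (rule linearI) (simp_all add: inner_left_distrib scaleR_left_distrib sum.distrib scaleR_right.sum)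
  have "P b = b" if "b \<in> B" for b
  proof -
    have "P b = (\<Sum>c\<in>B. if c = b then b else 0)" unfolding P_def
    proof (rule sum.cong[OF refl])
      fix c assume "c \<in> B"
      then show "(b \<bullet> c) *\<^sub>R c = (if c = b then b else 0)"
        using B(2,3) that by (auto simp: pairwise_def orthogonal_def dot_square_norm)
    qed
    then show ?thesis using fin that by simp
  qed
  then have "P x = x" if "x \<in> span B" for x
    using linear_eq_on[OF lin linear_ident that] by simp
  moreover have "P x \<in> V" for x unfolding P_def
    by (intro subspace_sum[OF assms] subspace_scale[OF assms]) (use B in auto)
  ultimately show ?thesis using that lin B(6) by blast
qed

text \<open>A projection \<open>P\<close> onto the model space \<open>V\<close> turns the inverse of a chart into a map \<open>par\<close>
  defined on an open subset of the ambient space, so smoothness becomes smoothness on open sets.\<close>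

locale charted =
  fixes A :: "('m::{t2_space,second_countable_topology}, 'e::euclidean_space) atlas"
    and P :: "'e \<Rightarrow> 'e"
  assumes linear_P: "linear P"
    and idem_P [simp]: "P (P x) = P x"
    and covered: "\<exists>U \<phi>. (U, \<phi>) \<in> A \<and> p \<in> U"
    and open_chart: "(U, \<phi>) \<in> A \<Longrightarrow> open U"
    and open_image: "(U, \<phi>) \<in> A \<Longrightarrow> open (P -` (\<phi> ` U))"
    and chart_homeo: "(U, \<phi>) \<in> A \<Longrightarrow> homeomorphism U (\<phi> ` U) \<phi> (inv_into U \<phi>)"
    and P_chart: "(U, \<phi>) \<in> A \<Longrightarrow> q \<in> U \<Longrightarrow> P (\<phi> q) = \<phi> q"
    and smooth_transition: "(U, \<phi>) \<in> A \<Longrightarrow> (W, \<psi>) \<in> A \<Longrightarrow>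
       smooth_on (\<phi> ` (U \<inter> W)) (\<psi> \<circ> inv_into U \<phi>)"

lemma smooth_manifold_charted:
  assumes "smooth_manifold A" shows "\<exists>P. charted A P"
proof -
  obtain V where V: "subspace V" and "\<forall>(U, \<phi>)\<in>A. open U \<and>
      openin (top_of_set V) (\<phi> ` U) \<and> homeomorphism U (\<phi> ` U) \<phi> (inv_into U \<phi>)"
    using assms unfolding smooth_manifold_def by (elim conjE exE)
  then have ch: "open U \<and> openin (top_of_set V) (\<phi> ` U) \<and>
      homeomorphism U (\<phi> ` U) \<phi> (inv_into U \<phi>)" if "(U, \<phi>) \<in> A" for U \<phi>
    using that by auto
  obtain P where P: "linear P" "\<And>x. P x \<in> V" "\<And>x. x \<in> V \<Longrightarrow> P x = x"
    using projection_onto_subspace[OF V] by metis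
  have "charted A P"
  proof
    fix U \<phi> assume U: "(U, \<phi>) \<in> A"
    obtain T where T: "open T" "\<phi> ` U = V \<inter> T" using ch[OF U] by (auto simp: openin_open)
    have "P -` (\<phi> ` U) = P -` T" using T(2) P(2) by auto
    moreover have "open (P -` T)"
      by (rule continuous_open_vimage[OF T(1)])
        (rule linear_continuous_at[OF linear_conv_bounded_linear[THEN iffD1, OF P(1)]])
    ultimately show "open (P -` \<phi> ` U)" by simp
    show "P (\<phi> q) = \<phi> q" if "q \<in> U" for q
      using T(2) P(3) that by blast
  next
    show "\<exists>U \<phi>. (U, \<phi>) \<in> A \<and> p \<in> U" for p
    proof -
      have "p \<in> (\<Union>(U, \<phi>)\<in>A. U)" using assms by (simp add: smooth_manifold_def)
      then show ?thesis by blast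
    qed
    show "smooth_on (\<phi> ` (U \<inter> W)) (\<psi> \<circ> inv_into U \<phi>)" if "(U, \<phi>) \<in> A" "(W, \<psi>) \<in> A" for U \<phi> W \<psi>
      using assms that unfolding smooth_manifold_def by fast
  qed (use P ch in \<open>auto simp: linear_add linear_scale\<close>)
  then show ?thesis by blast
qed

context charted
begin

text \<open>The chart image thickened along the fibres of \<open>P\<close>. This set is open in the
  ambient space, and \<open>par\<close> is constant along those fibres.\<close>

definition Om :: "'m set \<Rightarrow> ('m \<Rightarrow> 'e) \<Rightarrow> 'e set" where
  "Om U \<phi> = P -` (\<phi> ` U)"

definition par :: "'m set \<Rightarrow> ('m \<Rightarrow> 'e) \<Rightarrow> 'e \<Rightarrow> 'm" where
  "par U \<phi> x = inv_into U \<phi> (P x)"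

lemma bounded_linear_P: "bounded_linear P"
  using linear_P linear_conv_bounded_linear by blast

lemma Cinf_on_P: "Cinf_on S P"
  by (rule Cinf_on_bounded_linear[OF bounded_linear_P])

lemma open_vimage_P: "open T \<Longrightarrow> open (P -` T)"
  by (erule continuous_open_vimage) (rule linear_continuous_at[OF bounded_linear_P])

context
  fixes U \<phi> assumes U: "(U, \<phi>) \<in> A"
begin

lemma inj_chart: "inj_on \<phi> U"
  using chart_homeo[OF U] by (auto simp: homeomorphism_def intro: inj_on_inverseI)

lemma open_Om: "open (Om U \<phi>)"
  using open_image[OF U] by (simp add: Om_def)

lemma par_in: "x \<in> Om U \<phi> \<Longrightarrow> par U \<phi> x \<in> U"
  by (auto simp: Om_def par_def inv_into_into)

lemma chart_par: "x \<in> Om U \<phi> \<Longrightarrow> \<phi> (par U \<phi> x) = P x"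
  by (auto simp: Om_def par_def f_inv_into_f)

lemma par_chart: "q \<in> U \<Longrightarrow> par U \<phi> (\<phi> q) = q"
  using inj_chart by (simp add: par_def P_chart[OF U])

lemma chart_in_Om: "q \<in> U \<Longrightarrow> \<phi> q \<in> Om U \<phi>"
  by (simp add: Om_def P_chart[OF U])

lemma continuous_on_chart: "continuous_on U \<phi>"
  using chart_homeo[OF U] by (simp add: homeomorphism_def)

lemma continuous_on_par: "continuous_on (Om U \<phi>) (par U \<phi>)"
proof -
  have "continuous_on (\<phi> ` U) (inv_into U \<phi>)" using chart_homeo[OF U] by (simp add: homeomorphism_def)
  then show ?thesis unfolding par_def
    by (rule continuous_on_compose2) (auto simp: Om_def linear_continuous_on[OF bounded_linear_P])
qed

lemma open_chart_vimage: "open N \<Longrightarrow> open {q \<in> U. \<phi> q \<in> N}"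
  using continuous_openin_preimage_gen[OF continuous_on_chart, of N] open_chart[OF U]
  by (simp add: openin_open_eq vimage_def Int_def)

lemma open_par_vimage: "open W \<Longrightarrow> open {x \<in> Om U \<phi>. par U \<phi> x \<in> W}"
  using continuous_openin_preimage_gen[OF continuous_on_par, of W] open_Om
  by (simp add: openin_open_eq vimage_def Int_def)

text \<open>A local extension of \<open>F\<close> is known to agree with it only on the chart image.
  Precomposing with \<open>P\<close> sends a full ambient neighbourhood into that image, so the
  agreement holds on an open set.\<close>

lemma Cinf_on_par_if_smooth_on:
  fixes F :: "'e \<Rightarrow> 'k::real_normed_vector"
  assumes "open W" "smooth_on (\<phi> ` (U \<inter> W)) F"
  shows "Cinf_on {x \<in> Om U \<phi>. par U \<phi> x \<in> W} (\<lambda>x. F (P x))"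
proof (rule Cinf_on_local)
  fix x assume x: "x \<in> {x \<in> Om U \<phi>. par U \<phi> x \<in> W}"
  have Px: "P x' \<in> \<phi> ` (U \<inter> W)" if "x' \<in> {x \<in> Om U \<phi>. par U \<phi> x \<in> W}" for x'
    using that chart_par[of x'] par_in[of x'] by (auto intro: rev_image_eqI)
  obtain T g where T: "open T" "P x \<in> T" "Cinf_on T g"
    "\<And>y. y \<in> \<phi> ` (U \<inter> W) \<Longrightarrow> y \<in> T \<Longrightarrow> F y = g y"
    using assms(2)[unfolded smooth_on_def, rule_format, OF Px[OF x]]
    by (auto simp: Cinf_on_def)
  let ?T = "{x \<in> Om U \<phi>. par U \<phi> x \<in> W} \<inter> P -` T"
  have oT: "open ?T" using open_par_vimage[OF assms(1)] open_vimage_P[OF T(1)] by blast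
  have "Cinf_on ?T (\<lambda>x. g (P x))"
    by (rule Cinf_on_compose[OF T(3) Cinf_on_P]) auto
  then have "Cinf_on ?T (\<lambda>x. F (P x))"
    by (rule Cinf_on_cong[OF oT, rotated]) (use T(4) Px in auto)
  then show "\<exists>T. open T \<and> x \<in> T \<and> Cinf_on T (\<lambda>x. F (P x))" using oT T(2) x by blast
qed

end

lemma Cinf_on_transition:
  assumes "(U, \<phi>) \<in> A" "(W, \<psi>) \<in> A"
  shows "Cinf_on {x \<in> Om U \<phi>. par U \<phi> x \<in> W} (\<lambda>x. \<psi> (par U \<phi> x))"
  using Cinf_on_par_if_smooth_on[OF assms(1) open_chart[OF assms(2)] smooth_transition[OF assms]]
  by (simp add: par_def)

lemma smooth_map_euclidean_iff:
  fixes F :: "'m \<Rightarrow> 'k::euclidean_space"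
  shows "smooth_map A euclidean_atlas F \<longleftrightarrow> (\<forall>(U, \<phi>)\<in>A. Cinf_on (Om U \<phi>) (\<lambda>x. F (par U \<phi> x)))"
    (is "?L \<longleftrightarrow> ?R")
proof
  assume L: ?L
  show ?R
  proof clarify
    fix U \<phi> assume U: "(U, \<phi>) \<in> A"
    have "smooth_on (\<phi> ` (U \<inter> UNIV)) (F \<circ> inv_into U \<phi>)"
      using L U by (auto simp: smooth_map_def euclidean_atlas_def)
    from Cinf_on_par_if_smooth_on[OF U open_UNIV this]
    show "Cinf_on (Om U \<phi>) (\<lambda>x. F (par U \<phi> x))" by (simp add: par_def)
  qed
next
  assume R: ?R
  show ?L unfolding smooth_map_def
  proof
    have "isCont F p" for p
    proof -
      obtain U \<phi> where U: "(U, \<phi>) \<in> A" "p \<in> U" using covered by blast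
      have "continuous_on (Om U \<phi>) (\<lambda>x. F (par U \<phi> x))" using R U Cinf_on_continuous by blast
      then have "continuous_on U (\<lambda>q. F (par U \<phi> (\<phi> q)))"
        by (rule continuous_on_compose2[OF _ continuous_on_chart[OF U(1)]])
          (use chart_in_Om[OF U(1)] in auto)
      then have "continuous_on U F" by (rule continuous_on_eq) (simp add: par_chart[OF U(1)])
      then show ?thesis using U open_chart continuous_on_eq_continuous_at by blast
    qed
    then show "continuous_on UNIV F" by (simp add: continuous_at_imp_continuous_on)
    have "smooth_on (\<phi> ` U) (F \<circ> inv_into U \<phi>)" if U: "(U, \<phi>) \<in> A" for U \<phi>
      by (rule smooth_on_if_Cinf_on[OF open_Om[OF U], of "\<lambda>x. F (par U \<phi> x)"])
        (use R U chart_in_Om[OF U] P_chart[OF U] in \<open>auto simp: par_def\<close>)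
    then show "\<forall>(U, \<phi>)\<in>A. \<forall>(W, \<psi>)\<in>euclidean_atlas.
        smooth_on (\<phi> ` (U \<inter> F -` W)) (\<psi> \<circ> F \<circ> inv_into U \<phi>)"
      by (auto simp: euclidean_atlas_def)
  qed
qed

abbreviation C\<^sub>M :: "('m \<Rightarrow> real) set" where "C\<^sub>M \<equiv> smooth_functions A"

lemma smooth_functions_iff: "f \<in> C\<^sub>M \<longleftrightarrow> (\<forall>(U, \<phi>)\<in>A. Cinf_on (Om U \<phi>) (\<lambda>x. f (par U \<phi> x)))"
  by (simp add: smooth_functions_def smooth_map_euclidean_iff)

lemma smooth_functionsD: "f \<in> C\<^sub>M \<Longrightarrow> (U, \<phi>) \<in> A \<Longrightarrow> Cinf_on (Om U \<phi>) (\<lambda>x. f (par U \<phi> x))"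
  by (auto simp: smooth_functions_iff)

lemma smooth_const [simp, intro]: "(\<lambda>q. c) \<in> C\<^sub>M"
  by (auto simp: smooth_functions_iff)

lemma smooth_add [intro]: "f \<in> C\<^sub>M \<Longrightarrow> g \<in> C\<^sub>M \<Longrightarrow> (\<lambda>q. f q + g q) \<in> C\<^sub>M"
  by (auto simp: smooth_functions_iff)

lemma smooth_mult [intro]: "f \<in> C\<^sub>M \<Longrightarrow> g \<in> C\<^sub>M \<Longrightarrow> (\<lambda>q. f q * g q) \<in> C\<^sub>M"
  by (fastforce simp: smooth_functions_iff)

lemma smooth_diff [intro]: "f \<in> C\<^sub>M \<Longrightarrow> g \<in> C\<^sub>M \<Longrightarrow> (\<lambda>q. f q - g q) \<in> C\<^sub>M"
  by (auto simp: smooth_functions_iff)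

lemma smooth_local:
  assumes "\<And>p. \<exists>O' g. open O' \<and> p \<in> O' \<and> g \<in> C\<^sub>M \<and> (\<forall>q\<in>O'. f q = g q)"
  shows "f \<in> C\<^sub>M"
  unfolding smooth_functions_iff
proof clarify
  fix U \<phi> assume U: "(U, \<phi>) \<in> A"
  show "Cinf_on (Om U \<phi>) (\<lambda>x. f (par U \<phi> x))"
  proof (rule Cinf_on_local)
    fix x assume x: "x \<in> Om U \<phi>"
    obtain O' g where O: "open O'" "par U \<phi> x \<in> O'" "g \<in> C\<^sub>M" "\<And>q. q \<in> O' \<Longrightarrow> f q = g q"
      using assms by metis
    let ?T = "{x \<in> Om U \<phi>. par U \<phi> x \<in> O'}"
    have "Cinf_on ?T (\<lambda>x. g (par U \<phi> x))"
      by (rule Cinf_on_subset[OF smooth_functionsD[OF O(3) U]]) auto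
    then have "Cinf_on ?T (\<lambda>x. f (par U \<phi> x))"
      by (rule Cinf_on_cong[OF open_par_vimage[OF U O(1)], rotated]) (use O(4) in auto)
    then show "\<exists>T. open T \<and> x \<in> T \<and> Cinf_on T (\<lambda>x. f (par U \<phi> x))"
      using x O(2) open_par_vimage[OF U O(1)] by blast
  qed
qed

text \<open>Extension by 0 is smooth because the product vanishes off a compact set \<open>K\<close>
  inside the chart: \<open>K\<close> is closed in the Hausdorff space, so every point either has a
  neighbourhood in the chart or one that misses \<open>K\<close>. The quantifier over
  \<open>g\<close> stands inside so that the same \<open>\<rho>\<close> and \<open>W\<close> serve
  all functions, as \<open>dvec_extends\<close> requires.\<close>

lemma chart_bump:
  assumes U: "(U, \<phi>) \<in> A" and p: "p \<in> U" and N: "open N" "\<phi> p \<in> N"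
  obtains \<rho> :: "'e \<Rightarrow> real" and W where "Cinf_on UNIV \<rho>" "open W" "\<phi> p \<in> W" "W \<subseteq> N"
    "\<And>x. x \<in> W \<Longrightarrow> \<rho> x = 1"
    "\<forall>g. Cinf_on (N \<inter> Om U \<phi>) g \<longrightarrow>
       (\<lambda>q. if q \<in> U \<and> \<phi> q \<in> N then \<rho> (\<phi> q) * g (\<phi> q) else 0) \<in> C\<^sub>M"
proof -
  let ?y = "\<phi> p"
  have "open (N \<inter> Om U \<phi>)" "?y \<in> N \<inter> Om U \<phi>" using N open_Om[OF U] chart_in_Om[OF U p] by auto
  then obtain e where e: "e > 0" "cball ?y e \<subseteq> N \<inter> Om U \<phi>" using open_contains_cball by blast
  define r where "r = e / 2"
  have r: "r > 0" "cball ?y (2 * r) \<subseteq> N \<inter> Om U \<phi>" using e by (auto simp: r_def)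
  obtain \<rho> :: "'e \<Rightarrow> real" where \<rho>: "Cinf_on UNIV \<rho>" "\<And>x. dist ?y x \<le> r \<Longrightarrow> \<rho> x = 1"
    "\<And>x. dist ?y x \<ge> 2 * r \<Longrightarrow> \<rho> x = 0" using smooth_bump[OF r(1)] by metis
  define K where "K = {q \<in> U. \<phi> q \<in> cball ?y (2 * r)}"
  \<comment> \<open>Chart values are fixed by \<open>P\<close>, so the closed ball is cut down to
    the fixed points; this exhibits \<open>K\<close> as the continuous image of a compact
    set.\<close>
  have "K = par U \<phi> ` (cball ?y (2 * r) \<inter> {x. P x = x})"
  proof
    show "K \<subseteq> par U \<phi> ` (cball ?y (2 * r) \<inter> {x. P x = x})"
      unfolding K_def using par_chart[OF U] P_chart[OF U] by (force intro: rev_image_eqI)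
    show "par U \<phi> ` (cball ?y (2 * r) \<inter> {x. P x = x}) \<subseteq> K"
      using r(2) par_in[OF U] chart_par[OF U] by (fastforce simp: K_def)
  qed
  moreover have "compact (cball ?y (2 * r) \<inter> {x. P x = x})"
    by (intro compact_Int_closed compact_cball closed_Collect_eq continuous_intros
        linear_continuous_on[OF bounded_linear_P])
  moreover have "continuous_on (cball ?y (2 * r) \<inter> {x. P x = x}) (par U \<phi>)"
    using r(2) by (intro continuous_on_subset[OF continuous_on_par[OF U]]) auto
  ultimately have "compact K"
    using compact_continuous_image by metis
  then have clK: "closed K" by (rule compact_imp_closed)
  let ?F = "\<lambda>g q. if q \<in> U \<and> \<phi> q \<in> N then \<rho> (\<phi> q) * g (\<phi> q) else 0"
  show ?thesis
  proof (rule that[of \<rho> "ball ?y r"])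
    show "ball ?y r \<subseteq> N" using r by force
    have "?F g \<in> C\<^sub>M" if g: "Cinf_on (N \<inter> Om U \<phi>) g" for g unfolding smooth_functions_iff
    proof clarify
      fix V \<psi> assume V: "(V, \<psi>) \<in> A"
      show "Cinf_on (Om V \<psi>) (\<lambda>x. ?F g (par V \<psi> x))"
      proof (rule Cinf_on_local)
        fix x assume x: "x \<in> Om V \<psi>"
        show "\<exists>T. open T \<and> x \<in> T \<and> Cinf_on T (\<lambda>x. ?F g (par V \<psi> x))"
        proof (cases "par V \<psi> x \<in> K")
          case True
          let ?T = "{x \<in> Om V \<psi>. par V \<psi> x \<in> {q \<in> U. \<phi> q \<in> N}}"
          have oT: "open ?T" by (rule open_par_vimage[OF V open_chart_vimage[OF U N(1)]])
          have \<tau>: "Cinf_on ?T (\<lambda>x. \<phi> (par V \<psi> x))"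
            by (rule Cinf_on_subset[OF Cinf_on_transition[OF V U]]) auto
          have "Cinf_on ?T (\<lambda>x. \<rho> (\<phi> (par V \<psi> x)) * g (\<phi> (par V \<psi> x)))"
            by (intro Cinf_on_mult Cinf_on_compose[OF \<rho>(1) \<tau>] Cinf_on_compose[OF g \<tau>])
              (use chart_in_Om[OF U] in auto)
          then have "Cinf_on ?T (\<lambda>x. ?F g (par V \<psi> x))"
            by (rule Cinf_on_cong[OF oT, rotated]) auto
          moreover have "x \<in> ?T" using True x r(2) by (auto simp: K_def)
          ultimately show ?thesis using oT by blast
        next
          case False
          let ?T = "{x \<in> Om V \<psi>. par V \<psi> x \<in> - K}"
          have oT: "open ?T" by (rule open_par_vimage[OF V]) (use clK in auto)
          have "?F g q = 0" if "q \<notin> K" for q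
            using that \<rho>(3)[of "\<phi> q"] by (auto simp: K_def)
          then have "Cinf_on ?T (\<lambda>x. ?F g (par V \<psi> x))"
            by (intro Cinf_on_cong[OF oT _ Cinf_on_const[of _ 0]]) (auto simp del: if_split)
          then show ?thesis using oT x False by blast
        qed
      qed
    qed
    then show "\<forall>g. Cinf_on (N \<inter> Om U \<phi>) g \<longrightarrow> ?F g \<in> C\<^sub>M" by blast
  qed (use \<rho> r in auto)
qed

lemma local_extension:
  assumes U: "(U, \<phi>) \<in> A" and p: "p \<in> U" and N: "open N" "\<phi> p \<in> N" and g: "Cinf_on (N \<inter> Om U \<phi>) g"
  obtains f W where "f \<in> C\<^sub>M" "open W" "p \<in> W" "W \<subseteq> U" "\<And>q. q \<in> W \<Longrightarrow> \<phi> q \<in> N \<and> f q = g (\<phi> q)"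
proof -
  obtain \<rho> :: "'e \<Rightarrow> real" and W where W: "Cinf_on UNIV \<rho>" "open W" "\<phi> p \<in> W" "W \<subseteq> N"
    "\<And>x. x \<in> W \<Longrightarrow> \<rho> x = 1"
    "\<forall>g. Cinf_on (N \<inter> Om U \<phi>) g \<longrightarrow>
       (\<lambda>q. if q \<in> U \<and> \<phi> q \<in> N then \<rho> (\<phi> q) * g (\<phi> q) else 0) \<in> C\<^sub>M"
    by (rule chart_bump[OF U p N]) blast
  show ?thesis
    by (rule that[OF W(6)[rule_format, OF g] open_chart_vimage[OF U W(2)]]) (use p W in auto)
qed

lemma bump_function:
  assumes "open O'" "p \<in> O'"
  obtains \<rho> where "\<rho> \<in> C\<^sub>M" "\<rho> p = 1" "\<And>q. q \<notin> O' \<Longrightarrow> \<rho> q = 0"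
proof -
  obtain U \<phi> where U: "(U, \<phi>) \<in> A" "p \<in> U" using covered by blast
  let ?N = "{x \<in> Om U \<phi>. par U \<phi> x \<in> O'}"
  have N: "open ?N" "\<phi> p \<in> ?N"
    using open_par_vimage[OF U(1) assms(1)] par_chart[OF U] chart_in_Om[OF U] assms(2) by auto
  obtain \<rho> :: "'e \<Rightarrow> real" and W where W: "Cinf_on UNIV \<rho>" "open W" "\<phi> p \<in> W" "W \<subseteq> ?N"
    "\<And>x. x \<in> W \<Longrightarrow> \<rho> x = 1"
    "\<forall>g. Cinf_on (?N \<inter> Om U \<phi>) g \<longrightarrow>
       (\<lambda>q. if q \<in> U \<and> \<phi> q \<in> ?N then \<rho> (\<phi> q) * g (\<phi> q) else 0) \<in> C\<^sub>M"
    by (rule chart_bump[OF U N]) blast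
  show ?thesis
  proof (rule that)
    show "(\<lambda>q. if q \<in> U \<and> \<phi> q \<in> ?N then \<rho> (\<phi> q) * (\<lambda>x. 1) (\<phi> q) else 0) \<in> C\<^sub>M"
      by (rule W(6)[rule_format]) auto
    show "(if p \<in> U \<and> \<phi> p \<in> ?N then \<rho> (\<phi> p) * (\<lambda>x. 1) (\<phi> p) else 0) = 1"
      using U N W by auto
    show "(if q \<in> U \<and> \<phi> q \<in> ?N then \<rho> (\<phi> q) * (\<lambda>x. 1) (\<phi> q) else 0) = 0" if "q \<notin> O'" for q
      using that par_chart[OF U(1)] by auto
  qed
qed

end

section \<open>Linear algebra of tangent and cotangent spaces\<close>

lemma tangent_space_combination:
  assumes "v \<in> tangent_space A p" "w \<in> tangent_space A p"
  shows "(\<lambda>f. a * v f + b * w f) \<in> tangent_space A p"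
  using assms unfolding tangent_space_def linear_functional_on_def by (auto simp: algebra_simps)

lemma zero_in_tangent_space: "(\<lambda>f. 0) \<in> tangent_space A p"
  by (auto simp: tangent_space_def linear_functional_on_def)

lemma tangent_space_sum:
  "finite I \<Longrightarrow> (\<And>i. i \<in> I \<Longrightarrow> v i \<in> tangent_space A p) \<Longrightarrow>
    (\<lambda>f. \<Sum>i\<in>I. c i * v i f) \<in> tangent_space A p"
proof (induction I rule: finite_induct)
  case (insert i I)
  then show ?case using tangent_space_combination[of "v i" A p _ "c i" 1] by simp
qed (simp add: zero_in_tangent_space)

lemma tangent_space_add_fun:
  "v \<in> tangent_space A p \<Longrightarrow> f \<in> smooth_functions A \<Longrightarrow> g \<in> smooth_functions A \<Longrightarrow>
    v (\<lambda>q. f q + g q) = v f + v g"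
  by (simp add: tangent_space_def linear_functional_on_def)

lemma tangent_space_scale_fun:
  "v \<in> tangent_space A p \<Longrightarrow> f \<in> smooth_functions A \<Longrightarrow> v (\<lambda>q. c * f q) = c * v f"
  by (simp add: tangent_space_def linear_functional_on_def)

lemma tangent_space_mult_fun:
  "v \<in> tangent_space A p \<Longrightarrow> f \<in> smooth_functions A \<Longrightarrow> g \<in> smooth_functions A \<Longrightarrow>
    v (\<lambda>q. f q * g q) = f p * v g + v f * g p"
  by (simp add: tangent_space_def)

lemma tangent_space_non_smooth: "v \<in> tangent_space A p \<Longrightarrow> f \<notin> smooth_functions A \<Longrightarrow> v f = 0"
  by (simp add: tangent_space_def)

lemma cotangent_space_combination:
  assumes "\<beta> \<in> cotangent_space A p" "\<gamma> \<in> cotangent_space A p"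
  shows "(\<lambda>f. a * \<beta> f + b * \<gamma> f) \<in> cotangent_space A p"
  using assms unfolding cotangent_space_def linear_functional_on_def by (auto simp: algebra_simps)

lemma zero_in_cotangent_space: "(\<lambda>f. 0) \<in> cotangent_space A p"
  by (auto simp: cotangent_space_def linear_functional_on_def)

lemma cotangent_space_sum:
  "finite I \<Longrightarrow> (\<And>i. i \<in> I \<Longrightarrow> \<beta> i \<in> cotangent_space A p) \<Longrightarrow>
    (\<lambda>v. \<Sum>i\<in>I. c i * \<beta> i v) \<in> cotangent_space A p"
proof (induction I rule: finite_induct)
  case (insert i I)
  then show ?case using cotangent_space_combination[of "\<beta> i" A p _ "c i" 1] by simp
qed (simp add: zero_in_cotangent_space)

lemma cotangent_combination_vec:
  assumes "\<beta> \<in> cotangent_space A p" "v \<in> tangent_space A p" "w \<in> tangent_space A p"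
  shows "\<beta> (\<lambda>f. a * v f + b * w f) = a * \<beta> v + b * \<beta> w"
proof -
  have av: "(\<lambda>f. a * v f) \<in> tangent_space A p" "(\<lambda>f. b * w f) \<in> tangent_space A p"
    using tangent_space_combination[OF assms(2,2), of a 0] tangent_space_combination[OF assms(3,3), of b 0]
    by auto
  then have "\<beta> (\<lambda>f. a * v f + b * w f) = \<beta> (\<lambda>f. a * v f) + \<beta> (\<lambda>f. b * w f)"
    using assms(1) by (simp add: cotangent_space_def linear_functional_on_def)
  then show ?thesis using assms by (simp add: cotangent_space_def linear_functional_on_def)
qed

lemma cotangent_zero_vec: "\<beta> \<in> cotangent_space A p \<Longrightarrow> \<beta> (\<lambda>f. 0) = 0"
  using cotangent_combination_vec[OF _ zero_in_tangent_space zero_in_tangent_space, of \<beta> A p 0 0] by simp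

lemma cotangent_sum_vec:
  assumes "\<beta> \<in> cotangent_space A p"
  shows "finite I \<Longrightarrow> (\<And>i. i \<in> I \<Longrightarrow> v i \<in> tangent_space A p) \<Longrightarrow>
    \<beta> (\<lambda>f. \<Sum>i\<in>I. c i * v i f) = (\<Sum>i\<in>I. c i * \<beta> (v i))"
proof (induction I rule: finite_induct)
  case (insert i I)
  then show ?case
    using cotangent_combination_vec[OF assms, of "v i" "\<lambda>f. \<Sum>i\<in>I. c i * v i f" "c i" 1]
      tangent_space_sum[of I v A p c] by simp
qed (simp add: cotangent_zero_vec[OF assms])

lemma cotangent_ext:
  assumes "\<beta> \<in> cotangent_space A p" "\<gamma> \<in> cotangent_space A p"
    "\<And>v. v \<in> tangent_space A p \<Longrightarrow> \<beta> v = \<gamma> v"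
  shows "\<beta> = \<gamma>"
proof
  fix v show "\<beta> v = \<gamma> v"
    using assms by (cases "v \<in> tangent_space A p") (auto simp: cotangent_space_def)
qed

lemma dfun_in_cotangent_space: "dfun A f p \<in> cotangent_space A p"
proof -
  have "(\<lambda>f. u f + v f) \<in> tangent_space A p" "(\<lambda>f. c * u f) \<in> tangent_space A p"
    if "u \<in> tangent_space A p" "v \<in> tangent_space A p" for u v c
    using tangent_space_combination[OF that, of 1 1] tangent_space_combination[OF that, of c 0] by auto
  then show ?thesis
    by (auto simp: dfun_def cotangent_space_def linear_functional_on_def)
qed

lemma one_form_dfun: "f \<in> smooth_functions A \<Longrightarrow> one_form A (dfun A f)"
  by (simp add: one_form_def dfun_in_cotangent_space) (simp add: dfun_def vector_field_def)

section \<open>Derivations in charts\<close>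

context charted
begin

lemma tangent_const:
  assumes "v \<in> tangent_space A p" shows "v (\<lambda>q. c) = 0"
proof -
  have "v (\<lambda>q. 1 * 1) = 1 * v (\<lambda>q. 1) + v (\<lambda>q. 1) * 1"
    by (rule tangent_space_mult_fun[OF assms]) auto
  then have "v (\<lambda>q. 1) = 0" by simp
  then show ?thesis using tangent_space_scale_fun[OF assms, of "\<lambda>q. 1" c] by simp
qed

lemma vf_bracket_in_tangent_space:
  assumes "vector_field A X" "vector_field A Y"
  shows "vf_bracket X Y p \<in> tangent_space A p"
proof -
  have X: "X q \<in> tangent_space A q" and Y: "Y q \<in> tangent_space A q" for q
    using assms by (auto simp: vector_field_def)
  have S: "(\<lambda>q. X q f) \<in> C\<^sub>M" "(\<lambda>q. Y q f) \<in> C\<^sub>M" if "f \<in> C\<^sub>M" for f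
    using assms that by (auto simp: vector_field_def)
  have "vf_bracket X Y p (\<lambda>q. f q + g q) = vf_bracket X Y p f + vf_bracket X Y p g"
    if "f \<in> C\<^sub>M" "g \<in> C\<^sub>M" for f g
    using that S by (simp add: vf_bracket_def tangent_space_add_fun[OF X] tangent_space_add_fun[OF Y])
  moreover have "vf_bracket X Y p (\<lambda>q. c * f q) = c * vf_bracket X Y p f" if "f \<in> C\<^sub>M" for f c
    using that S
    by (simp add: vf_bracket_def tangent_space_scale_fun[OF X] tangent_space_scale_fun[OF Y] algebra_simps)
  moreover have "vf_bracket X Y p (\<lambda>q. f q * g q) = f p * vf_bracket X Y p g + vf_bracket X Y p f * g p"
    if "f \<in> C\<^sub>M" "g \<in> C\<^sub>M" for f g
    using that S smooth_mult
    by (simp add: vf_bracket_def tangent_space_mult_fun[OF X] tangent_space_mult_fun[OF Y]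
        tangent_space_add_fun[OF X] tangent_space_add_fun[OF Y] algebra_simps)
  \<comment> \<open>On a non-smooth \<open>f\<close> the inner field yields the constant function 0,
    and derivations kill constants; so the default value 0 is respected.\<close>
  moreover have "vf_bracket X Y p f = 0" if "f \<notin> C\<^sub>M" for f
    using tangent_space_non_smooth[OF X that] tangent_space_non_smooth[OF Y that]
      tangent_const[OF X] tangent_const[OF Y] by (simp add: vf_bracket_def)
  ultimately show ?thesis unfolding tangent_space_def linear_functional_on_def by blast
qed

lemma smooth_scale [intro]: "f \<in> C\<^sub>M \<Longrightarrow> (\<lambda>q. c * f q) \<in> C\<^sub>M"
  by (rule smooth_mult) auto

lemma smooth_sum [intro]:
  "finite I \<Longrightarrow> (\<And>i. i \<in> I \<Longrightarrow> f i \<in> C\<^sub>M) \<Longrightarrow> (\<lambda>q. \<Sum>i\<in>I. f i q) \<in> C\<^sub>M"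
  by (induction I rule: finite_induct) auto

lemma tangent_sum_fun:
  assumes "v \<in> tangent_space A p"
  shows "finite I \<Longrightarrow> (\<And>i. i \<in> I \<Longrightarrow> f i \<in> C\<^sub>M) \<Longrightarrow> v (\<lambda>q. \<Sum>i\<in>I. f i q) = (\<Sum>i\<in>I. v (f i))"
proof (induction I rule: finite_induct)
  case (insert i I)
  then show ?case using tangent_space_add_fun[OF assms, of "f i" "\<lambda>q. \<Sum>i\<in>I. f i q"] by auto
qed (simp add: tangent_const[OF assms])

text \<open>The difference of the functions times a bump function is identically 0. The Leibniz rule
  at \<open>p\<close>, where the bump is 1 and the difference is 0, leaves the derivative of the
  difference.\<close>

lemma tangent_local:
  assumes v: "v \<in> tangent_space A p" and O: "open O'" "p \<in> O'" and fg: "f \<in> C\<^sub>M" "g \<in> C\<^sub>M"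
    and eq: "\<And>q. q \<in> O' \<Longrightarrow> f q = g q"
  shows "v f = v g"
proof -
  obtain \<rho> where \<rho>: "\<rho> \<in> C\<^sub>M" "\<rho> p = 1" "\<And>q. q \<notin> O' \<Longrightarrow> \<rho> q = 0" using bump_function[OF O] by metis
  define h where "h q = f q + (- 1) * g q" for q
  have h: "h \<in> C\<^sub>M" unfolding h_def by (intro smooth_add smooth_scale fg)
  have "(\<lambda>q. \<rho> q * h q) = (\<lambda>q. 0)" using \<rho>(3) eq by (fastforce simp: h_def)
  then have "v (\<lambda>q. \<rho> q * h q) = 0" using tangent_const[OF v] by simp
  then have "\<rho> p * v h + v \<rho> * h p = 0" using tangent_space_mult_fun[OF v \<rho>(1) h] by simp
  moreover have "h p = 0" using eq O by (simp add: h_def)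
  ultimately have "v h = 0" using \<rho>(2) by simp
  moreover have "v h = v f + v (\<lambda>q. (- 1) * g q)" unfolding h_def
    by (rule tangent_space_add_fun[OF v fg(1) smooth_scale[OF fg(2)]])
  moreover have "v (\<lambda>q. (- 1) * g q) = (- 1) * v g" by (rule tangent_space_scale_fun[OF v fg(2)])
  ultimately show ?thesis by simp
qed

text \<open>The coordinate vector in direction \<open>w\<close>, with the default value on
  non-smooth functions that \<open>tangent_space\<close> demands. Directions killed by
  \<open>P\<close> give the zero vector.\<close>

definition dvec :: "'m set \<Rightarrow> ('m \<Rightarrow> 'e) \<Rightarrow> 'm \<Rightarrow> 'e \<Rightarrow> 'm tvec" where
  "dvec U \<phi> p w f = (if f \<in> C\<^sub>M then frechet_derivative (\<lambda>x. f (par U \<phi> x)) (at (\<phi> p)) w else 0)"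

context
  fixes U \<phi> p assumes U: "(U, \<phi>) \<in> A" and p: "p \<in> U"
begin

lemma smooth_par_has_derivative:
  "f \<in> C\<^sub>M \<Longrightarrow> ((\<lambda>x. f (par U \<phi> x)) has_derivative (\<lambda>w. dvec U \<phi> p w f)) (at (\<phi> p))"
  using Cinf_on_has_derivative[OF smooth_functionsD[OF _ U] chart_in_Om[OF U p]]
  by (simp add: dvec_def)

lemma dvec_eqI:
  "f \<in> C\<^sub>M \<Longrightarrow> ((\<lambda>x. f (par U \<phi> x)) has_derivative D) (at (\<phi> p)) \<Longrightarrow> dvec U \<phi> p w f = D w"
  using has_derivative_unique[OF smooth_par_has_derivative] by metis

lemma dvec_in_tangent_space: "dvec U \<phi> p w \<in> tangent_space A p"
proof -
  have "dvec U \<phi> p w (\<lambda>a. u a + v a) = dvec U \<phi> p w u + dvec U \<phi> p w v"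
    if "u \<in> C\<^sub>M" "v \<in> C\<^sub>M" for u v
    using that by (intro dvec_eqI has_derivative_add smooth_par_has_derivative) auto
  moreover have "dvec U \<phi> p w (\<lambda>a. c * u a) = c * dvec U \<phi> p w u" if "u \<in> C\<^sub>M" for c u
    using that by (intro dvec_eqI has_derivative_mult_right smooth_par_has_derivative) auto
  moreover have "dvec U \<phi> p w (\<lambda>a. u a * v a) = u p * dvec U \<phi> p w v + dvec U \<phi> p w u * v p"
    if "u \<in> C\<^sub>M" "v \<in> C\<^sub>M" for u v
  proof -
    have "((\<lambda>x. u (par U \<phi> x) * v (par U \<phi> x)) has_derivative
        (\<lambda>w. u (par U \<phi> (\<phi> p)) * dvec U \<phi> p w v + dvec U \<phi> p w u * v (par U \<phi> (\<phi> p)))) (at (\<phi> p))"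
      using that by (intro has_derivative_mult smooth_par_has_derivative)
    then show ?thesis using that par_chart[OF U p] by (intro dvec_eqI) auto
  qed
  ultimately show ?thesis
    unfolding tangent_space_def linear_functional_on_def by (auto simp: dvec_def)
qed

lemma linear_dvec: "f \<in> C\<^sub>M \<Longrightarrow> linear (\<lambda>w. dvec U \<phi> p w f)"
  by (rule has_derivative_linear[OF smooth_par_has_derivative])

lemma dvec_combination: "dvec U \<phi> p (a *\<^sub>R u + b *\<^sub>R w) = (\<lambda>f. a * dvec U \<phi> p u f + b * dvec U \<phi> p w f)"
proof
  fix f show "dvec U \<phi> p (a *\<^sub>R u + b *\<^sub>R w) f = a * dvec U \<phi> p u f + b * dvec U \<phi> p w f"
  proof (cases "f \<in> C\<^sub>M")
    case True
    then interpret linear "\<lambda>w. dvec U \<phi> p w f" by (rule linear_dvec)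
    show ?thesis by (simp add: add scale)
  qed (simp add: dvec_def)
qed

lemma linear_cotangent_dvec:
  assumes "\<beta> \<in> cotangent_space A p" shows "linear (\<lambda>w. \<beta> (dvec U \<phi> p w))"
proof (rule linearI)
  show "\<beta> (dvec U \<phi> p (b1 + b2)) = \<beta> (dvec U \<phi> p b1) + \<beta> (dvec U \<phi> p b2)" for b1 b2
    using cotangent_combination_vec[OF assms dvec_in_tangent_space dvec_in_tangent_space, of 1 b1 1 b2]
      dvec_combination[of 1 b1 1 b2] by simp
  show "\<beta> (dvec U \<phi> p (r *\<^sub>R b)) = r *\<^sub>R \<beta> (dvec U \<phi> p b)" for r b
    using cotangent_combination_vec[OF assms dvec_in_tangent_space dvec_in_tangent_space, of r b 0 b]
      dvec_combination[of r b 0 b] by simp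
qed

text \<open>\<open>par\<close> factors through \<open>P\<close>, so this is the chain rule.\<close>

lemma dvec_P: "dvec U \<phi> p (P w) = dvec U \<phi> p w"
proof
  fix f show "dvec U \<phi> p (P w) f = dvec U \<phi> p w f"
  proof (cases "f \<in> C\<^sub>M")
    case True
    have "((\<lambda>x. f (par U \<phi> (P x))) has_derivative (\<lambda>w. dvec U \<phi> p (P w) f)) (at (\<phi> p))"
      by (rule has_derivative_compose[of P P _ UNIV "\<lambda>x. f (par U \<phi> x)"])
        (use smooth_par_has_derivative[OF True] P_chart[OF U p] bounded_linear_imp_has_derivative[OF bounded_linear_P] in auto)
    then have "((\<lambda>x. f (par U \<phi> x)) has_derivative (\<lambda>w. dvec U \<phi> p (P w) f)) (at (\<phi> p))"
      by (simp add: par_def)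
    then show ?thesis using dvec_eqI[OF True] by metis
  qed (simp add: dvec_def)
qed

text \<open>By Hadamard's lemma a derivation is determined by its values on coordinate functions.\<close>

lemma tangent_coordinates:
  obtains c :: "'e \<Rightarrow> 'm \<Rightarrow> real" where "\<And>i. c i \<in> C\<^sub>M"
    "\<And>v. v \<in> tangent_space A p \<Longrightarrow> v = dvec U \<phi> p (\<Sum>i\<in>Basis. v (c i) *\<^sub>R i)"
    "\<And>i w. dvec U \<phi> p w (c i) = P w \<bullet> i"
proof -
  let ?y = "\<phi> p"
  obtain r where r: "r > 0" "ball ?y r \<subseteq> Om U \<phi>"
    using open_Om[OF U] chart_in_Om[OF U p] open_contains_ball by metis
  have ext: "\<exists>f W. f \<in> C\<^sub>M \<and> open W \<and> p \<in> W \<and> W \<subseteq> U \<and> (\<forall>q\<in>W. \<phi> q \<in> ball ?y (r/2) \<and> f q = g (\<phi> q))"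
    if "Cinf_on (ball ?y (r/2)) g" for g :: "'e \<Rightarrow> real"
  proof -
    have "Cinf_on (ball ?y (r/2) \<inter> Om U \<phi>) g" by (rule Cinf_on_subset[OF that]) auto
    then show ?thesis using local_extension[OF U p, of "ball ?y (r/2)" g] r(1) by (metis centre_in_ball half_gt_zero open_ball)
  qed
  have "\<forall>i. \<exists>f W. f \<in> C\<^sub>M \<and> open W \<and> p \<in> W \<and> W \<subseteq> U \<and> (\<forall>q\<in>W. \<phi> q \<in> ball ?y (r/2) \<and> f q = \<phi> q \<bullet> i)"
    using ext[OF Cinf_on_inner_const[OF Cinf_on_ident]] by blast
  then obtain c Wc where c: "\<And>i. c i \<in> C\<^sub>M" "\<And>i. open (Wc i)" "\<And>i. p \<in> Wc i" "\<And>i. Wc i \<subseteq> U"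
    "\<And>i q. q \<in> Wc i \<Longrightarrow> \<phi> q \<in> ball ?y (r/2) \<and> c i q = \<phi> q \<bullet> i"
    by metis
  show ?thesis
  proof (rule that[OF c(1)])
    fix v assume v: "v \<in> tangent_space A p"
    show "v = dvec U \<phi> p (\<Sum>i\<in>Basis. v (c i) *\<^sub>R i)"
    proof
      fix f show "v f = dvec U \<phi> p (\<Sum>i\<in>Basis. v (c i) *\<^sub>R i) f"
      proof (cases "f \<in> C\<^sub>M")
        case True
        have cf: "Cinf_on (ball ?y r) (\<lambda>x. f (par U \<phi> x))"
          by (rule Cinf_on_subset[OF smooth_functionsD[OF True U] r(2)])
        obtain g where g: "\<And>i. Cinf_on (ball ?y (r/2)) (g i)"
          "\<And>x. x \<in> ball ?y (r/2) \<Longrightarrow> f (par U \<phi> x) = f (par U \<phi> ?y) + (\<Sum>i\<in>Basis. ((x - ?y) \<bullet> i) * g i x)"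
          "\<And>i. g i ?y = frechet_derivative (\<lambda>x. f (par U \<phi> x)) (at ?y) i"
          by (rule hadamard[OF r(1) cf]) blast
        obtain G WG where G: "\<And>i. G i \<in> C\<^sub>M" "\<And>i. open (WG i)" "\<And>i. p \<in> WG i"
          "\<And>i q. q \<in> WG i \<Longrightarrow> \<phi> q \<in> ball ?y (r/2) \<and> G i q = g i (\<phi> q)"
          using ext[OF g(1)] by metis
        \<comment> \<open>Hadamard's formula with coordinates and coefficients replaced by globally
          smooth functions, since a derivation can be applied only to those. It agrees with
          \<open>f\<close> near \<open>p\<close>.\<close>
        define h where "h q = f p + (\<Sum>i\<in>Basis. (c i q + - (?y \<bullet> i)) * G i q)" for q
        have cG: "(\<lambda>q. (c i q + - (?y \<bullet> i)) * G i q) \<in> C\<^sub>M" for i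
          by (intro smooth_add smooth_const smooth_mult c(1) G(1))
        have h: "h \<in> C\<^sub>M" unfolding h_def
          by (intro smooth_add smooth_const smooth_sum finite_Basis cG)
        define W where "W = U \<inter> (\<Inter>i\<in>Basis. Wc i \<inter> WG i)"
        have W: "open W" "p \<in> W"
          using c(2,3) G(2,3) p open_chart[OF U] by (auto simp: W_def intro!: open_INT open_Int)
        have "f q = h q" if "q \<in> W" for q
        proof -
          have "\<phi> q \<in> ball ?y (r/2)" using that c(5) SOME_Basis unfolding W_def by blast
          from g(2)[OF this] have "f q = f p + (\<Sum>i\<in>Basis. ((\<phi> q - ?y) \<bullet> i) * g i (\<phi> q))"
            using par_chart[OF U] p that by (simp add: W_def)
          also have "\<dots> = h q" unfolding h_def
            using c(5) G(4) that by (auto simp: W_def inner_diff_left intro!: sum.cong)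
          finally show ?thesis .
        qed
        then have "v f = v h" by (rule tangent_local[OF v W True h])
        also have "\<dots> = v (\<lambda>q. f p) + v (\<lambda>q. \<Sum>i\<in>Basis. (c i q + - (?y \<bullet> i)) * G i q)"
          unfolding h_def by (rule tangent_space_add_fun[OF v smooth_const smooth_sum[OF finite_Basis cG]])
        also have "v (\<lambda>q. \<Sum>i\<in>Basis. (c i q + - (?y \<bullet> i)) * G i q)
            = (\<Sum>i\<in>Basis. v (\<lambda>q. (c i q + - (?y \<bullet> i)) * G i q))"
          by (rule tangent_sum_fun[OF v finite_Basis cG])
        also have "v (\<lambda>q. f p) + \<dots> = (\<Sum>i\<in>Basis. v (c i) * dvec U \<phi> p i f)"
        proof -
          \<comment> \<open>The first factor vanishes at \<open>p\<close>, so the Leibniz rule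
            leaves the derivative of the coordinate times the value of the coefficient.\<close>
          have "v (\<lambda>q. (c i q + - (?y \<bullet> i)) * G i q) = v (c i) * dvec U \<phi> p i f" for i
          proof -
            have "v (\<lambda>q. (c i q + - (?y \<bullet> i)) * G i q)
                = (c i p + - (?y \<bullet> i)) * v (G i) + v (\<lambda>q. c i q + - (?y \<bullet> i)) * G i p"
              by (rule tangent_space_mult_fun[OF v smooth_add[OF c(1) smooth_const] G(1)])
            moreover have "v (\<lambda>q. c i q + - (?y \<bullet> i)) = v (c i) + v (\<lambda>q. - (?y \<bullet> i))"
              by (rule tangent_space_add_fun[OF v c(1) smooth_const])
            moreover have "c i p = ?y \<bullet> i" "G i p = dvec U \<phi> p i f"
              using c(3,5) G(3,4) g(3) True by (auto simp: dvec_def)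
            ultimately show ?thesis by (simp add: tangent_const[OF v])
          qed
          then show ?thesis by (simp add: tangent_const[OF v])
        qed
        also have "\<dots> = dvec U \<phi> p (\<Sum>i\<in>Basis. v (c i) *\<^sub>R i) f"
        proof -
          interpret linear "\<lambda>w. dvec U \<phi> p w f" by (rule linear_dvec[OF True])
          show ?thesis by (simp add: sum scale)
        qed
        finally show ?thesis .
      qed (simp add: dvec_def tangent_space_non_smooth[OF v])
    qed
  next
    fix i w
    have "((\<lambda>x. P x \<bullet> i) has_derivative (\<lambda>w. P w \<bullet> i)) (at ?y)"
      by (intro has_derivative_inner_left bounded_linear_imp_has_derivative bounded_linear_P)
    then have "((\<lambda>x. c i (par U \<phi> x)) has_derivative (\<lambda>w. P w \<bullet> i)) (at ?y)"
    proof (rule has_derivative_transform_within_open)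
      show "open {x \<in> Om U \<phi>. par U \<phi> x \<in> Wc i}" by (rule open_par_vimage[OF U c(2)])
      show "?y \<in> {x \<in> Om U \<phi>. par U \<phi> x \<in> Wc i}"
        using chart_in_Om[OF U p] par_chart[OF U p] c(3) by simp
    qed (use c(5) chart_par[OF U] in auto)
    then show "dvec U \<phi> p w (c i) = P w \<bullet> i" by (rule dvec_eqI[OF c(1)])
  qed
qed

lemma tangent_is_dvec: "v \<in> tangent_space A p \<Longrightarrow> \<exists>w. v = dvec U \<phi> p w"
  using tangent_coordinates by metis

end

text \<open>Exterior derivatives are tested on global vector fields only. Here the coordinate fields
  are extended globally, with one neighbourhood \<open>W\<close> for all directions, so that their
  brackets can be computed there.\<close>

lemma dvec_extends:
  assumes U: "(U, \<phi>) \<in> A" and p: "p \<in> U"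
  obtains W where "open W" "p \<in> W" "W \<subseteq> U" "\<forall>w. \<exists>X. vector_field A X \<and> (\<forall>q\<in>W. X q = dvec U \<phi> q w)"
proof -
  obtain \<rho> :: "'e \<Rightarrow> real" and W where W: "Cinf_on UNIV \<rho>" "open W" "\<phi> p \<in> W" "W \<subseteq> UNIV"
    "\<And>x. x \<in> W \<Longrightarrow> \<rho> x = 1"
    "\<forall>g. Cinf_on (UNIV \<inter> Om U \<phi>) g \<longrightarrow>
       (\<lambda>q. if q \<in> U \<and> \<phi> q \<in> UNIV then \<rho> (\<phi> q) * g (\<phi> q) else 0) \<in> C\<^sub>M"
    by (rule chart_bump[OF U p open_UNIV UNIV_I]) blast
  have "\<exists>X. vector_field A X \<and> (\<forall>q\<in>{q \<in> U. \<phi> q \<in> W}. X q = dvec U \<phi> q w)" for w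
  proof (intro exI conjI ballI)
    let ?X = "\<lambda>q f. if q \<in> U then \<rho> (\<phi> q) * dvec U \<phi> q w f else 0"
    show "vector_field A ?X" unfolding vector_field_def
    proof (intro conjI allI ballI)
      show "?X q \<in> tangent_space A q" for q
        using tangent_space_combination[OF dvec_in_tangent_space[OF U] dvec_in_tangent_space[OF U],
            of q "\<rho> (\<phi> q)" w 0 w] zero_in_tangent_space by (cases "q \<in> U") simp_all
      show "(\<lambda>q. ?X q f) \<in> C\<^sub>M" if "f \<in> C\<^sub>M" for f
        using W(6)[rule_format, of "\<lambda>x. frechet_derivative (\<lambda>x. f (par U \<phi> x)) (at x) w"]
          Cinf_on_derivative[OF open_Om[OF U] smooth_functionsD[OF that U]] that
        by (simp add: dvec_def cong: if_cong)
    qed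
    show "?X q = dvec U \<phi> q w" if "q \<in> {q \<in> U. \<phi> q \<in> W}" for q
      using that W(5) by auto
  qed
  then show ?thesis
    by (intro that[OF open_chart_vimage[OF U W(2)]]) (use p W(3) in auto)
qed

end

lemma linear_functional_on_cotangent_sum:
  assumes "linear_functional_on (cotangent_space A p) L"
  shows "finite I \<Longrightarrow> (\<And>i. i \<in> I \<Longrightarrow> \<beta> i \<in> cotangent_space A p) \<Longrightarrow>
    L (\<lambda>v. \<Sum>i\<in>I. c i * \<beta> i v) = (\<Sum>i\<in>I. c i * L (\<beta> i))"
proof (induction I rule: finite_induct)
  case empty
  have "L (\<lambda>a. c * u a) = c * L u" if "u \<in> cotangent_space A p" for c u
    using assms that by (simp add: linear_functional_on_def)
  from this[OF zero_in_cotangent_space, of 0] show ?case by simp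
next
  case (insert i I)
  have ci: "(\<lambda>v. c i * \<beta> i v) \<in> cotangent_space A p"
    using cotangent_space_combination[of "\<beta> i" A p "\<beta> i" "c i" 0] insert.prems by simp
  have "L (\<lambda>v. c i * \<beta> i v + (\<Sum>i\<in>I. c i * \<beta> i v)) = L (\<lambda>v. c i * \<beta> i v) + L (\<lambda>v. \<Sum>i\<in>I. c i * \<beta> i v)"
    using assms ci cotangent_space_sum[of I \<beta> A p c] insert by (simp add: linear_functional_on_def)
  moreover have "L (\<lambda>v. c i * \<beta> i v) = c i * L (\<beta> i)"
    using assms insert.prems by (simp add: linear_functional_on_def)
  ultimately show ?case using insert by simp
qed

section \<open>Covectors, closed forms and their primitives\<close>

context charted
begin

text \<open>Here \<open>x\<close> need not lie on the chart image: the chart value of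
  \<open>par U \<phi> x\<close> is \<open>P x\<close>. The derivative at \<open>x\<close> is that at
  \<open>P x\<close> composed with \<open>P\<close>, and \<open>dvec_P\<close> removes the
  projection.\<close>

lemma smooth_par_has_derivative_at:
  assumes U: "(U, \<phi>) \<in> A" and x: "x \<in> Om U \<phi>" and g: "g \<in> C\<^sub>M"
  shows "((\<lambda>x. g (par U \<phi> x)) has_derivative (\<lambda>u. dvec U \<phi> (par U \<phi> x) u g)) (at x)"
proof -
  let ?q = "par U \<phi> x"
  have q: "?q \<in> U" "\<phi> ?q = P x" using par_in[OF U x] chart_par[OF U x] by auto
  have "((\<lambda>x. g (par U \<phi> (P x))) has_derivative (\<lambda>u. dvec U \<phi> ?q (P u) g)) (at x)"
    by (rule has_derivative_compose[of P P x UNIV "\<lambda>x. g (par U \<phi> x)"])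
      (use smooth_par_has_derivative[OF U q(1) g] q(2) bounded_linear_imp_has_derivative[OF bounded_linear_P] in auto)
  then show ?thesis using dvec_P[OF U q(1)] by (simp add: par_def)
qed

text \<open>This turns identities that are stated for vector fields into identities for single
  tangent vectors.\<close>

lemma vector_field_through:
  assumes "v \<in> tangent_space A p"
  shows "\<exists>X. vector_field A X \<and> X p = v"
proof -
  obtain U \<phi> where U: "(U, \<phi>) \<in> A" "p \<in> U" using covered by blast
  obtain w where w: "v = dvec U \<phi> p w" using tangent_is_dvec[OF U assms] by blast
  obtain W where "p \<in> W" "\<forall>w. \<exists>X. vector_field A X \<and> (\<forall>q\<in>W. X q = dvec U \<phi> q w)"
    by (rule dvec_extends[OF U]) blast
  then show ?thesis using w by blast
qed

text \<open>The differentials of the coordinate functions at \<open>p\<close> span the cotangent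
  space. Their images under \<open>L\<close> are used as the coefficients of the vector; this is the
  surjectivity onto the bidual and yields the existence part of \<open>sharp\<close>.\<close>

lemma cotangent_representation:
  assumes L: "linear_functional_on (cotangent_space A p) L"
  shows "\<exists>v\<in>tangent_space A p. \<forall>b\<in>cotangent_space A p. b v = L b"
proof -
  obtain U \<phi> where U: "(U, \<phi>) \<in> A" "p \<in> U" using covered by blast
  obtain c :: "'e \<Rightarrow> 'm \<Rightarrow> real" where c: "\<And>i. c i \<in> C\<^sub>M"
    "\<And>v. v \<in> tangent_space A p \<Longrightarrow> v = dvec U \<phi> p (\<Sum>i\<in>Basis. v (c i) *\<^sub>R i)"
    by (rule tangent_coordinates[OF U]) blast
  define v0 where "v0 = (\<lambda>f. \<Sum>i\<in>Basis. L (dfun A (c i) p) * dvec U \<phi> p i f)"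
  have v0: "v0 \<in> tangent_space A p" unfolding v0_def
    by (intro tangent_space_sum finite_Basis dvec_in_tangent_space[OF U])
  have "b v0 = L b" if b: "b \<in> cotangent_space A p" for b
  proof -
    have beq: "b = (\<lambda>v. \<Sum>i\<in>Basis. b (dvec U \<phi> p i) * dfun A (c i) p v)"
    proof (rule cotangent_ext[OF b cotangent_space_sum[OF finite_Basis dfun_in_cotangent_space]])
      fix v assume v: "v \<in> tangent_space A p"
      interpret linear "\<lambda>w. b (dvec U \<phi> p w)" by (rule linear_cotangent_dvec[OF U b])
      have "b v = b (dvec U \<phi> p (\<Sum>i\<in>Basis. v (c i) *\<^sub>R i))" using c(2)[OF v] by simp
      also have "\<dots> = (\<Sum>i\<in>Basis. b (dvec U \<phi> p i) * dfun A (c i) p v)"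
        using v by (simp add: sum scale dfun_def mult.commute)
      finally show "b v = (\<Sum>i\<in>Basis. b (dvec U \<phi> p i) * dfun A (c i) p v)" .
    qed
    have "b v0 = (\<Sum>i\<in>Basis. L (dfun A (c i) p) * b (dvec U \<phi> p i))" unfolding v0_def
      by (intro cotangent_sum_vec[OF b] finite_Basis dvec_in_tangent_space[OF U])
    also have "\<dots> = (\<Sum>i\<in>Basis. b (dvec U \<phi> p i) * L (dfun A (c i) p))" by (simp add: mult.commute)
    also have "\<dots> = L (\<lambda>v. \<Sum>i\<in>Basis. b (dvec U \<phi> p i) * dfun A (c i) p v)"
      by (rule linear_functional_on_cotangent_sum[OF L finite_Basis dfun_in_cotangent_space, symmetric])
    also have "\<dots> = L b" using beq by simp
    finally show ?thesis .
  qed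
  with v0 show ?thesis by blast
qed

lemma tangent_separated:
  assumes "u \<in> tangent_space A p" "v \<in> tangent_space A p" "\<And>b. b \<in> cotangent_space A p \<Longrightarrow> b u = b v"
  shows "u = v"
proof
  fix f show "u f = v f"
  proof (cases "f \<in> C\<^sub>M")
    case True
    then show ?thesis using assms(3)[OF dfun_in_cotangent_space[of A f p]] assms(1,2) by (simp add: dfun_def)
  qed (use assms tangent_space_non_smooth in metis)
qed

lemma locally_constant_if_dfun_zero:
  assumes f: "f \<in> C\<^sub>M" and O: "open O'" "p \<in> O'"
    and z: "\<And>q v. q \<in> O' \<Longrightarrow> v \<in> tangent_space A q \<Longrightarrow> v f = 0"
  shows "\<forall>\<^sub>F q in nhds p. f q = f p"
proof -
  obtain U \<phi> where U: "(U, \<phi>) \<in> A" "p \<in> U" using covered by blast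
  let ?N = "{x \<in> Om U \<phi>. par U \<phi> x \<in> O'}"
  have "open ?N" "\<phi> p \<in> ?N"
    using open_par_vimage[OF U(1) O(1)] chart_in_Om[OF U] par_chart[OF U] O(2) by auto
  then obtain r where r: "r > 0" "ball (\<phi> p) r \<subseteq> ?N" using open_contains_ball by blast
  have "((\<lambda>x. f (par U \<phi> x)) has_derivative (\<lambda>h. 0)) (at x within ball (\<phi> p) r)" if "x \<in> ball (\<phi> p) r" for x
  proof -
    have x: "x \<in> Om U \<phi>" "par U \<phi> x \<in> O'" using that r by auto
    have "dvec U \<phi> (par U \<phi> x) u f = 0" for u
      by (rule z[OF x(2) dvec_in_tangent_space[OF U(1) par_in[OF U(1) x(1)]]])
    then show ?thesis using smooth_par_has_derivative_at[OF U(1) x(1) f] by (simp add: has_derivative_at_withinI)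
  qed
  from has_derivative_zero_constant[OF convex_ball this]
  obtain k where k: "\<And>x. x \<in> ball (\<phi> p) r \<Longrightarrow> f (par U \<phi> x) = k" by blast
  have "f q = f p" if "q \<in> {q \<in> U. \<phi> q \<in> ball (\<phi> p) r}" for q
    using that k[of "\<phi> q"] k[of "\<phi> p"] par_chart[OF U(1)] U(2) r(1) by auto
  moreover have "open {q \<in> U. \<phi> q \<in> ball (\<phi> p) r}" "p \<in> {q \<in> U. \<phi> q \<in> ball (\<phi> p) r}"
    using open_chart_vimage[OF U(1) open_ball] U(2) r(1) by auto
  ultimately show ?thesis unfolding eventually_nhds by blast
qed

lemma constant_if_dfun_zero:
  assumes "f \<in> C\<^sub>M" "connected (UNIV :: 'm set)" "\<And>q v. v \<in> tangent_space A q \<Longrightarrow> v f = 0"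
  shows "f p = f q"
proof (rule connected_local_const[OF assms(2) UNIV_I UNIV_I])
  show "\<forall>a\<in>UNIV. \<forall>\<^sub>F b in at a. f a = f b"
  proof
    fix a
    have "\<forall>\<^sub>F q in nhds a. f q = f a"
      by (rule locally_constant_if_dfun_zero[of f UNIV]) (use assms in auto)
    then show "\<forall>\<^sub>F b in at a. f a = f b"
      unfolding eventually_at_filter by (auto elim!: eventually_mono)
  qed
qed

text \<open>A ball around the chart value, intersected with the range of \<open>P\<close>, is
  convex; its image under \<open>par\<close> is the wanted neighbourhood.\<close>

lemma locally_path_connected:
  fixes q :: 'm
  assumes "open N" "q \<in> N"
  shows "\<exists>W. open W \<and> q \<in> W \<and> W \<subseteq> N \<and> path_connected W"
proof -
  obtain U \<phi> where U: "(U, \<phi>) \<in> A" "q \<in> U" using covered by blast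
  let ?N = "{x \<in> Om U \<phi>. par U \<phi> x \<in> N}"
  have "open ?N" "\<phi> q \<in> ?N"
    using open_par_vimage[OF U(1) assms(1)] chart_in_Om[OF U] par_chart[OF U] assms(2) by auto
  then obtain r where r: "r > 0" "ball (\<phi> q) r \<subseteq> ?N" using open_contains_ball by blast
  let ?B = "ball (\<phi> q) r \<inter> range P" and ?W = "{q' \<in> U. \<phi> q' \<in> ball (\<phi> q) r}"
  have B: "P x = x" if "x \<in> ?B" for x using that by auto
  have W: "?W = par U \<phi> ` ?B"
  proof
    show "?W \<subseteq> par U \<phi> ` ?B"
    proof
      fix q' assume q': "q' \<in> ?W"
      then have "\<phi> q' = P (\<phi> q')" "q' = par U \<phi> (\<phi> q')"
        using P_chart[OF U(1)] par_chart[OF U(1)] by auto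
      then show "q' \<in> par U \<phi> ` ?B" using q' by blast
    qed
    show "par U \<phi> ` ?B \<subseteq> ?W"
    proof clarify
      fix x assume x: "P x \<in> ball (\<phi> q) r"
      then have "P x \<in> Om U \<phi>" using r(2) by blast
      then show "par U \<phi> (P x) \<in> U \<and> \<phi> (par U \<phi> (P x)) \<in> ball (\<phi> q) r"
        using x par_in[OF U(1)] chart_par[OF U(1)] by simp
    qed
  qed
  have "convex ?B" by (intro convex_Int convex_ball linear_subspace_image subspace_imp_convex linear_P subspace_UNIV)
  then have "path_connected ?B" by (rule convex_imp_path_connected)
  then have "path_connected ?W" unfolding W
    by (rule path_connected_continuous_image[rotated])
      (use r(2) in \<open>auto intro: continuous_on_subset[OF continuous_on_par[OF U(1)]]\<close>)
  moreover have "open ?W" "q \<in> ?W" using open_chart_vimage[OF U(1) open_ball] U(2) r(1) by auto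
  moreover have "?W \<subseteq> N" using r(2) par_chart[OF U(1)] by auto
  ultimately show ?thesis by blast
qed

text \<open>The extended coordinate fields commute near \<open>p\<close>, so vanishing of the
  exterior derivative on them says that the coefficients of \<open>\<beta>\<close> in the chart have
  symmetric partial derivatives. The Poincare lemma on a ball gives a primitive there, which is then
  cut off to a global smooth function.\<close>

lemma local_primitive:
  assumes \<beta>: "one_form A \<beta>"
    and closed: "\<And>X Y q. vector_field A X \<Longrightarrow> vector_field A Y \<Longrightarrow> ext_deriv \<beta> X Y q = 0"
  shows "\<exists>N F. open N \<and> p \<in> N \<and> F \<in> C\<^sub>M \<and> (\<forall>q\<in>N. \<forall>v\<in>tangent_space A q. v F = \<beta> q v)"
proof -
  obtain U \<phi> where U: "(U, \<phi>) \<in> A" "p \<in> U" using covered by blast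
  have cot: "\<beta> q \<in> cotangent_space A q" for q using \<beta> by (simp add: one_form_def)
  obtain W where W: "open W" "p \<in> W" "W \<subseteq> U" "\<forall>w. \<exists>X. vector_field A X \<and> (\<forall>q\<in>W. X q = dvec U \<phi> q w)"
    by (rule dvec_extends[OF U]) blast
  obtain X where X: "\<And>w. vector_field A (X w)" "\<And>w q. q \<in> W \<Longrightarrow> X w q = dvec U \<phi> q w"
    using W(4) by metis
  define g where "g w q = \<beta> q (X w q)" for w q
  have g: "g w \<in> C\<^sub>M" for w using \<beta> X(1)[of w] unfolding one_form_def g_def[abs_def] by blast
  let ?N = "{x \<in> Om U \<phi>. par U \<phi> x \<in> W}"
  have "open ?N" "\<phi> p \<in> ?N"
    using open_par_vimage[OF U(1) W(1)] chart_in_Om[OF U] par_chart[OF U] W(2) by auto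
  then obtain r where r: "r > 0" "ball (\<phi> p) r \<subseteq> ?N" using open_contains_ball by blast
  \<comment> \<open>Near \<open>q\<close> the fields are coordinate fields, so this is the symmetry
    of second derivatives of \<open>f\<close> in the chart.\<close>
  have sym: "X u q (\<lambda>q. X w q f) = X w q (\<lambda>q. X u q f)" if q: "q \<in> W" and f: "f \<in> C\<^sub>M" for u w q f
  proof -
    let ?f = "\<lambda>x. f (par U \<phi> x)"
    have qU: "q \<in> U" using q W by blast
    have cf: "Cinf_on (Om U \<phi>) ?f" by (rule smooth_functionsD[OF f U(1)])
    have "X u q (\<lambda>q. X w q f) = frechet_derivative (\<lambda>x. frechet_derivative ?f (at x) w) (at (\<phi> q)) u" for u w
    proof -
      have sm: "(\<lambda>q. X w q f) \<in> C\<^sub>M" using X(1) f by (simp add: vector_field_def)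
      have "((\<lambda>x. frechet_derivative ?f (at x) w) has_derivative
          frechet_derivative (\<lambda>x. frechet_derivative ?f (at x) w) (at (\<phi> q))) (at (\<phi> q))"
        by (rule Cinf_on_has_derivative[OF Cinf_on_derivative[OF open_Om[OF U(1)] cf] chart_in_Om[OF U(1) qU]])
      then have "((\<lambda>x. X w (par U \<phi> x) f) has_derivative
          frechet_derivative (\<lambda>x. frechet_derivative ?f (at x) w) (at (\<phi> q))) (at (\<phi> q))"
      proof (rule has_derivative_transform_within_open)
        show "open ?N" by fact
        show "\<phi> q \<in> ?N" using q chart_in_Om[OF U(1) qU] par_chart[OF U(1) qU] by simp
        fix x assume x: "x \<in> ?N"
        then have "X w (par U \<phi> x) f = dvec U \<phi> (par U \<phi> x) w f" using X(2) by simp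
        also have "\<dots> = frechet_derivative ?f (at x) w"
          using frechet_derivative_at[OF smooth_par_has_derivative_at[OF U(1) _ f, of x]] x
          by (metis (mono_tags, lifting) mem_Collect_eq)
        finally show "frechet_derivative ?f (at x) w = X w (par U \<phi> x) f" by simp
      qed
      then have "dvec U \<phi> q u (\<lambda>q. X w q f) = frechet_derivative (\<lambda>x. frechet_derivative ?f (at x) w) (at (\<phi> q)) u"
        by (rule dvec_eqI[OF U(1) qU sm])
      then show ?thesis using X(2)[OF q] by simp
    qed
    then show ?thesis
      using symmetric_second_derivative[OF open_Om[OF U(1)] chart_in_Om[OF U(1) qU] cf] by simp
  qed
  have br: "vf_bracket (X u) (X w) q = (\<lambda>f. 0)" if "q \<in> W" for u w q
  proof
    fix f show "vf_bracket (X u) (X w) q f = 0"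
    proof (cases "f \<in> C\<^sub>M")
      case False
      then show ?thesis
        using tangent_space_non_smooth[OF vf_bracket_in_tangent_space[OF X(1) X(1)]] by blast
    qed (simp add: vf_bracket_def sym[OF that])
  qed
  have cl: "X u q (g w) = X w q (g u)" if "q \<in> W" for u w q
    using closed[OF X(1) X(1), of u w q] br[OF that] cotangent_zero_vec[OF cot, of q]
    by (simp add: ext_deriv_def g_def[abs_def])
  define b where "b x w = g w (par U \<phi> x)" for x w
  have cb: "Cinf_on (ball (\<phi> p) r) (\<lambda>x. b x w)" for w unfolding b_def
    by (rule Cinf_on_subset[OF smooth_functionsD[OF g U(1)]]) (use r in auto)
  have bx: "b x = (\<lambda>w. \<beta> (par U \<phi> x) (dvec U \<phi> (par U \<phi> x) w))" if "x \<in> ball (\<phi> p) r" for x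
  proof
    fix w
    have "par U \<phi> x \<in> W" using that r(2) by blast
    then show "b x w = \<beta> (par U \<phi> x) (dvec U \<phi> (par U \<phi> x) w)" by (simp add: b_def g_def X(2))
  qed
  have lb: "linear (b x)" if "x \<in> ball (\<phi> p) r" for x
    unfolding bx[OF that] using that r(2) W(3) by (intro linear_cotangent_dvec[OF U(1) _ cot]) auto
  have db: "frechet_derivative (\<lambda>x. b x w) (at x) u = X u (par U \<phi> x) (g w)" if "x \<in> ball (\<phi> p) r" for x u w
  proof -
    have x: "x \<in> Om U \<phi>" "par U \<phi> x \<in> W" using that r(2) by auto
    show ?thesis
      using frechet_derivative_at[OF smooth_par_has_derivative_at[OF U(1) x(1) g, of w]] X(2)[OF x(2)]
      unfolding b_def by metis
  qed
  obtain F where F: "Cinf_on (ball (\<phi> p) (r/2)) F" "\<forall>x\<in>ball (\<phi> p) (r/2). (F has_derivative b x) (at x)"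
  proof (rule poincare_ball[OF r(1) cb lb])
    fix x u w assume x: "x \<in> ball (\<phi> p) r"
    then show "frechet_derivative (\<lambda>x. b x w) (at x) u = frechet_derivative (\<lambda>x. b x u) (at x) w"
      using r(2) by (simp only: db) (intro cl, auto)
  qed blast
  have "Cinf_on (ball (\<phi> p) (r/2) \<inter> Om U \<phi>) F" by (rule Cinf_on_subset[OF F(1)]) auto
  then obtain G W' where G: "G \<in> C\<^sub>M" "open W'" "p \<in> W'" "W' \<subseteq> U"
    "\<And>q. q \<in> W' \<Longrightarrow> \<phi> q \<in> ball (\<phi> p) (r/2) \<and> G q = F (\<phi> q)"
    using local_extension[OF U, of "ball (\<phi> p) (r/2)" F] r(1) by (metis centre_in_ball half_gt_zero open_ball)
  have "v G = \<beta> q v" if q: "q \<in> W'" and v: "v \<in> tangent_space A q" for q v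
  proof -
    have qU: "q \<in> U" using q G by blast
    have q2: "\<phi> q \<in> ball (\<phi> p) (r/2)" using G(5)[OF q] by blast
    then have q1: "\<phi> q \<in> ball (\<phi> p) r" using r(1) by auto
    obtain w where w: "v = dvec U \<phi> q w" using tangent_is_dvec[OF U(1) qU v] by blast
    \<comment> \<open>Off the chart image \<open>G\<close> corresponds to \<open>F\<close> composed
      with \<open>P\<close>, not to \<open>F\<close>; the extra projection in the derivative
      disappears again by \<open>dvec_P\<close>.\<close>
    have "((\<lambda>x. F (P x)) has_derivative (\<lambda>u. b (\<phi> q) (P u))) (at (\<phi> q))"
      by (rule has_derivative_compose[of P P "\<phi> q" UNIV F])
        (use F(2) q2 P_chart[OF U(1) qU] bounded_linear_imp_has_derivative[OF bounded_linear_P] in auto)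
    then have "((\<lambda>x. G (par U \<phi> x)) has_derivative (\<lambda>u. b (\<phi> q) (P u))) (at (\<phi> q))"
    proof (rule has_derivative_transform_within_open)
      show "open {x \<in> Om U \<phi>. par U \<phi> x \<in> W'}" by (rule open_par_vimage[OF U(1) G(2)])
      show "\<phi> q \<in> {x \<in> Om U \<phi>. par U \<phi> x \<in> W'}"
        using chart_in_Om[OF U(1) qU] par_chart[OF U(1) qU] q by simp
      show "F (P x) = G (par U \<phi> x)" if "x \<in> {x \<in> Om U \<phi>. par U \<phi> x \<in> W'}" for x
        using that G(5)[of "par U \<phi> x"] chart_par[OF U(1), of x] by simp
    qed
    then have "v G = b (\<phi> q) (P w)" unfolding w by (rule dvec_eqI[OF U(1) qU G(1)])
    also have "\<dots> = \<beta> q v"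
      using bx[OF q1] par_chart[OF U(1) qU] dvec_P[OF U(1) qU] w by simp
    finally show ?thesis .
  qed
  then show ?thesis using G by blast
qed

text \<open>The monodromy argument is run on the family of all local primitives: two of them differ
  by a function with zero differential, hence by a locally constant one. The global function agrees
  near each point with a local primitive up to a constant, so it is smooth with the right
  differential.\<close>

lemma closed_form_primitive:
  assumes sc: "simply_connected (UNIV :: 'm set)" and \<beta>: "one_form A \<beta>"
    and closed: "\<And>X Y q. vector_field A X \<Longrightarrow> vector_field A Y \<Longrightarrow> ext_deriv \<beta> X Y q = 0"
  obtains f where "f \<in> C\<^sub>M" "\<And>q v. v \<in> tangent_space A q \<Longrightarrow> v f = \<beta> q v"
proof -
  define \<F> where "\<F> = {(N, F). open N \<and> F \<in> C\<^sub>M \<and> (\<forall>q\<in>N. \<forall>v\<in>tangent_space A q. v F = \<beta> q v)}"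
  interpret local_primitives \<F>
  proof
    show "\<exists>N F. (N, F) \<in> \<F> \<and> q \<in> N" for q
      using local_primitive[OF \<beta> closed, of q] by (auto simp: \<F>_def)
    fix N F N' F' q assume N: "(N, F) \<in> \<F>" "(N', F') \<in> \<F>" "q \<in> N" "q \<in> N'"
    have FC: "F \<in> C\<^sub>M" "F' \<in> C\<^sub>M" using N by (auto simp: \<F>_def)
    show "\<forall>\<^sub>F x in nhds q. F x - F' x = F q - F' q"
    proof (rule locally_constant_if_dfun_zero[of "\<lambda>x. F x - F' x" "N \<inter> N'"])
      fix x v assume x: "x \<in> N \<inter> N'" and v: "v \<in> tangent_space A x"
      have "v (\<lambda>x. F x + (-1) * F' x) = v F + v (\<lambda>x. (-1) * F' x)"
        by (rule tangent_space_add_fun[OF v FC(1) smooth_scale[OF FC(2)]])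
      also have "v (\<lambda>x. (-1) * F' x) = (-1) * v F'" by (rule tangent_space_scale_fun[OF v FC(2)])
      also have "v F = v F'" using x v N by (auto simp: \<F>_def)
      finally show "v (\<lambda>x. F x - F' x) = 0" by simp
    qed (use N FC in \<open>auto simp: \<F>_def\<close>)
  qed (auto simp: \<F>_def)
  obtain f where f: "\<forall>(N, F)\<in>\<F>. \<forall>q\<in>N. \<forall>\<^sub>F x in nhds q. f x - F x = f q - F q"
    using global_primitive[OF sc simply_connected_UNIV_imp_path_connected[OF sc] locally_path_connected]
    by blast
  have loc: "\<exists>O' F c. open O' \<and> q \<in> O' \<and> F \<in> C\<^sub>M \<and> (\<forall>x\<in>O'. f x = F x + c) \<and> (\<forall>v\<in>tangent_space A q. v F = \<beta> q v)" for q
  proof -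
    obtain N F where N: "(N, F) \<in> \<F>" "q \<in> N" using cover by blast
    have "\<forall>\<^sub>F x in nhds q. f x - F x = f q - F q" using f N by auto
    then obtain O' where O: "open O'" "q \<in> O'" "\<And>x. x \<in> O' \<Longrightarrow> f x - F x = f q - F q"
      unfolding eventually_nhds by auto
    have "\<forall>x\<in>O'. f x = F x + (f q - F q)" using O(3) by (simp add: algebra_simps)
    then show ?thesis using O(1,2) N by (auto simp: \<F>_def)
  qed
  have fC: "f \<in> C\<^sub>M"
  proof (rule smooth_local)
    fix p
    obtain O' F c where O: "open O'" "p \<in> O'" "F \<in> C\<^sub>M" "\<forall>x\<in>O'. f x = F x + c"
      using loc[of p] by auto
    then show "\<exists>O' g. open O' \<and> p \<in> O' \<and> g \<in> C\<^sub>M \<and> (\<forall>q\<in>O'. f q = g q)"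
      by (intro exI[of _ O'] exI[of _ "\<lambda>x. F x + c"]) auto
  qed
  have "v f = \<beta> q v" if v: "v \<in> tangent_space A q" for q v
  proof -
    obtain O' F c where O: "open O'" "q \<in> O'" "F \<in> C\<^sub>M" "\<forall>x\<in>O'. f x = F x + c" "v F = \<beta> q v"
      using loc[of q] v by auto
    have "v f = v (\<lambda>x. F x + c)"
      by (rule tangent_local[OF v O(1,2) fC]) (use O in auto)
    also have "\<dots> = v F" using tangent_space_add_fun[OF v O(3) smooth_const, of c] tangent_const[OF v] by simp
    finally show ?thesis using O(5) by simp
  qed
  with fC that show ?thesis by blast
qed

end

section \<open>Bivector fields and brackets of 1-forms\<close>

lemma bivector_left:
  assumes "bivector_field A \<pi>" "a \<in> cotangent_space A p" "a' \<in> cotangent_space A p" "b \<in> cotangent_space A p"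
  shows "\<pi> p (\<lambda>v. c * a v + c' * a' v) b = c * \<pi> p a b + c' * \<pi> p a' b"
proof -
  have L: "linear_functional_on (cotangent_space A p) (\<lambda>a. \<pi> p a b)"
    using assms by (simp add: bivector_field_def)
  have s: "(\<lambda>v. c * a v) \<in> cotangent_space A p" "(\<lambda>v. c' * a' v) \<in> cotangent_space A p"
    using cotangent_space_combination[OF assms(2,2), of c 0] cotangent_space_combination[OF assms(3,3), of c' 0]
    by auto
  show ?thesis using L s assms(2,3) by (simp add: linear_functional_on_def)
qed

lemma bivector_antisym:
  "bivector_field A \<pi> \<Longrightarrow> a \<in> cotangent_space A p \<Longrightarrow> b \<in> cotangent_space A p \<Longrightarrow> \<pi> p a b = - \<pi> p b a"
  unfolding bivector_field_def by blast

lemma bivector_self: "bivector_field A \<pi> \<Longrightarrow> a \<in> cotangent_space A p \<Longrightarrow> \<pi> p a a = 0"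
  using bivector_antisym[of A \<pi> a p a] by simp

lemma bivector_right:
  assumes "bivector_field A \<pi>" "a \<in> cotangent_space A p" "b \<in> cotangent_space A p" "b' \<in> cotangent_space A p"
  shows "\<pi> p a (\<lambda>v. c * b v + c' * b' v) = c * \<pi> p a b + c' * \<pi> p a b'"
  using bivector_left[OF assms(1,3,4,2), of c c'] cotangent_space_combination[OF assms(3,4), of c c']
    bivector_antisym[OF assms(1,2)] assms(3,4) by simp

text \<open>The coefficients are the 2 by 2 minors, as for a bivector evaluated in a
  three-dimensional coframe. The three covectors may be dependent, which matters for the forms on
  \<open>M\<close>.\<close>

lemma bivector_expand:
  assumes \<pi>: "bivector_field A \<pi>"
    and a: "a1 \<in> cotangent_space A p" "a2 \<in> cotangent_space A p" "a3 \<in> cotangent_space A p"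
  shows "\<pi> p (\<lambda>v. c1 * a1 v + c2 * a2 v + c3 * a3 v) (\<lambda>v. d1 * a1 v + d2 * a2 v + d3 * a3 v)
    = (c1 * d2 - c2 * d1) * \<pi> p a1 a2 + (c1 * d3 - c3 * d1) * \<pi> p a1 a3 + (c2 * d3 - c3 * d2) * \<pi> p a2 a3"
proof -
  let ?C = "cotangent_space A p"
  define b where "b = (\<lambda>v. d1 * a1 v + d2 * a2 v + d3 * a3 v)"
  have d: "(\<lambda>v. d1 * a1 v + d2 * a2 v) \<in> ?C" "(\<lambda>v. c1 * a1 v + c2 * a2 v) \<in> ?C"
    using a cotangent_space_combination by blast+
  have b: "b \<in> ?C" unfolding b_def using cotangent_space_combination[OF d(1) a(3), of 1 d3] by simp
  have "\<pi> p x b = d1 * \<pi> p x a1 + d2 * \<pi> p x a2 + d3 * \<pi> p x a3" if "x \<in> ?C" for x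
    unfolding b_def
    using bivector_right[OF \<pi> that d(1) a(3), of 1 d3] bivector_right[OF \<pi> that a(1,2), of d1 d2] by simp
  moreover have "\<pi> p (\<lambda>v. c1 * a1 v + c2 * a2 v + c3 * a3 v) b = c1 * \<pi> p a1 b + c2 * \<pi> p a2 b + c3 * \<pi> p a3 b"
    using bivector_left[OF \<pi> d(2) a(3) b, of 1 c3] bivector_left[OF \<pi> a(1,2) b, of c1 c2] by simp
  ultimately show ?thesis
    using bivector_self[OF \<pi>] bivector_antisym[OF \<pi> a(2,1)] bivector_antisym[OF \<pi> a(3,1)]
      bivector_antisym[OF \<pi> a(3,2)] a
    unfolding b_def[symmetric] by (simp add: algebra_simps)
qed

lemma bivector_smooth:
  "bivector_field A \<pi> \<Longrightarrow> one_form A \<beta> \<Longrightarrow> one_form A \<gamma> \<Longrightarrow> (\<lambda>p. \<pi> p (\<beta> p) (\<gamma> p)) \<in> smooth_functions A"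
  by (simp add: bivector_field_def)

lemma one_form_cotangent: "one_form A \<beta> \<Longrightarrow> \<beta> p \<in> cotangent_space A p"
  by (simp add: one_form_def)

lemma one_form_smooth: "one_form A \<beta> \<Longrightarrow> vector_field A X \<Longrightarrow> (\<lambda>p. \<beta> p (X p)) \<in> smooth_functions A"
  by (simp add: one_form_def)

lemma vector_field_tangent: "vector_field A X \<Longrightarrow> X p \<in> tangent_space A p"
  by (simp add: vector_field_def)

locale charted_bivector = charted "atlas M" P
  for M :: "('m::{t2_space,second_countable_topology}, 'e::euclidean_space) poisson_space" and P +
  assumes bivec: "bivector_field (atlas M) (bivector M)"
begin

abbreviation "\<pi> \<equiv> bivector M"

text \<open>The definite description in \<open>sharp\<close> is justified by
  \<open>cotangent_representation\<close> for existence and \<open>tangent_separated\<close> for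
  uniqueness.\<close>

lemma sharp_spec:
  assumes \<beta>: "\<beta> p \<in> cotangent_space (atlas M) p"
  shows sharp_tangent: "sharp M \<beta> p \<in> tangent_space (atlas M) p"
    and sharp_eval: "b \<in> cotangent_space (atlas M) p \<Longrightarrow> b (sharp M \<beta> p) = \<pi> p (\<beta> p) b"
proof -
  have "linear_functional_on (cotangent_space (atlas M) p) (\<lambda>b. \<pi> p (\<beta> p) b)"
    unfolding linear_functional_on_def
    using bivector_right[OF bivec \<beta>, where c = 1 and c' = 1] bivector_right[OF bivec \<beta>, where c' = 0]
    by simp
  from cotangent_representation[OF this]
  have "\<exists>!v. v \<in> tangent_space (atlas M) p \<and> (\<forall>b\<in>cotangent_space (atlas M) p. b v = \<pi> p (\<beta> p) b)"
    using tangent_separated by metis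
  then have *: "sharp M \<beta> p \<in> tangent_space (atlas M) p \<and>
      (\<forall>b\<in>cotangent_space (atlas M) p. b (sharp M \<beta> p) = \<pi> p (\<beta> p) b)"
    unfolding sharp_def by (rule theI')
  show "sharp M \<beta> p \<in> tangent_space (atlas M) p" using * by blast
  show "b \<in> cotangent_space (atlas M) p \<Longrightarrow> b (sharp M \<beta> p) = \<pi> p (\<beta> p) b" using * by blast
qed

lemma vector_field_sharp:
  assumes \<beta>: "one_form (atlas M) \<beta>" shows "vector_field (atlas M) (sharp M \<beta>)"
  unfolding vector_field_def
proof (intro conjI allI ballI)
  show T: "sharp M \<beta> p \<in> tangent_space (atlas M) p" for p
    by (rule sharp_tangent[of \<beta>, OF one_form_cotangent[OF \<beta>]])
  fix f assume f: "f \<in> C\<^sub>M"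
  have "sharp M \<beta> p f = \<pi> p (\<beta> p) (dfun (atlas M) f p)" for p
    using sharp_eval[of \<beta>, OF one_form_cotangent[OF \<beta>] dfun_in_cotangent_space[of "atlas M" f p]] T[of p]
    by (simp add: dfun_def)
  then show "(\<lambda>p. sharp M \<beta> p f) \<in> C\<^sub>M" using bivector_smooth[OF bivec \<beta> one_form_dfun[OF f]] by simp
qed

text \<open>Cartan's formula rewrites each Lie derivative as a contracted exterior derivative plus
  the differential of a contraction. The two contractions have opposite values, so together they
  contribute twice the differential of the pairing, and the last term of the bracket takes one of
  these away.\<close>

lemma form_bracket_eq:
  assumes \<beta>: "one_form (atlas M) \<beta>" and \<gamma>: "one_form (atlas M) \<gamma>" and X: "vector_field (atlas M) X"
  shows "form_bracket M \<beta> \<gamma> X p = X p (\<lambda>q. \<pi> q (\<beta> q) (\<gamma> q))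
    + ext_deriv \<gamma> (sharp M \<beta>) X p - ext_deriv \<beta> (sharp M \<gamma>) X p"
proof -
  have 1: "\<gamma> q (sharp M \<beta> q) = \<pi> q (\<beta> q) (\<gamma> q)" for q
    by (rule sharp_eval[of \<beta>]) (auto intro: one_form_cotangent \<beta> \<gamma>)
  have 2: "\<beta> q (sharp M \<gamma> q) = (- 1) * \<pi> q (\<beta> q) (\<gamma> q)" for q
    using sharp_eval[of \<gamma>, OF one_form_cotangent[OF \<gamma>] one_form_cotangent[OF \<beta>], of q]
      bivector_antisym[OF bivec one_form_cotangent[OF \<gamma>] one_form_cotangent[OF \<beta>], of q] by simp
  have "X p (\<lambda>q. (- 1) * \<pi> q (\<beta> q) (\<gamma> q)) = (- 1) * X p (\<lambda>q. \<pi> q (\<beta> q) (\<gamma> q))"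
    by (rule tangent_space_scale_fun[OF vector_field_tangent[OF X] bivector_smooth[OF bivec \<beta> \<gamma>]])
  then show ?thesis unfolding form_bracket_def lie_deriv_def ext_deriv_def 1 2 by simp
qed

end

section \<open>Euclidean spaces and the Heisenberg group\<close>

lemma charted_euclidean: "charted (euclidean_atlas :: ('e::euclidean_space, 'e) atlas) (\<lambda>x. x)"
  by unfold_locales
    (auto simp: euclidean_atlas_def homeomorphism_def smooth_on_def Ck_on_bounded_linear
      intro!: exI[of _ UNIV] exI[of _ "\<lambda>x. x"])

interpretation euc: charted "euclidean_atlas :: ('e::euclidean_space, 'e) atlas" "\<lambda>x. x"
  by (rule charted_euclidean)

lemma euclidean_chart: "(UNIV, id) \<in> (euclidean_atlas :: ('e::euclidean_space, 'e) atlas)"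
  by (simp add: euclidean_atlas_def)

lemma smooth_functions_euclidean_iff:
  "f \<in> smooth_functions (euclidean_atlas :: ('e::euclidean_space, 'e) atlas) \<longleftrightarrow> Cinf_on UNIV f"
  unfolding euc.smooth_functions_iff by (simp add: euclidean_atlas_def euc.Om_def euc.par_def)

definition evec :: "'e::euclidean_space \<Rightarrow> 'e \<Rightarrow> 'e tvec" where
  "evec p w f = (if Cinf_on UNIV f then frechet_derivative f (at p) w else 0)"

lemma dvec_euclidean: "euc.dvec UNIV id p = evec p"
  by (simp add: fun_eq_iff euc.dvec_def evec_def smooth_functions_euclidean_iff euc.par_def)

lemma evec_in_tangent_space: "evec p w \<in> tangent_space euclidean_atlas p"
  using euc.dvec_in_tangent_space[OF euclidean_chart UNIV_I] by (simp add: dvec_euclidean)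

lemma tangent_is_evec: "v \<in> tangent_space euclidean_atlas p \<Longrightarrow> \<exists>w. v = evec p w"
  using euc.tangent_is_dvec[OF euclidean_chart UNIV_I] by (simp add: dvec_euclidean)

lemma evec_linear:
  fixes L :: "'e::euclidean_space \<Rightarrow> real"
  assumes "bounded_linear L" shows "evec p w L = L w"
  using assms Cinf_on_bounded_linear[OF assms]
    frechet_derivative_at[OF bounded_linear_imp_has_derivative[OF assms], of p]
  by (simp add: evec_def)

lemma heis_tangent_eq: "heis_tangent = evec (0, 0, 0)"
  by (simp add: fun_eq_iff heis_tangent_def evec_def smooth_functions_euclidean_iff)

definition h1 :: "heis \<Rightarrow> real" where "h1 = fst"
definition h2 :: "heis \<Rightarrow> real" where "h2 p = fst (snd p)"
definition h3 :: "heis \<Rightarrow> real" where "h3 p = snd (snd p)"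

lemma bounded_linear_h: "bounded_linear h1" "bounded_linear h2" "bounded_linear h3"
  unfolding h1_def h2_def h3_def
  by (intro bounded_linear_fst bounded_linear_compose[OF bounded_linear_fst bounded_linear_snd]
      bounded_linear_compose[OF bounded_linear_snd bounded_linear_snd])+

lemma smooth_h [simp]: "h1 \<in> smooth_functions euclidean_atlas" "h2 \<in> smooth_functions euclidean_atlas"
  "h3 \<in> smooth_functions euclidean_atlas"
  by (simp_all add: smooth_functions_euclidean_iff Cinf_on_bounded_linear bounded_linear_h)

lemma evec_h [simp]: "evec p w h1 = h1 w" "evec p w h2 = h2 w" "evec p w h3 = h3 w"
  by (simp_all add: evec_linear bounded_linear_h)

lemma h_expand: "(h1 p, h2 p, h3 p) = p"
  by (simp add: h1_def h2_def h3_def)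

lemma tangent_heis: "v \<in> tangent_space euclidean_atlas p \<Longrightarrow> v = evec p (v h1, v h2, v h3)"
  using tangent_is_evec[of v p] h_expand by auto

lemma cotangent_heis:
  assumes "a \<in> cotangent_space euclidean_atlas (0, 0, 0)"
  shows "a (heis_tangent w) = h1 w * a heis_x + h2 w * a heis_y + h3 w * a heis_z"
proof -
  interpret linear "\<lambda>w. a (heis_tangent w)"
    using euc.linear_cotangent_dvec[OF euclidean_chart UNIV_I assms] by (simp add: dvec_euclidean heis_tangent_eq)
  have "w = h1 w *\<^sub>R (1, 0, 0) + h2 w *\<^sub>R (0, 1, 0) + h3 w *\<^sub>R (0, 0, 1)"
    by (simp add: h1_def h2_def h3_def)
  then have "a (heis_tangent w) = a (heis_tangent (h1 w *\<^sub>R (1, 0, 0) + h2 w *\<^sub>R (0, 1, 0) + h3 w *\<^sub>R (0, 0, 1)))"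
    by simp
  also have "\<dots> = h1 w * a heis_x + h2 w * a heis_y + h3 w * a heis_z"
    by (simp only: add scale heis_x_def heis_y_def heis_z_def real_scaleR_def)
  finally show ?thesis .
qed

section \<open>Maps into the Heisenberg group in coordinates\<close>

context charted
begin

lemma smooth_map_heis_iff:
  fixes F :: "'m \<Rightarrow> heis"
  shows "smooth_map A euclidean_atlas F \<longleftrightarrow>
    (\<lambda>q. h1 (F q)) \<in> C\<^sub>M \<and> (\<lambda>q. h2 (F q)) \<in> C\<^sub>M \<and> (\<lambda>q. h3 (F q)) \<in> C\<^sub>M"
proof -
  have "Cinf_on S (\<lambda>x. F (g x)) \<longleftrightarrow> Cinf_on S (\<lambda>x. h1 (F (g x))) \<and> Cinf_on S (\<lambda>x. h2 (F (g x))) \<and>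
      Cinf_on S (\<lambda>x. h3 (F (g x)))" for S :: "'e set" and g :: "'e \<Rightarrow> 'm"
  proof
    assume "Cinf_on S (\<lambda>x. h1 (F (g x))) \<and> Cinf_on S (\<lambda>x. h2 (F (g x))) \<and> Cinf_on S (\<lambda>x. h3 (F (g x)))"
    then have "Cinf_on S (\<lambda>x. (h1 (F (g x)), h2 (F (g x)), h3 (F (g x))))"
      by (intro Cinf_on_Pair) auto
    then show "Cinf_on S (\<lambda>x. F (g x))" by (simp add: h_expand)
  qed (use Cinf_on_linear_comp bounded_linear_h in blast)
  then show ?thesis unfolding smooth_map_euclidean_iff smooth_functions_iff by auto
qed

lemma tangent_heis_comp:
  fixes F :: "'m \<Rightarrow> heis"
  assumes F: "smooth_map A euclidean_atlas F" and v: "v \<in> tangent_space A p"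
    and f: "Cinf_on UNIV f"
  shows "v (\<lambda>q. f (F q)) =
      evec (F p) (v (\<lambda>q. h1 (F q)), v (\<lambda>q. h2 (F q)), v (\<lambda>q. h3 (F q))) f"
proof -
  have fF: "(\<lambda>q. f (F q)) \<in> C\<^sub>M"
    using F unfolding smooth_map_euclidean_iff smooth_functions_iff
    by (auto intro!: Cinf_on_compose[OF f])
  obtain U \<phi> where U: "(U, \<phi>) \<in> A" "p \<in> U" using covered by blast
  obtain w where w: "v = dvec U \<phi> p w" using tangent_is_dvec[OF U v] by blast
  have Fc: "(\<lambda>q. h1 (F q)) \<in> C\<^sub>M" "(\<lambda>q. h2 (F q)) \<in> C\<^sub>M" "(\<lambda>q. h3 (F q)) \<in> C\<^sub>M"
    using F smooth_map_heis_iff by auto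
  have "((\<lambda>x. (h1 (F (par U \<phi> x)), h2 (F (par U \<phi> x)), h3 (F (par U \<phi> x)))) has_derivative
      (\<lambda>w. (dvec U \<phi> p w (\<lambda>q. h1 (F q)), dvec U \<phi> p w (\<lambda>q. h2 (F q)), dvec U \<phi> p w (\<lambda>q. h3 (F q))))) (at (\<phi> p))"
    by (intro has_derivative_Pair smooth_par_has_derivative[OF U] Fc)
  then have d: "((\<lambda>x. F (par U \<phi> x)) has_derivative
      (\<lambda>w. (dvec U \<phi> p w (\<lambda>q. h1 (F q)), dvec U \<phi> p w (\<lambda>q. h2 (F q)), dvec U \<phi> p w (\<lambda>q. h3 (F q))))) (at (\<phi> p))"
    by (simp add: h_expand)
  have "(f has_derivative frechet_derivative f (at (F (par U \<phi> (\<phi> p))))) (at (F (par U \<phi> (\<phi> p))))"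
    using Cinf_on_has_derivative[OF f] by blast
  from dvec_eqI[OF U fF has_derivative_compose[OF d this], of w]
  show "v (\<lambda>q. f (F q)) = evec (F p) (v (\<lambda>q. h1 (F q)), v (\<lambda>q. h2 (F q)), v (\<lambda>q. h3 (F q))) f"
    using f by (simp add: w evec_def par_chart[OF U])
qed

lemma push_heis:
  fixes F :: "'m \<Rightarrow> heis"
  assumes F: "smooth_map A euclidean_atlas F" and v: "v \<in> tangent_space A p"
  shows "push euclidean_atlas F v = evec (F p) (v (\<lambda>q. h1 (F q)), v (\<lambda>q. h2 (F q)), v (\<lambda>q. h3 (F q)))"
  using tangent_heis_comp[OF F v]
  by (auto simp: fun_eq_iff push_def smooth_functions_euclidean_iff o_def evec_def)

end

lemma heis_simps [simp]:
  "atlas (heisenberg_group \<pi>) = euclidean_atlas" "bivector (heisenberg_group \<pi>) = \<pi>"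
  "gone (heisenberg_group \<pi>) = (0, 0, 0)"
  "gmult (heisenberg_group \<pi>) g g' = (h1 g + h1 g', h2 g + h2 g', h3 g + h3 g' + h1 g * h2 g')"
  "ginv (heisenberg_group \<pi>) g = (- h1 g, - h2 g, h1 g * h2 g - h3 g)"
  by (simp_all add: heisenberg_group_def h1_def h2_def h3_def split_beta)

lemma h_Pair [simp]: "h1 (a, b, c) = a" "h2 (a, b, c) = b" "h3 (a, b, c) = c"
  by (simp_all add: h1_def h2_def h3_def)

lemma tangent_heis_affine:
  assumes v: "v \<in> tangent_space euclidean_atlas p"
  shows "v (\<lambda>x. k + (a * h1 x + b * h2 x + c * h3 x)) = a * v h1 + b * v h2 + c * v h3"
proof -
  obtain w where w: "v = evec p w" using tangent_is_evec[OF v] by blast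
  have L: "bounded_linear (\<lambda>x. a * h1 x + b * h2 x + c * h3 x)"
    by (intro bounded_linear_add bounded_linear_mult_right[THEN bounded_linear_compose] bounded_linear_h)
  then have "v (\<lambda>x. a * h1 x + b * h2 x + c * h3 x) = a * v h1 + b * v h2 + c * v h3"
    unfolding w by (simp add: evec_linear)
  moreover have "v (\<lambda>x. k + (a * h1 x + b * h2 x + c * h3 x)) = v (\<lambda>x. k) + v (\<lambda>x. a * h1 x + b * h2 x + c * h3 x)"
    by (rule tangent_space_add_fun[OF v])
      (simp_all add: smooth_functions_euclidean_iff Cinf_on_bounded_linear[OF L])
  ultimately show ?thesis using euc.tangent_const[OF v] by simp
qed

lemma smooth_affine_heis:
  "Cinf_on S (\<lambda>x. k + (a * h1 x + b * h2 x + c * h3 x))"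
  by (intro Cinf_on_intros Cinf_on_bounded_linear bounded_linear_h)

lemma (in charted) one_form_combination:
  assumes \<beta>: "one_form A \<beta>" and \<gamma>: "one_form A \<gamma>" and f: "f \<in> C\<^sub>M"
  shows "one_form A (\<lambda>p v. \<beta> p v + f p * \<gamma> p v)"
  unfolding one_form_def
proof (intro conjI allI impI)
  show "(\<lambda>v. \<beta> p v + f p * \<gamma> p v) \<in> cotangent_space A p" for p
    using cotangent_space_combination[OF one_form_cotangent[OF \<beta>] one_form_cotangent[OF \<gamma>], of 1 p "f p"]
    by simp
  show "(\<lambda>p. \<beta> p (X p) + f p * \<gamma> p (X p)) \<in> C\<^sub>M" if "vector_field A X" for X
    by (intro smooth_add smooth_mult f one_form_smooth[OF \<beta> that] one_form_smooth[OF \<gamma> that])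
qed

section \<open>Left invariant forms and multiplicative bivectors on the Heisenberg group\<close>

definition \<theta>\<^sub>1 :: "heis form1" where "\<theta>\<^sub>1 = dfun euclidean_atlas h1"
definition \<theta>\<^sub>2 :: "heis form1" where "\<theta>\<^sub>2 = dfun euclidean_atlas h2"
definition \<theta>\<^sub>3 :: "heis form1" where
  "\<theta>\<^sub>3 = (\<lambda>g v. dfun euclidean_atlas h3 g v + - h1 g * dfun euclidean_atlas h2 g v)"

lemma one_form_\<theta>: "one_form euclidean_atlas \<theta>\<^sub>1" "one_form euclidean_atlas \<theta>\<^sub>2" "one_form euclidean_atlas \<theta>\<^sub>3"
proof -
  show "one_form euclidean_atlas \<theta>\<^sub>1" "one_form euclidean_atlas \<theta>\<^sub>2"
    unfolding \<theta>\<^sub>1_def \<theta>\<^sub>2_def by (intro one_form_dfun smooth_h)+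
  have "(\<lambda>g. - h1 g) \<in> smooth_functions euclidean_atlas"
    using euc.smooth_scale[OF smooth_h(1), of "-1"] by simp
  then show "one_form euclidean_atlas \<theta>\<^sub>3" unfolding \<theta>\<^sub>3_def
    by (intro euc.one_form_combination one_form_dfun smooth_h)
qed

lemma \<theta>_eval:
  assumes "v \<in> tangent_space euclidean_atlas g"
  shows "\<theta>\<^sub>1 g v = v h1" "\<theta>\<^sub>2 g v = v h2" "\<theta>\<^sub>3 g v = v h3 - h1 g * v h2"
  using assms by (simp_all add: \<theta>\<^sub>1_def \<theta>\<^sub>2_def \<theta>\<^sub>3_def dfun_def)

lemma \<theta>_outside:
  assumes "v \<notin> tangent_space euclidean_atlas g"
  shows "\<theta>\<^sub>1 g v = 0" "\<theta>\<^sub>2 g v = 0" "\<theta>\<^sub>3 g v = 0"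
  using assms by (simp_all add: \<theta>\<^sub>1_def \<theta>\<^sub>2_def \<theta>\<^sub>3_def dfun_def)

lemma smooth_affine_map_heis:
  "smooth_map euclidean_atlas euclidean_atlas (\<lambda>x. (k1 + (a1 * h1 x + b1 * h2 x + c1 * h3 x),
     k2 + (a2 * h1 x + b2 * h2 x + c2 * h3 x), k3 + (a3 * h1 x + b3 * h2 x + c3 * h3 x)))"
  unfolding euc.smooth_map_heis_iff by (simp add: smooth_functions_euclidean_iff smooth_affine_heis)

text \<open>Left and right translation by a fixed element of the Heisenberg group are affine in the
  coordinates, so this formula serves both \<open>push_left_heis\<close> and
  \<open>push_right_heis\<close>.\<close>

lemma push_affine_heis:
  assumes v: "v \<in> tangent_space euclidean_atlas p"
  shows "push euclidean_atlas (\<lambda>x. (k1 + (a1 * h1 x + b1 * h2 x + c1 * h3 x),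
     k2 + (a2 * h1 x + b2 * h2 x + c2 * h3 x), k3 + (a3 * h1 x + b3 * h2 x + c3 * h3 x))) v =
   evec (k1 + (a1 * h1 p + b1 * h2 p + c1 * h3 p),
     k2 + (a2 * h1 p + b2 * h2 p + c2 * h3 p), k3 + (a3 * h1 p + b3 * h2 p + c3 * h3 p))
    (a1 * v h1 + b1 * v h2 + c1 * v h3, a2 * v h1 + b2 * v h2 + c2 * v h3, a3 * v h1 + b3 * v h2 + c3 * v h3)"
  unfolding euc.push_heis[OF smooth_affine_map_heis v] h_Pair tangent_heis_affine[OF v] ..

text \<open>Additivity carries the derivative at 0 to every point, so the derivative is
  constant.\<close>

lemma additive_differentiable_linear:
  fixes r :: "real \<Rightarrow> real"
  assumes add: "\<And>s t. r (s + t) = r s + r t" and d: "(r has_real_derivative d) (at 0)"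
  shows "r t = d * t"
proof -
  have "(r has_real_derivative d) (at t)" for t
  proof -
    have "((\<lambda>s. r t + r s) has_real_derivative d) (at 0)" using d by (auto intro!: derivative_eq_intros)
    then have "((\<lambda>s. r (s + t)) has_real_derivative d) (at 0)" by (simp add: add add.commute)
    then show ?thesis using DERIV_shift[of r d 0 t] by simp
  qed
  then have "((\<lambda>t. r t - d * t) has_real_derivative 0) (at t)" for t
    by (auto intro!: derivative_eq_intros)
  then have "r t - d * t = r 0 - d * 0" by (intro DERIV_isconst_all[rule_format]) auto
  moreover have "r 0 = 0" using add[of 0 0] by simp
  ultimately show ?thesis by simp
qed

lemma push_left_heis:
  assumes v: "v \<in> tangent_space euclidean_atlas p"
  shows "push euclidean_atlas (gmult (heisenberg_group \<pi>) g) v =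
    evec (gmult (heisenberg_group \<pi>) g p) (v h1, v h2, v h3 + h1 g * v h2)"
  using push_affine_heis[OF v, of "h1 g" 1 0 0 "h2 g" 0 1 0 "h3 g" 0 "h1 g" 1]
  by (simp add: algebra_simps fun_eq_iff heis_simps(4)[abs_def])

lemma push_right_heis:
  assumes v: "v \<in> tangent_space euclidean_atlas p"
  shows "push euclidean_atlas (\<lambda>k. gmult (heisenberg_group \<pi>) k g) v =
    evec (gmult (heisenberg_group \<pi>) p g) (v h1, v h2, v h3 + h2 g * v h1)"
  using push_affine_heis[OF v, of "h1 g" 1 0 0 "h2 g" 0 1 0 "h3 g" "h2 g" 0 1]
  by (simp add: algebra_simps)

text \<open>At the unit the three invariant forms are dual to \<open>heis_x\<close>,
  \<open>heis_y\<close>, \<open>heis_z\<close>, so the values of \<open>a\<close> on this basis are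
  the coefficients everywhere.\<close>

lemma left_form_heis:
  assumes a: "a \<in> cotangent_space euclidean_atlas (0, 0, 0)"
  shows "left_form (heisenberg_group \<pi>) a g =
    (\<lambda>v. a heis_x * \<theta>\<^sub>1 g v + a heis_y * \<theta>\<^sub>2 g v + a heis_z * \<theta>\<^sub>3 g v)"
proof
  fix v
  show "left_form (heisenberg_group \<pi>) a g v = a heis_x * \<theta>\<^sub>1 g v + a heis_y * \<theta>\<^sub>2 g v + a heis_z * \<theta>\<^sub>3 g v"
  proof (cases "v \<in> tangent_space euclidean_atlas g")
    case True
    have "left_form (heisenberg_group \<pi>) a g v =
        a (heis_tangent (v h1, v h2, v h3 + - h1 g * v h2))"
      unfolding left_form_def cot_pull_def heis_simps(1) push_left_heis[OF True] heis_tangent_eq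
      using True by simp
    then show ?thesis using True by (simp add: cotangent_heis[OF a] \<theta>_eval algebra_simps)
  qed (simp add: left_form_def cot_pull_def \<theta>_outside)
qed

context
  fixes \<pi> :: "heis bivec"
  assumes mult: "multiplicative (heisenberg_group \<pi>)" and bv: "bivector_field euclidean_atlas \<pi>"
begin

abbreviation "mul \<equiv> gmult (heisenberg_group \<pi>)"
abbreviation "pull \<equiv> cot_pull euclidean_atlas (euclidean_atlas :: (heis, heis) atlas)"

text \<open>Left translations preserve all three forms. Right translations act by the coadjoint
  representation, which moves only the third form; this is the source of the correction terms in
  \<open>P\<^sub>1\<^sub>3_mult\<close> and \<open>P\<^sub>2\<^sub>3_mult\<close>, both of them
  multiples of \<open>P\<^sub>1\<^sub>2\<close>.\<close>

lemma cot_pull_\<theta>: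
  shows cot_pull_left_\<theta>: "pull (mul g) p (\<theta>\<^sub>1 (mul g p)) = \<theta>\<^sub>1 p" "pull (mul g) p (\<theta>\<^sub>2 (mul g p)) = \<theta>\<^sub>2 p"
      "pull (mul g) p (\<theta>\<^sub>3 (mul g p)) = \<theta>\<^sub>3 p"
    and cot_pull_right_\<theta>: "pull (\<lambda>k. mul k p) g (\<theta>\<^sub>1 (mul g p)) = \<theta>\<^sub>1 g" "pull (\<lambda>k. mul k p) g (\<theta>\<^sub>2 (mul g p)) = \<theta>\<^sub>2 g"
      "pull (\<lambda>k. mul k p) g (\<theta>\<^sub>3 (mul g p)) = (\<lambda>v. h2 p * \<theta>\<^sub>1 g v + - h1 p * \<theta>\<^sub>2 g v + 1 * \<theta>\<^sub>3 g v)"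
proof -
  note [simp del] = heis_simps(4)
  note [simp] = cot_pull_def push_left_heis push_right_heis \<theta>_eval[OF evec_in_tangent_space] \<theta>_eval \<theta>_outside
  have [simp]: "h1 (mul g p) = h1 g + h1 p" by (simp add: heis_simps(4))
  show "pull (mul g) p (\<theta>\<^sub>1 (mul g p)) = \<theta>\<^sub>1 p" "pull (mul g) p (\<theta>\<^sub>2 (mul g p)) = \<theta>\<^sub>2 p"
      "pull (mul g) p (\<theta>\<^sub>3 (mul g p)) = \<theta>\<^sub>3 p" "pull (\<lambda>k. mul k p) g (\<theta>\<^sub>1 (mul g p)) = \<theta>\<^sub>1 g"
      "pull (\<lambda>k. mul k p) g (\<theta>\<^sub>2 (mul g p)) = \<theta>\<^sub>2 g"
      "pull (\<lambda>k. mul k p) g (\<theta>\<^sub>3 (mul g p)) = (\<lambda>v. h2 p * \<theta>\<^sub>1 g v + - h1 p * \<theta>\<^sub>2 g v + 1 * \<theta>\<^sub>3 g v)"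
    by (auto simp: fun_eq_iff algebra_simps)
qed

lemma \<theta>_cotangent: "\<theta>\<^sub>1 g \<in> cotangent_space euclidean_atlas g" "\<theta>\<^sub>2 g \<in> cotangent_space euclidean_atlas g"
  "\<theta>\<^sub>3 g \<in> cotangent_space euclidean_atlas g"
  using one_form_\<theta> by (auto intro: one_form_cotangent)

lemma multiplicative_heis:
  assumes "a \<in> cotangent_space euclidean_atlas (mul g p)"
    "b \<in> cotangent_space euclidean_atlas (mul g p)"
  shows "\<pi> (mul g p) a b =
     \<pi> p (pull (mul g) p a)
         (pull (mul g) p b)
   + \<pi> g (pull (\<lambda>k. mul k p) g a)
         (pull (\<lambda>k. mul k p) g b)"
  using mult assms unfolding multiplicative_def heis_simps(1,2) by blast

abbreviation "P\<^sub>1\<^sub>2 \<equiv> \<lambda>g. \<pi> g (\<theta>\<^sub>1 g) (\<theta>\<^sub>2 g)"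
abbreviation "P\<^sub>1\<^sub>3 \<equiv> \<lambda>g. \<pi> g (\<theta>\<^sub>1 g) (\<theta>\<^sub>3 g)"
abbreviation "P\<^sub>2\<^sub>3 \<equiv> \<lambda>g. \<pi> g (\<theta>\<^sub>2 g) (\<theta>\<^sub>3 g)"

lemma P\<^sub>1\<^sub>2_mult: "P\<^sub>1\<^sub>2 (mul g p) = P\<^sub>1\<^sub>2 g + P\<^sub>1\<^sub>2 p"
  unfolding multiplicative_heis[OF \<theta>_cotangent(1,2)] cot_pull_left_\<theta> cot_pull_right_\<theta> by simp

lemma P\<^sub>1\<^sub>3_mult: "P\<^sub>1\<^sub>3 (mul g p) = P\<^sub>1\<^sub>3 g + P\<^sub>1\<^sub>3 p - h1 p * P\<^sub>1\<^sub>2 g"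
  unfolding multiplicative_heis[OF \<theta>_cotangent(1,3)] cot_pull_left_\<theta> cot_pull_right_\<theta>
  using bivector_expand[OF bv \<theta>_cotangent, of g 1 0 0 "h2 p" "- h1 p" 1] by simp

lemma P\<^sub>2\<^sub>3_mult: "P\<^sub>2\<^sub>3 (mul g p) = P\<^sub>2\<^sub>3 g + P\<^sub>2\<^sub>3 p - h2 p * P\<^sub>1\<^sub>2 g"
  unfolding multiplicative_heis[OF \<theta>_cotangent(2,3)] cot_pull_left_\<theta> cot_pull_right_\<theta>
  using bivector_expand[OF bv \<theta>_cotangent, of g 0 1 0 "h2 p" "- h1 p" 1] by simp

text \<open>On each coordinate axis, a one-parameter subgroup, \<open>Q\<close> is additive and
  hence linear; every element is a product of elements of the three axes.\<close>

lemma heis_homomorphism_linear: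
  assumes Q: "Cinf_on UNIV Q" and add: "\<And>g p. Q (mul g p) = Q g + Q p"
  shows "Q g = h1 g * heis_x Q + h2 g * heis_y Q + h3 g * heis_z Q"
proof -
  have line: "Q (t *\<^sub>R w) = heis_tangent w Q * t"
    if "\<And>s t. mul (s *\<^sub>R w) (t *\<^sub>R w) = (s + t) *\<^sub>R w" for w t
  proof (rule additive_differentiable_linear)
    show "Q ((s + t) *\<^sub>R w) = Q (s *\<^sub>R w) + Q (t *\<^sub>R w)" for s t
      using that[of s t] add[of "s *\<^sub>R w" "t *\<^sub>R w"] by simp
    have "((\<lambda>s. Q (0 + s *\<^sub>R w)) has_real_derivative frechet_derivative Q (at (0 + 0 *\<^sub>R w)) w) (at 0)"
      by (rule line_has_derivative[OF Q]) simp
    then show "((\<lambda>s. Q (s *\<^sub>R w)) has_real_derivative heis_tangent w Q) (at 0)"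
      using Q by (simp add: heis_tangent_eq evec_def flip: zero_prod_def)
  qed
  \<comment> \<open>The factor from the second axis stands on the left, where the product term
    \<open>h1 g * h2 g'\<close> of the group law contributes nothing.\<close>
  have "g = mul (mul (h2 g *\<^sub>R (0, 1, 0)) (h1 g *\<^sub>R (1, 0, 0)))
      (h3 g *\<^sub>R (0, 0, 1))"
    using h_expand[of g] by simp
  then have "Q g = Q (h2 g *\<^sub>R (0, 1, 0)) + Q (h1 g *\<^sub>R (1, 0, 0)) + Q (h3 g *\<^sub>R (0, 0, 1))"
    by (metis add)
  then show ?thesis
    using line[of "(1, 0, 0)" "h1 g"] line[of "(0, 1, 0)" "h2 g"] line[of "(0, 0, 1)" "h3 g"]
    by (simp add: heis_x_def heis_y_def heis_z_def)
qed

lemma heis_bivector: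
  assumes "heis_x P\<^sub>1\<^sub>2 = 0" "heis_y P\<^sub>1\<^sub>2 = 0" "heis_z P\<^sub>1\<^sub>2 = 0"
  shows "P\<^sub>1\<^sub>2 g = 0"
    and "P\<^sub>1\<^sub>3 g = h1 g * heis_x P\<^sub>1\<^sub>3 + h2 g * heis_y P\<^sub>1\<^sub>3 + h3 g * heis_z P\<^sub>1\<^sub>3"
    and "P\<^sub>2\<^sub>3 g = h1 g * heis_x P\<^sub>2\<^sub>3 + h2 g * heis_y P\<^sub>2\<^sub>3 + h3 g * heis_z P\<^sub>2\<^sub>3"
proof -
  note sm = bivector_smooth[OF bv, unfolded smooth_functions_euclidean_iff]
  have 0: "P\<^sub>1\<^sub>2 g = 0" for g
    using heis_homomorphism_linear[OF sm[OF one_form_\<theta>(1,2)] P\<^sub>1\<^sub>2_mult, of g] assms by simp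
  show "P\<^sub>1\<^sub>2 g = 0" by (rule 0)
  show "P\<^sub>1\<^sub>3 g = h1 g * heis_x P\<^sub>1\<^sub>3 + h2 g * heis_y P\<^sub>1\<^sub>3 + h3 g * heis_z P\<^sub>1\<^sub>3"
    by (rule heis_homomorphism_linear[OF sm[OF one_form_\<theta>(1,3)]]) (simp only: P\<^sub>1\<^sub>3_mult 0 mult_zero_right diff_zero)
  show "P\<^sub>2\<^sub>3 g = h1 g * heis_x P\<^sub>2\<^sub>3 + h2 g * heis_y P\<^sub>2\<^sub>3 + h3 g * heis_z P\<^sub>2\<^sub>3"
    by (rule heis_homomorphism_linear[OF sm[OF one_form_\<theta>(2,3)]]) (simp only: P\<^sub>2\<^sub>3_mult 0 mult_zero_right diff_zero)
qed

end

section \<open>Poisson maps into the Heisenberg group\<close>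

lemma (in charted) form_pull_heis:
  fixes \<mu> :: "'m \<Rightarrow> heis"
  assumes \<mu>: "smooth_map A euclidean_atlas \<mu>" and a: "a \<in> cotangent_space euclidean_atlas (0, 0, 0)"
    and v: "v \<in> tangent_space A p"
  shows "form_pull A euclidean_atlas \<mu> (left_form (heisenberg_group \<pi>) a) p v =
    a heis_x * v (\<lambda>q. h1 (\<mu> q)) + a heis_y * v (\<lambda>q. h2 (\<mu> q))
    + a heis_z * (v (\<lambda>q. h3 (\<mu> q)) - h1 (\<mu> p) * v (\<lambda>q. h2 (\<mu> q)))"
  using v by (simp add: form_pull_def cot_pull_def push_heis[OF \<mu> v] left_form_heis[OF a]
      \<theta>_eval[OF evec_in_tangent_space])

text \<open>The coefficients are the derivatives of \<open>f\<close> along the left invariant frame dual to \<open>\<theta>\<close>.\<close>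

lemma (in charted_bivector) bracket_heis_comp:
  fixes \<mu> :: "'m \<Rightarrow> heis" and p :: 'm
  assumes \<mu>: "smooth_map (atlas M) euclidean_atlas \<mu>"
    and a: "a1 \<in> cotangent_space (atlas M) p" "a2 \<in> cotangent_space (atlas M) p" "a3 \<in> cotangent_space (atlas M) p"
    and eq: "\<And>v. v \<in> tangent_space (atlas M) p \<Longrightarrow> v (\<lambda>q. h1 (\<mu> q)) = a1 v"
      "\<And>v. v \<in> tangent_space (atlas M) p \<Longrightarrow> v (\<lambda>q. h2 (\<mu> q)) = a2 v"
      "\<And>v. v \<in> tangent_space (atlas M) p \<Longrightarrow> v (\<lambda>q. h3 (\<mu> q)) = a3 v + h1 (\<mu> p) * a2 v"
    and fg: "Cinf_on UNIV f" "Cinf_on UNIV g"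
  defines "\<And>f. D1 f \<equiv> evec (\<mu> p) (1, 0, 0) f" and "\<And>f. D2 f \<equiv> evec (\<mu> p) (0, 1, h1 (\<mu> p)) f"
    and "\<And>f. D3 f \<equiv> evec (\<mu> p) (0, 0, 1) f"
  shows "poisson_bracket M (f \<circ> \<mu>) (g \<circ> \<mu>) p =
    (D1 f * D2 g - D2 f * D1 g) * \<pi> p a1 a2 + (D1 f * D3 g - D3 f * D1 g) * \<pi> p a1 a3
    + (D2 f * D3 g - D3 f * D2 g) * \<pi> p a2 a3"
proof -
  have d: "dfun (atlas M) (f \<circ> \<mu>) p = (\<lambda>v. D1 f * a1 v + D2 f * a2 v + D3 f * a3 v)"
    if f: "Cinf_on UNIV f" for f
  proof (rule cotangent_ext[OF dfun_in_cotangent_space])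
    show "(\<lambda>v. D1 f * a1 v + D2 f * a2 v + D3 f * a3 v) \<in> cotangent_space (atlas M) p"
      using cotangent_space_combination[OF cotangent_space_combination[OF a(1,2), of "D1 f" "D2 f"] a(3), of 1 "D3 f"]
      by simp
    fix v assume v: "v \<in> tangent_space (atlas M) p"
    interpret linear "\<lambda>w. evec (\<mu> p) w f"
      using euc.linear_dvec[OF euclidean_chart UNIV_I, of f "\<mu> p"] f
      by (simp add: dvec_euclidean smooth_functions_euclidean_iff)
    have "dfun (atlas M) (f \<circ> \<mu>) p v = evec (\<mu> p) (a1 v, a2 v, a3 v + h1 (\<mu> p) * a2 v) f"
      using tangent_heis_comp[OF \<mu> v f] v eq[OF v] by (simp add: dfun_def o_def)
    also have "(a1 v, a2 v, a3 v + h1 (\<mu> p) * a2 v)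
        = a1 v *\<^sub>R (1, 0, 0) + a2 v *\<^sub>R (0, 1, h1 (\<mu> p)) + a3 v *\<^sub>R (0, 0, 1)" by simp
    also have "evec (\<mu> p) (a1 v *\<^sub>R (1, 0, 0) + a2 v *\<^sub>R (0, 1, h1 (\<mu> p)) + a3 v *\<^sub>R (0, 0, 1)) f
        = D1 f * a1 v + D2 f * a2 v + D3 f * a3 v"
      by (simp only: add scale D1_def D2_def D3_def real_scaleR_def mult.commute)
    finally show "dfun (atlas M) (f \<circ> \<mu>) p v = D1 f * a1 v + D2 f * a2 v + D3 f * a3 v" .
  qed
  show ?thesis unfolding poisson_bracket_def d[OF fg(1)] d[OF fg(2)]
    by (rule bivector_expand[OF bivec a])
qed

text \<open>Both sides of the Poisson condition are expanded by \<open>bracket_heis_comp\<close>,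
  the right-hand one through the identity map of the group. The coefficients agree, so equality of
  the three pairings suffices, and the coordinate functions show that it is necessary.\<close>

lemma (in charted_bivector) poisson_map_heis_iff:
  fixes \<mu> :: "'m \<Rightarrow> heis"
  assumes \<pi>H: "bivector_field euclidean_atlas \<pi>H"
    and \<mu>: "smooth_map (atlas M) euclidean_atlas \<mu>"
    and a: "\<And>p. a1 p \<in> cotangent_space (atlas M) p" "\<And>p. a2 p \<in> cotangent_space (atlas M) p"
      "\<And>p. a3 p \<in> cotangent_space (atlas M) p"
    and eq: "\<And>p v. v \<in> tangent_space (atlas M) p \<Longrightarrow> v (\<lambda>q. h1 (\<mu> q)) = a1 p v"
      "\<And>p v. v \<in> tangent_space (atlas M) p \<Longrightarrow> v (\<lambda>q. h2 (\<mu> q)) = a2 p v"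
      "\<And>p v. v \<in> tangent_space (atlas M) p \<Longrightarrow> v (\<lambda>q. h3 (\<mu> q)) = a3 p v + h1 (\<mu> p) * a2 p v"
  shows "poisson_map M (heisenberg_group \<pi>H) \<mu> \<longleftrightarrow> (\<forall>p. \<pi> p (a1 p) (a2 p) = \<pi>H (\<mu> p) (\<theta>\<^sub>1 (\<mu> p)) (\<theta>\<^sub>2 (\<mu> p))
      \<and> \<pi> p (a1 p) (a3 p) = \<pi>H (\<mu> p) (\<theta>\<^sub>1 (\<mu> p)) (\<theta>\<^sub>3 (\<mu> p))
      \<and> \<pi> p (a2 p) (a3 p) = \<pi>H (\<mu> p) (\<theta>\<^sub>2 (\<mu> p)) (\<theta>\<^sub>3 (\<mu> p)))" (is "?L \<longleftrightarrow> ?R")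
proof -
  let ?H = "heisenberg_group \<pi>H"
  \<comment> \<open>The group with its multiplication forgotten: the locale is stated for the plain
    record \<open>poisson_space\<close>, which \<open>poisson_group\<close> extends.\<close>
  define N :: "(heis, heis) poisson_space" where "N = \<lparr>atlas = euclidean_atlas, bivector = \<pi>H\<rparr>"
  interpret N: charted_bivector N "\<lambda>x. x"
    using charted_euclidean \<pi>H by (simp add: charted_bivector_def charted_bivector_axioms_def N_def)
  have id: "smooth_map (atlas N) euclidean_atlas (\<lambda>x::heis. x)"
    by (simp add: N_def euc.smooth_map_heis_iff)
  have HN: "poisson_bracket ?H f g = poisson_bracket N f g" for f g
    by (simp add: poisson_bracket_def N_def)
  define D1 where "D1 p f = evec (\<mu> p) (1, 0, 0) f" for p f
  define D2 where "D2 p f = evec (\<mu> p) (0, 1, h1 (\<mu> p)) f" for p f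
  define D3 where "D3 p f = evec (\<mu> p) (0, 0, 1) f" for p f
  have Mb: "poisson_bracket M (f \<circ> \<mu>) (g \<circ> \<mu>) p =
      (D1 p f * D2 p g - D2 p f * D1 p g) * \<pi> p (a1 p) (a2 p) + (D1 p f * D3 p g - D3 p f * D1 p g) * \<pi> p (a1 p) (a3 p)
    + (D2 p f * D3 p g - D3 p f * D2 p g) * \<pi> p (a2 p) (a3 p)"
    if "Cinf_on UNIV f" "Cinf_on UNIV g" for f g p
    using bracket_heis_comp[OF \<mu> a eq that, of p] by (simp add: D1_def D2_def D3_def)
  have Hb: "(poisson_bracket ?H f g \<circ> \<mu>) p =
      (D1 p f * D2 p g - D2 p f * D1 p g) * \<pi>H (\<mu> p) (\<theta>\<^sub>1 (\<mu> p)) (\<theta>\<^sub>2 (\<mu> p))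
    + (D1 p f * D3 p g - D3 p f * D1 p g) * \<pi>H (\<mu> p) (\<theta>\<^sub>1 (\<mu> p)) (\<theta>\<^sub>3 (\<mu> p))
    + (D2 p f * D3 p g - D3 p f * D2 p g) * \<pi>H (\<mu> p) (\<theta>\<^sub>2 (\<mu> p)) (\<theta>\<^sub>3 (\<mu> p))"
    if "Cinf_on UNIV f" "Cinf_on UNIV g" for f g p
  proof -
    have "poisson_bracket N (f \<circ> (\<lambda>x. x)) (g \<circ> (\<lambda>x. x)) (\<mu> p) =
      (D1 p f * D2 p g - D2 p f * D1 p g) * bivector N (\<mu> p) (\<theta>\<^sub>1 (\<mu> p)) (\<theta>\<^sub>2 (\<mu> p))
    + (D1 p f * D3 p g - D3 p f * D1 p g) * bivector N (\<mu> p) (\<theta>\<^sub>1 (\<mu> p)) (\<theta>\<^sub>3 (\<mu> p))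
    + (D2 p f * D3 p g - D3 p f * D2 p g) * bivector N (\<mu> p) (\<theta>\<^sub>2 (\<mu> p)) (\<theta>\<^sub>3 (\<mu> p))"
      unfolding D1_def D2_def D3_def
      by (rule N.bracket_heis_comp[OF id _ _ _ _ _ _ that])
        (simp_all add: N_def \<theta>_eval one_form_cotangent one_form_\<theta>)
    then show ?thesis by (simp add: HN o_def N_def)
  qed
  show ?thesis
  proof
    assume L: ?L
    have b: "poisson_bracket M (f \<circ> \<mu>) (g \<circ> \<mu>) p = (poisson_bracket ?H f g \<circ> \<mu>) p"
      if "Cinf_on UNIV f" "Cinf_on UNIV g" for f g p
      using L that by (simp add: poisson_map_def smooth_functions_euclidean_iff)
    have hc: "Cinf_on UNIV h1" "Cinf_on UNIV h2" "Cinf_on UNIV h3"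
      using smooth_h by (auto simp: smooth_functions_euclidean_iff)
    show ?R
    proof
      fix p
      \<comment> \<open>The pairs (\<open>h1\<close>, \<open>h2\<close>) and (\<open>h2\<close>,
        \<open>h3\<close>) isolate one pairing each; (\<open>h1\<close>, \<open>h3\<close>) gives
        the remaining pairing plus \<open>h1\<close> times the first one, because the second frame
        vector has third component \<open>h1\<close>.\<close>
      show "\<pi> p (a1 p) (a2 p) = \<pi>H (\<mu> p) (\<theta>\<^sub>1 (\<mu> p)) (\<theta>\<^sub>2 (\<mu> p))
        \<and> \<pi> p (a1 p) (a3 p) = \<pi>H (\<mu> p) (\<theta>\<^sub>1 (\<mu> p)) (\<theta>\<^sub>3 (\<mu> p))
        \<and> \<pi> p (a2 p) (a3 p) = \<pi>H (\<mu> p) (\<theta>\<^sub>2 (\<mu> p)) (\<theta>\<^sub>3 (\<mu> p))"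
        using b[OF hc(1,2), of p] b[OF hc(1,3), of p] b[OF hc(2,3), of p]
        unfolding Mb[OF hc(1,2)] Hb[OF hc(1,2)] Mb[OF hc(1,3)] Hb[OF hc(1,3)] Mb[OF hc(2,3)] Hb[OF hc(2,3)]
        by (simp add: D1_def D2_def D3_def)
    qed
  next
    assume R: ?R
    have "poisson_bracket M (f \<circ> \<mu>) (g \<circ> \<mu>) = poisson_bracket ?H f g \<circ> \<mu>"
      if "Cinf_on UNIV f" "Cinf_on UNIV g" for f g
      by (rule ext) (simp only: Mb[OF that] Hb[OF that] R)
    then show ?L using \<mu> by (simp add: poisson_map_def smooth_functions_euclidean_iff)
  qed
qed

section \<open>Lifts of the infinitesimal momentum map\<close>

text \<open>In \<open>form_bracket_eq\<close> all exterior derivatives vanish except that of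
  \<open>a3\<close>. Contracting \<open>wedge a1 a2\<close> with the sharp of \<open>a1\<close> or
  of \<open>a2\<close> leaves the pairing of \<open>a1\<close> and \<open>a2\<close> times the same
  form, which is the correction term in the last two equations.\<close>

lemma (in charted_bivector) bracket_derivatives:
  assumes a: "one_form (atlas M) a1" "one_form (atlas M) a2" "one_form (atlas M) a3"
    and closed: "\<And>X Y m. vector_field (atlas M) X \<Longrightarrow> vector_field (atlas M) Y \<Longrightarrow> ext_deriv a1 X Y m = 0"
      "\<And>X Y m. vector_field (atlas M) X \<Longrightarrow> vector_field (atlas M) Y \<Longrightarrow> ext_deriv a2 X Y m = 0"
    and d3: "\<And>X Y m. vector_field (atlas M) X \<Longrightarrow> vector_field (atlas M) Y \<Longrightarrow>
      ext_deriv a3 X Y m = - wedge a1 a2 X Y m"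
    and fb: "\<And>X m. vector_field (atlas M) X \<Longrightarrow> form_bracket M a1 a2 X m = 0"
      "\<And>X m. vector_field (atlas M) X \<Longrightarrow> form_bracket M a1 a3 X m = b1 m (X m)"
      "\<And>X m. vector_field (atlas M) X \<Longrightarrow> form_bracket M a2 a3 X m = b2 m (X m)"
    and v: "v \<in> tangent_space (atlas M) p"
  shows "v (\<lambda>q. \<pi> q (a1 q) (a2 q)) = 0"
    and "v (\<lambda>q. \<pi> q (a1 q) (a3 q)) = b1 p v - \<pi> p (a1 p) (a2 p) * a1 p v"
    and "v (\<lambda>q. \<pi> q (a2 q) (a3 q)) = b2 p v - \<pi> p (a1 p) (a2 p) * a2 p v"
proof -
  obtain X where X: "vector_field (atlas M) X" "X p = v" using vector_field_through[OF v] by blast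
  note cot = a[THEN one_form_cotangent]
  note sh = a[THEN vector_field_sharp]
  have 1: "a1 p (sharp M a1 p) = 0" "a2 p (sharp M a1 p) = \<pi> p (a1 p) (a2 p)"
    using sharp_eval[of a1, OF cot(1)] cot bivector_self[OF bivec cot(1)] by simp_all
  have 2: "a1 p (sharp M a2 p) = - \<pi> p (a1 p) (a2 p)" "a2 p (sharp M a2 p) = 0"
    using sharp_eval[of a2, OF cot(2)] cot bivector_self[OF bivec cot(2)]
      bivector_antisym[OF bivec cot(2) cot(1), of p] by simp_all
  show "v (\<lambda>q. \<pi> q (a1 q) (a2 q)) = 0"
    using form_bracket_eq[OF a(1,2) X(1), of p] fb(1)[OF X(1)] closed sh X by simp
  show "v (\<lambda>q. \<pi> q (a1 q) (a3 q)) = b1 p v - \<pi> p (a1 p) (a2 p) * a1 p v"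
    using form_bracket_eq[OF a(1,3) X(1), of p] fb(2)[OF X(1), of p] closed(1)[OF sh(3) X(1), of p]
      d3[OF sh(1) X(1), of p] X(2) 1 by (simp add: wedge_def algebra_simps)
  show "v (\<lambda>q. \<pi> q (a2 q) (a3 q)) = b2 p v - \<pi> p (a1 p) (a2 p) * a2 p v"
    using form_bracket_eq[OF a(2,3) X(1), of p] fb(3)[OF X(1), of p] closed(2)[OF sh(3) X(1), of p]
      d3[OF sh(2) X(1), of p] X(2) 2 by (simp add: wedge_def algebra_simps)
qed

text \<open>This is joint smoothness in time and point of the central translation. A product chart
  has domain \<open>UNIV \<times> U\<close>, and its inverse is the identity paired with
  \<open>par\<close>.\<close>

lemma (in charted) smooth_translation_heis:
  fixes \<mu> :: "'m \<Rightarrow> heis"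
  assumes \<mu>: "smooth_map A euclidean_atlas \<mu>"
  shows "smooth_map (prod_atlas (euclidean_atlas :: (real, real) atlas) A) euclidean_atlas
    (\<lambda>(t, m). (h1 (\<mu> m), h2 (\<mu> m), h3 (\<mu> m) + t))"
  unfolding smooth_map_def
proof
  let ?F = "\<lambda>(t, m). (h1 (\<mu> m), h2 (\<mu> m), h3 (\<mu> m) + t)"
  have c: "continuous_on UNIV \<mu>" using \<mu> by (simp add: smooth_map_def)
  have h: "continuous_on UNIV (\<lambda>z::real \<times> 'm. L (\<mu> (snd z)))" if "bounded_linear L" for L :: "heis \<Rightarrow> real"
    by (rule continuous_on_compose2[OF linear_continuous_on[OF that, of UNIV]])
      (auto intro!: continuous_on_compose2[OF c] continuous_intros)
  show "continuous_on UNIV ?F" unfolding split_beta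
    by (intro continuous_on_Pair continuous_on_add continuous_on_fst continuous_on_id h bounded_linear_h)
  have "smooth_on (map_prod (id :: real \<Rightarrow> real) \<phi> ` (UNIV \<times> U)) (?F \<circ> inv_into (UNIV \<times> U) (map_prod (id :: real \<Rightarrow> real) \<phi>))"
    if U: "(U, \<phi>) \<in> A" for U \<phi>
  proof (rule smooth_on_if_Cinf_on[of "UNIV \<times> Om U \<phi>" "\<lambda>z. ?F (fst z, par U \<phi> (snd z))"])
    show "open (UNIV \<times> Om U \<phi>)" by (intro open_Times open_UNIV open_Om[OF U])
    have "Cinf_on (UNIV \<times> Om U \<phi>) (\<lambda>z. f (par U \<phi> (snd z)))" if "f \<in> C\<^sub>M" for f
      by (rule Cinf_on_compose[OF smooth_functionsD[OF that U]]) (auto intro: Cinf_on_intros)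
    then show "Cinf_on (UNIV \<times> Om U \<phi>) (\<lambda>z. ?F (fst z, par U \<phi> (snd z)))"
      using \<mu> unfolding smooth_map_heis_iff split_beta fst_conv snd_conv
      by (intro Cinf_on_Pair Cinf_on_add Cinf_on_fst Cinf_on_ident) auto
    show "map_prod (id :: real \<Rightarrow> real) \<phi> ` (UNIV \<times> U) \<subseteq> UNIV \<times> Om U \<phi>" using chart_in_Om[OF U] by auto
    fix y assume "y \<in> map_prod (id :: real \<Rightarrow> real) \<phi> ` (UNIV \<times> U)"
    then obtain t q where y: "y = map_prod (id :: real \<Rightarrow> real) \<phi> (t, q)" "q \<in> U" by auto
    have "inj_on (map_prod (id :: real \<Rightarrow> real) \<phi>) (UNIV \<times> U)" by (intro map_prod_inj_on inj_on_id inj_chart[OF U])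
    then have "inv_into (UNIV \<times> U) (map_prod (id :: real \<Rightarrow> real) \<phi>) y = (t, q)"
      by (rule inv_into_f_eq) (use y in auto)
    then show "(?F \<circ> inv_into (UNIV \<times> U) (map_prod (id :: real \<Rightarrow> real) \<phi>)) y = ?F (fst y, par U \<phi> (snd y))"
      using y par_chart[OF U] by simp
  qed
  then show "\<forall>(U, \<phi>)\<in>prod_atlas (euclidean_atlas :: (real, real) atlas) A. \<forall>(W, \<psi>)\<in>euclidean_atlas.
      smooth_on (\<phi> ` (U \<inter> ?F -` W)) (\<psi> \<circ> ?F \<circ> inv_into U \<phi>)"
    by (auto simp: prod_atlas_def euclidean_atlas_def)
qed

text \<open>The first two components are prescribed, so only the third is to be found. It is a
  primitive of a fixed closed form, and two primitives differ by a constant because \<open>M\<close>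
  is connected. \<open>S\<close> enters through its description only, which keeps the group
  \<open>G\<close> out of this lemma.\<close>

lemma (in charted_bivector) heis_lifts:
  fixes S :: "('m \<Rightarrow> heis) set"
  assumes sc: "simply_connected (UNIV :: 'm set)" and con: "connected (UNIV :: 'm set)"
    and f: "f1 \<in> C\<^sub>M" "f2 \<in> C\<^sub>M"
    and a: "one_form (atlas M) a1" "one_form (atlas M) a2" "one_form (atlas M) a3"
    and df: "\<And>p v. v \<in> tangent_space (atlas M) p \<Longrightarrow> v f1 = a1 p v"
      "\<And>p v. v \<in> tangent_space (atlas M) p \<Longrightarrow> v f2 = a2 p v"
    and closed: "\<And>X Y m. vector_field (atlas M) X \<Longrightarrow> vector_field (atlas M) Y \<Longrightarrow> ext_deriv a2 X Y m = 0"
    and d3: "\<And>X Y m. vector_field (atlas M) X \<Longrightarrow> vector_field (atlas M) Y \<Longrightarrow>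
      ext_deriv a3 X Y m = - wedge a1 a2 X Y m"
    and S: "\<And>\<mu>. \<mu> \<in> S \<longleftrightarrow> smooth_map (atlas M) euclidean_atlas \<mu> \<and>
      (\<forall>p. h1 (\<mu> p) = f1 p \<and> h2 (\<mu> p) = f2 p) \<and>
      (\<forall>p. \<forall>v\<in>tangent_space (atlas M) p. v (\<lambda>q. h3 (\<mu> q)) = a3 p v + f1 p * a2 p v)"
  shows "S \<noteq> {}" and "\<exists>\<sigma>. simply_transitive_real_action M (heisenberg_group \<pi>H) S \<sigma>"
proof -
  define \<beta> where "\<beta> = (\<lambda>p v. a3 p v + f1 p * a2 p v)"
  have \<beta>: "one_form (atlas M) \<beta>" unfolding \<beta>_def by (rule one_form_combination[OF a(3,2) f(1)])
  have "ext_deriv \<beta> X Y q = 0" if X: "vector_field (atlas M) X" and Y: "vector_field (atlas M) Y" for X Y q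
  proof -
    have exp: "X q (\<lambda>q. \<beta> q (Y q)) = X q (\<lambda>q. a3 q (Y q)) + (f1 q * X q (\<lambda>q. a2 q (Y q)) + X q f1 * a2 q (Y q))"
      if X: "vector_field (atlas M) X" and Y: "vector_field (atlas M) Y" for X Y
    proof -
      note Xq = vector_field_tangent[OF X, of q]
      note sm = one_form_smooth[OF a(3) Y] one_form_smooth[OF a(2) Y]
      have "X q (\<lambda>q. \<beta> q (Y q)) = X q (\<lambda>q. a3 q (Y q)) + X q (\<lambda>q. f1 q * a2 q (Y q))" unfolding \<beta>_def
        by (rule tangent_space_add_fun[OF Xq sm(1) smooth_mult[OF f(1) sm(2)]])
      also have "X q (\<lambda>q. f1 q * a2 q (Y q)) = f1 q * X q (\<lambda>q. a2 q (Y q)) + X q f1 * a2 q (Y q)"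
        by (rule tangent_space_mult_fun[OF Xq f(1) sm(2)])
      finally show ?thesis .
    qed
    \<comment> \<open>The wedge term is the one produced by differentiating the factor
      \<open>f1\<close>, whose differential is \<open>a1\<close>; it cancels the exterior derivative
      of \<open>a3\<close>.\<close>
    have "ext_deriv \<beta> X Y q = ext_deriv a3 X Y q + f1 q * ext_deriv a2 X Y q + wedge a1 a2 X Y q"
      unfolding ext_deriv_def exp[OF X Y] exp[OF Y X] wedge_def
      by (simp add: \<beta>_def df[OF vector_field_tangent[OF X]] df[OF vector_field_tangent[OF Y]] algebra_simps)
    then show ?thesis using d3[OF X Y] closed[OF X Y] by simp
  qed
  then obtain k where k: "k \<in> C\<^sub>M" "\<And>q v. v \<in> tangent_space (atlas M) q \<Longrightarrow> v k = \<beta> q v"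
    using closed_form_primitive[OF sc \<beta>] by metis
  have shift: "(\<lambda>q. k q + t) \<in> C\<^sub>M" for t by (intro smooth_add smooth_const k(1))
  have shift': "v (\<lambda>q. k q + t) = \<beta> q v" if v: "v \<in> tangent_space (atlas M) q" for t q v
    using tangent_space_add_fun[OF v k(1) smooth_const, of t] tangent_const[OF v, of t] k(2)[OF v] by simp
  have mem: "(\<lambda>m. (f1 m, f2 m, k m + t)) \<in> S" for t
    unfolding S smooth_map_heis_iff using f shift shift' by (simp add: \<beta>_def)
  then show "S \<noteq> {}" by blast
  have rep: "\<exists>t. \<mu> = (\<lambda>m. (f1 m, f2 m, k m + t))" if \<mu>: "\<mu> \<in> S" for \<mu>
  proof -
    have c3: "(\<lambda>q. h3 (\<mu> q)) \<in> C\<^sub>M" using \<mu> by (simp add: S smooth_map_heis_iff)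
    have "v (\<lambda>q. h3 (\<mu> q) - k q) = 0" if v: "v \<in> tangent_space (atlas M) p" for v p
    proof -
      have "v (\<lambda>q. h3 (\<mu> q) + (-1) * k q) = v (\<lambda>q. h3 (\<mu> q)) + v (\<lambda>q. (-1) * k q)"
        by (rule tangent_space_add_fun[OF v c3 smooth_scale[OF k(1)]])
      also have "v (\<lambda>q. (-1) * k q) = (-1) * v k" by (rule tangent_space_scale_fun[OF v k(1)])
      also have "v (\<lambda>q. h3 (\<mu> q)) = v k" using \<mu> v k(2)[OF v] unfolding S by (auto simp: \<beta>_def)
      finally show ?thesis by simp
    qed
    then have "h3 (\<mu> p) - k p = h3 (\<mu> q) - k q" for p q
      by (rule constant_if_dfun_zero[OF smooth_diff[OF c3 k(1)] con])
    then obtain t where "\<And>p. h3 (\<mu> p) = k p + t" by (metis add_diff_cancel_left' diff_add_cancel diff_diff_eq2 add.commute)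
    then have "\<mu> m = (f1 m, f2 m, k m + t)" for m using \<mu> h_expand[of "\<mu> m"] by (simp add: S)
    then show ?thesis by blast
  qed
  define \<sigma> :: "real \<Rightarrow> ('m \<Rightarrow> heis) \<Rightarrow> 'm \<Rightarrow> heis"
    where "\<sigma> t \<mu> = (\<lambda>m. (h1 (\<mu> m), h2 (\<mu> m), h3 (\<mu> m) + t))" for t \<mu>
  have \<sigma>: "\<sigma> t (\<lambda>m. (f1 m, f2 m, k m + s)) = (\<lambda>m. (f1 m, f2 m, k m + (s + t)))" for s t
    by (simp add: \<sigma>_def add.assoc)
  have "simply_transitive_real_action M (heisenberg_group \<pi>H) S \<sigma>"
    unfolding simply_transitive_real_action_def heis_simps(1)
  proof (intro conjI ballI allI impI)
    fix \<mu> assume \<mu>: "\<mu> \<in> S"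
    then obtain s where s: "\<mu> = (\<lambda>m. (f1 m, f2 m, k m + s))" using rep by blast
    show "\<sigma> t \<mu> \<in> S" for t unfolding s \<sigma> by (rule mem)
    show "\<sigma> 0 \<mu> = \<mu>" unfolding s \<sigma> by simp
    show "\<sigma> (s' + t) \<mu> = \<sigma> s' (\<sigma> t \<mu>)" for s' t unfolding s \<sigma> by (simp add: ac_simps)
    show "t = 0" if "\<sigma> t \<mu> = \<mu>" for t using that unfolding s \<sigma> by (simp add: fun_eq_iff)
    show "\<exists>t. \<sigma> t \<mu> = \<nu>" if \<nu>: "\<nu> \<in> S" for \<nu>
    proof -
      obtain s' where s': "\<nu> = (\<lambda>m. (f1 m, f2 m, k m + s'))" using rep[OF \<nu>] by blast
      show ?thesis unfolding s s' \<sigma> by (intro exI[of _ "s' - s"]) simp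
    qed
    show "smooth_map (prod_atlas euclidean_atlas (atlas M)) euclidean_atlas (\<lambda>(t, m). \<sigma> t \<mu> m)"
      unfolding \<sigma>_def by (rule smooth_translation_heis) (use \<mu> S in blast)
    fix m0 :: 'm
    \<comment> \<open>The shift between two lifts can be read off at any single point, here
      \<open>undefined\<close>; evaluation at a point is continuous for pointwise
      convergence.\<close>
    let ?\<rho> = "\<lambda>\<nu>. h3 (\<nu> undefined) - h3 (\<mu> undefined)"
    have "homeomorphism UNIV S (\<lambda>t. \<sigma> t \<mu>) ?\<rho>"
    proof (rule homeomorphismI)
      show "continuous_on UNIV (\<lambda>t. \<sigma> t \<mu>)" unfolding \<sigma>_def
        by (intro continuous_on_coordinatewise_then_product continuous_intros)
      have "continuous_on S (\<lambda>\<nu>. \<nu> undefined)"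
        by (rule continuous_on_subset[OF continuous_on_product_coordinates]) simp
      then have "continuous_on S (\<lambda>\<nu>. h3 (\<nu> undefined))"
        by (rule continuous_on_compose2[OF linear_continuous_on[OF bounded_linear_h(3), of UNIV]]) simp
      then show "continuous_on S ?\<rho>" by (intro continuous_intros)
      show "(\<lambda>t. \<sigma> t \<mu>) ` UNIV \<subseteq> S" unfolding s \<sigma> using mem by blast
      show "?\<rho> (\<sigma> t \<mu>) = t" for t by (simp add: \<sigma>_def)
      show "\<sigma> (?\<rho> \<nu>) \<mu> = \<nu>" if \<nu>: "\<nu> \<in> S" for \<nu>
      proof -
        obtain s' where s': "\<nu> = (\<lambda>m. (f1 m, f2 m, k m + s'))" using rep[OF \<nu>] by blast
        show ?thesis unfolding s s' by (simp add: \<sigma>)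
      qed
    qed auto
    then show "\<exists>\<rho>. homeomorphism UNIV S (\<lambda>t. \<sigma> t \<mu>) \<rho>" by blast
  qed
  then show "\<exists>\<sigma>. simply_transitive_real_action M (heisenberg_group \<pi>H) S \<sigma>" by blast
qed

section \<open>Duality with the Heisenberg Lie algebra\<close>

lemma linear_fun_on_tangent_combination:
  assumes F: "linear_fun_on (tangent_space A p) F"
    and "u \<in> tangent_space A p" "v \<in> tangent_space A p" "w \<in> tangent_space A p"
  shows "F (\<lambda>f. a * u f + b * v f + c * w f) = (\<lambda>x. a * F u x + b * F v x + c * F w x)"
proof -
  have s: "(\<lambda>f. r * u f) \<in> tangent_space A p" if "u \<in> tangent_space A p" for r u
    using tangent_space_combination[OF that that, of r 0] by simp
  have F': "F (\<lambda>f. r * u f) = (\<lambda>x. r * F u x)" if "u \<in> tangent_space A p" for r u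
    using F that by (simp add: linear_fun_on_def)
  have "F (\<lambda>f. (a * u f + b * v f) + c * w f) = (\<lambda>x. F (\<lambda>f. a * u f + b * v f) x + F (\<lambda>f. c * w f) x)"
    using F tangent_space_combination[OF assms(2,3), of a b] s[OF assms(4), of c]
    by (simp add: linear_fun_on_def)
  also have "F (\<lambda>f. a * u f + b * v f) = (\<lambda>x. F (\<lambda>f. a * u f) x + F (\<lambda>f. b * v f) x)"
    using F s[OF assms(2), of a] s[OF assms(3), of b] by (simp add: linear_fun_on_def)
  finally show ?thesis using F' assms by simp
qed

lemma left_field_heis:
  "left_field (heisenberg_group \<pi>) (heis_tangent w) g = evec g (h1 w, h2 w, h3 w + h1 g * h2 w)"
  unfolding left_field_def heis_simps(1) heis_tangent_eq push_left_heis[OF evec_in_tangent_space]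
  using h_expand[of g] by simp

lemma vector_field_left_field_heis:
  "vector_field euclidean_atlas (left_field (heisenberg_group \<pi>) (heis_tangent w))"
  unfolding vector_field_def left_field_heis
proof (intro conjI allI ballI evec_in_tangent_space)
  fix f :: "heis \<Rightarrow> real" assume f: "f \<in> smooth_functions euclidean_atlas"
  then have cf: "Cinf_on UNIV f" by (simp add: smooth_functions_euclidean_iff)
  have "evec g (h1 w, h2 w, h3 w + h1 g * h2 w) f =
      frechet_derivative f (at g) w + (h2 w * h1 g) * frechet_derivative f (at g) (0, 0, 1)" for g
  proof -
    interpret linear "frechet_derivative f (at g)"
      using Cinf_on_has_derivative[OF cf] has_derivative_linear by blast
    have "(h1 w, h2 w, h3 w + h1 g * h2 w) = w + (h2 w * h1 g) *\<^sub>R (0, 0, 1)"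
      by (simp add: h1_def h2_def h3_def prod_eq_iff)
    then show ?thesis using cf by (simp only: evec_def if_True add scale real_scaleR_def)
  qed
  moreover have "Cinf_on UNIV (\<lambda>g. frechet_derivative f (at g) w + (h2 w * h1 g) * frechet_derivative f (at g) (0, 0, 1))"
    by (intro Cinf_on_intros Cinf_on_derivative[OF open_UNIV cf] Cinf_on_bounded_linear bounded_linear_h)
  ultimately show "(\<lambda>g. evec g (h1 w, h2 w, h3 w + h1 g * h2 w) f) \<in> smooth_functions euclidean_atlas"
    by (simp add: smooth_functions_euclidean_iff)
qed

text \<open>A tangent vector is determined by its values on the three coordinates. A left invariant
  field has constant first and second components and a third one affine in \<open>h1\<close>, so the
  bracket retains only its third component.\<close>

lemma lie_bracket_heis:
  "lie_bracket (heisenberg_group \<pi>) (heis_tangent w) (heis_tangent w') =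
    heis_tangent (0, 0, h1 w * h2 w' - h1 w' * h2 w)"
proof -
  let ?b = "lie_bracket (heisenberg_group \<pi>) (heis_tangent w) (heis_tangent w')"
  have "?b \<in> tangent_space euclidean_atlas (0, 0, 0)"
    unfolding lie_bracket_def heis_simps(3)
    by (intro euc.vf_bracket_in_tangent_space vector_field_left_field_heis)
  then have "?b = evec (0, 0, 0) (?b h1, ?b h2, ?b h3)" by (rule tangent_heis)
  moreover have "?b h1 = 0" "?b h2 = 0"
    by (simp_all add: lie_bracket_def vf_bracket_def left_field_heis euc.tangent_const[OF evec_in_tangent_space])
  moreover have "?b h3 = h1 w * h2 w' - h1 w' * h2 w"
    using tangent_heis_affine[OF evec_in_tangent_space, of "(0, 0, 0)" w "h3 w'" "h2 w'" 0 0]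
      tangent_heis_affine[OF evec_in_tangent_space, of "(0, 0, 0)" w' "h3 w" "h2 w" 0 0]
    by (simp add: lie_bracket_def vf_bracket_def left_field_heis mult.commute h_expand)
  ultimately show ?thesis by (simp add: heis_tangent_eq)
qed

lemma cotangent_combination_vec3:
  assumes \<beta>: "\<beta> \<in> cotangent_space A p"
    and uvw: "u \<in> tangent_space A p" "v \<in> tangent_space A p" "w \<in> tangent_space A p"
  shows "\<beta> (\<lambda>f. a * u f + b * v f + c * w f) = a * \<beta> u + b * \<beta> v + c * \<beta> w"
proof -
  define y where "y f = a * u f + b * v f" for f
  have y: "y \<in> tangent_space A p" unfolding y_def[abs_def] by (rule tangent_space_combination[OF uvw(1,2)])
  have "\<beta> y = a * \<beta> u + b * \<beta> v" unfolding y_def[abs_def] by (rule cotangent_combination_vec[OF \<beta> uvw(1,2)])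
  then show ?thesis using cotangent_combination_vec[OF \<beta> y uvw(3), of 1 c] by (simp add: y_def)
qed

text \<open>Both sides have the same image under \<open>D\<close>, as one sees on
  \<open>heis_x\<close>, \<open>heis_y\<close>, \<open>heis_z\<close>, and \<open>D\<close> is
  injective.\<close>

lemma dual_heis_decomposition:
  assumes dual: "dual_poisson_lie_group G (heisenberg_group \<pi>H) D"
    and mem: "\<xi> \<in> lie_algebra G" "\<eta> \<in> lie_algebra G" "\<zeta> \<in> lie_algebra G"
    and D: "D \<xi> heis_x = 1" "D \<xi> heis_y = 0" "D \<xi> heis_z = 0"
      "D \<eta> heis_x = 0" "D \<eta> heis_y = 1" "D \<eta> heis_z = 0"
      "D \<zeta> heis_x = 0" "D \<zeta> heis_y = 0" "D \<zeta> heis_z = 1"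
    and \<kappa>: "\<kappa> \<in> lie_algebra G"
  shows "\<kappa> = (\<lambda>f. D \<kappa> heis_x * \<xi> f + D \<kappa> heis_y * \<eta> f + D \<kappa> heis_z * \<zeta> f)" (is "_ = ?\<kappa>")
proof -
  have bij: "bij_betw D (lie_algebra G) (cotangent_space euclidean_atlas (0, 0, 0))"
    and lin: "linear_fun_on (lie_algebra G) D"
    using dual by (simp_all add: dual_poisson_lie_group_def lie_coalgebra_def)
  have cot: "D \<kappa> \<in> cotangent_space euclidean_atlas (0, 0, 0)" if "\<kappa> \<in> lie_algebra G" for \<kappa>
    using bij that by (auto simp: bij_betw_def)
  have m: "?\<kappa> \<in> lie_algebra G"
    using tangent_space_combination[OF tangent_space_combination[OF mem(1,2)[unfolded lie_algebra_def],
        of "D \<kappa> heis_x" "D \<kappa> heis_y"] mem(3)[unfolded lie_algebra_def], of 1 "D \<kappa> heis_z"]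
    by (simp add: lie_algebra_def)
  have "D ?\<kappa> = (\<lambda>v. D \<kappa> heis_x * D \<xi> v + D \<kappa> heis_y * D \<eta> v + D \<kappa> heis_z * D \<zeta> v)"
    using linear_fun_on_tangent_combination lin mem unfolding lie_algebra_def by blast
  also have "\<dots> = D \<kappa>"
  proof (rule cotangent_ext[OF _ cot[OF \<kappa>]])
    show "(\<lambda>v. D \<kappa> heis_x * D \<xi> v + D \<kappa> heis_y * D \<eta> v + D \<kappa> heis_z * D \<zeta> v)
        \<in> cotangent_space euclidean_atlas (0, 0, 0)"
      using cotangent_space_combination[OF cotangent_space_combination[OF cot[OF mem(1)] cot[OF mem(2)],
          of "D \<kappa> heis_x" "D \<kappa> heis_y"] cot[OF mem(3)], of 1 "D \<kappa> heis_z"] by simp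
    fix v :: "heis tvec" assume "v \<in> tangent_space euclidean_atlas (0, 0, 0)"
    then obtain w where w: "v = heis_tangent w" using tangent_is_evec heis_tangent_eq by metis
    show "D \<kappa> heis_x * D \<xi> v + D \<kappa> heis_y * D \<eta> v + D \<kappa> heis_z * D \<zeta> v = D \<kappa> v"
      unfolding w cotangent_heis[OF cot[OF \<kappa>]] cotangent_heis[OF cot[OF mem(1)]]
        cotangent_heis[OF cot[OF mem(2)]] cotangent_heis[OF cot[OF mem(3)]] by (simp add: D)
  qed
  finally show ?thesis using bij \<kappa> m unfolding bij_betw_def inj_on_def by metis
qed

text \<open>A covector on the Lie algebra of \<open>G\<close> is an element of the Heisenberg
  algebra with coordinates its values at \<open>\<xi>\<close>, \<open>\<eta>\<close>,
  \<open>\<zeta>\<close>. The bracket of two such elements is the determinant of their first two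
  coordinates times the central element, which \<open>D \<kappa>\<close> then evaluates.\<close>

lemma dual_heis_cobracket:
  assumes dual: "dual_poisson_lie_group G (heisenberg_group \<pi>H) D"
    and mem: "\<xi> \<in> lie_algebra G" "\<eta> \<in> lie_algebra G" "\<zeta> \<in> lie_algebra G"
    and D: "D \<xi> heis_x = 1" "D \<xi> heis_y = 0" "D \<xi> heis_z = 0"
      "D \<eta> heis_x = 0" "D \<eta> heis_y = 1" "D \<eta> heis_z = 0"
      "D \<zeta> heis_x = 0" "D \<zeta> heis_y = 0" "D \<zeta> heis_z = 1"
    and \<kappa>: "\<kappa> \<in> lie_algebra G" and a: "a \<in> lie_coalgebra G" and b: "b \<in> lie_coalgebra G"
  shows "cobracket G \<kappa> a b = (a \<xi> * b \<eta> - b \<xi> * a \<eta>) * D \<kappa> heis_z"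
proof -
  have cot: "D \<kappa> \<in> cotangent_space euclidean_atlas (0, 0, 0)" if "\<kappa> \<in> lie_algebra G" for \<kappa>
    using dual that by (auto simp: dual_poisson_lie_group_def lie_coalgebra_def bij_betw_def)
  \<comment> \<open>\<open>dual_covec\<close> is inverted explicitly, so that duality, stated for
    elements of the Heisenberg algebra, applies to arbitrary covectors.\<close>
  have cov: "dual_covec G D (heis_tangent (a \<xi>, a \<eta>, a \<zeta>)) = a" if a: "a \<in> lie_coalgebra G" for a
  proof
    fix \<kappa>
    show "dual_covec G D (heis_tangent (a \<xi>, a \<eta>, a \<zeta>)) \<kappa> = a \<kappa>"
    proof (cases "\<kappa> \<in> lie_algebra G")
      case True
      note m = mem[unfolded lie_algebra_def]
      have "a (\<lambda>f. D \<kappa> heis_x * \<xi> f + D \<kappa> heis_y * \<eta> f + D \<kappa> heis_z * \<zeta> f)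
          = D \<kappa> heis_x * a \<xi> + D \<kappa> heis_y * a \<eta> + D \<kappa> heis_z * a \<zeta>"
        by (rule cotangent_combination_vec3[OF a[unfolded lie_coalgebra_def] m])
      then show ?thesis
        using dual_heis_decomposition[OF dual, OF mem, OF D, OF True] True
        by (simp add: dual_covec_def cotangent_heis[OF cot[OF True]] mult.commute)
    qed (use a in \<open>simp add: dual_covec_def lie_coalgebra_def lie_algebra_def cotangent_space_def\<close>)
  qed
  have l: "heis_tangent w \<in> lie_algebra (heisenberg_group \<pi>H)" for w
    by (simp add: lie_algebra_def heis_tangent_eq evec_in_tangent_space)
  have "cobracket G \<kappa> a b = D \<kappa> (lie_bracket (heisenberg_group \<pi>H)
      (heis_tangent (a \<xi>, a \<eta>, a \<zeta>)) (heis_tangent (b \<xi>, b \<eta>, b \<zeta>)))"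
    using dual l \<kappa> cov[OF a] cov[OF b] unfolding dual_poisson_lie_group_def by metis
  then show ?thesis unfolding lie_bracket_heis cotangent_heis[OF cot[OF \<kappa>]] by simp
qed

theorem theorem2p4p18:
  fixes G :: "('g::{t2_space,second_countable_topology}, 'e::euclidean_space) poisson_group"
    and M :: "('m::{t2_space,second_countable_topology}, 'f::euclidean_space) poisson_space"
    and \<Phi> :: "'g \<Rightarrow> 'm \<Rightarrow> 'm"
    and \<alpha> :: "'g tvec \<Rightarrow> 'm form1"
    and H :: "(heis, heis) poisson_group"
    and \<pi>H :: "heis bivec"
    and D :: "'g tvec \<Rightarrow> heis covec"
    and \<xi> \<eta> \<zeta> :: "'g tvec"
  assumes "poisson_lie_group G"
    and "connected (UNIV :: 'g set)" and "simply_connected (UNIV :: 'g set)"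
    and "poisson_manifold M"
    and "connected (UNIV :: 'm set)" and "simply_connected (UNIV :: 'm set)"
    and "lie_group_action G M \<Phi>"
    and "infinitesimal_momentum_map G M \<Phi> \<alpha>"
    and "H = heisenberg_group \<pi>H" and "dual_poisson_lie_group G H D"
    and "\<xi> \<in> lie_algebra G" and "\<eta> \<in> lie_algebra G" and "\<zeta> \<in> lie_algebra G"
    and "D \<xi> heis_x = 1" and "D \<xi> heis_y = 0" and "D \<xi> heis_z = 0"
    and "D \<eta> heis_x = 0" and "D \<eta> heis_y = 1" and "D \<eta> heis_z = 0"
    and "D \<zeta> heis_x = 0" and "D \<zeta> heis_y = 0" and "D \<zeta> heis_z = 1"
    and "(lie_bracket G \<xi> \<eta> = (\<lambda>f. 0) \<and> lie_bracket G \<xi> \<zeta> = \<xi> \<and> lie_bracket G \<eta> \<zeta> = \<eta>) \<or>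
         (lie_bracket G \<xi> \<eta> = (\<lambda>f. 0) \<and> lie_bracket G \<xi> \<zeta> = \<eta> \<and> lie_bracket G \<eta> \<zeta> = (\<lambda>f. - \<xi> f))"
  shows "\<exists>c. (\<forall>m. bivector M m (\<alpha> \<xi> m) (\<alpha> \<eta> m) = c) \<and>
           (momentum_maps G H D M \<alpha> \<noteq> {} \<longleftrightarrow> c = 0) \<and>
           (c = 0 \<longrightarrow> (\<exists>\<sigma>. simply_transitive_real_action M H (momentum_maps G H D M \<alpha>) \<sigma>))"
proof -
  note mem = assms(11-13)
  note D = assms(14-22)
  note dual = assms(10)[unfolded assms(9)]
  note sc = assms(6) and con = assms(5)
  let ?H = "heisenberg_group \<pi>H"

  obtain P where "charted (atlas M) P"
    using smooth_manifold_charted[of "atlas M"] assms(4) unfolding poisson_manifold_def by blast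
  then interpret charted_bivector M P
    using assms(4) by (simp add: charted_bivector_def charted_bivector_axioms_def poisson_manifold_def)
  have bvH: "bivector_field euclidean_atlas \<pi>H" and mult: "multiplicative ?H"
    using dual by (simp_all add: dual_poisson_lie_group_def poisson_lie_group_def poisson_manifold_def)
  have cot: "D \<kappa> \<in> cotangent_space euclidean_atlas (0, 0, 0)" if "\<kappa> \<in> lie_algebra G" for \<kappa>
    using dual that by (auto simp: dual_poisson_lie_group_def lie_coalgebra_def bij_betw_def)
  have linD: "linear_fun_on (lie_algebra G) D" using dual by (simp add: dual_poisson_lie_group_def)

  have IM: "\<And>\<kappa>. \<kappa> \<in> lie_algebra G \<Longrightarrow> one_form (atlas M) (\<alpha> \<kappa>)"
    "\<And>m. linear_fun_on (lie_algebra G) (\<lambda>\<kappa>. \<alpha> \<kappa> m)"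
    "\<And>\<kappa>1 \<kappa>2 X m. \<kappa>1 \<in> lie_algebra G \<Longrightarrow> \<kappa>2 \<in> lie_algebra G \<Longrightarrow> vector_field (atlas M) X \<Longrightarrow>
      form_bracket M (\<alpha> \<kappa>1) (\<alpha> \<kappa>2) X m = \<alpha> (lie_bracket G \<kappa>1 \<kappa>2) m (X m)"
    "\<And>\<kappa> ps X Y m. \<kappa> \<in> lie_algebra G \<Longrightarrow> represents_cobracket G \<kappa> ps \<Longrightarrow> vector_field (atlas M) X \<Longrightarrow>
      vector_field (atlas M) Y \<Longrightarrow>
      ext_deriv (\<alpha> \<kappa>) X Y m + 1/2 * (\<Sum>(\<kappa>1, \<kappa>2)\<leftarrow>ps. wedge (\<alpha> \<kappa>1) (\<alpha> \<kappa>2) X Y m) = 0"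
    using assms(8) by (auto simp: infinitesimal_momentum_map_def)
  define a1 where "a1 = \<alpha> \<xi>"
  define a2 where "a2 = \<alpha> \<eta>"
  define a3 where "a3 = \<alpha> \<zeta>"
  have a: "one_form (atlas M) a1" "one_form (atlas M) a2" "one_form (atlas M) a3"
    using IM(1) mem by (simp_all add: a1_def a2_def a3_def)
  note acot = a[THEN one_form_cotangent]

  have neg: "(\<lambda>f. - \<xi> f) \<in> lie_algebra G"
    using tangent_space_combination[OF mem(1,1)[unfolded lie_algebra_def], of "-1" 0]
    by (simp add: lie_algebra_def)
  have scale: "F (\<lambda>f. c * \<xi> f) = (\<lambda>x. c * F \<xi> x)" if "linear_fun_on (lie_algebra G) F" for c F
    using that mem(1) by (simp add: linear_fun_on_def)
  have \<alpha>_neg: "\<alpha> (\<lambda>f. - \<xi> f) m = (\<lambda>v. - a1 m v)" for m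
    using scale[OF IM(2), of "-1" m] by (simp add: a1_def)
  have \<alpha>_zero: "\<alpha> (\<lambda>f. 0) m = (\<lambda>v. 0)" for m
    using scale[OF IM(2), of 0 m] by simp
  have D_neg: "D (\<lambda>f. - \<xi> f) = (\<lambda>v. - D \<xi> v)" using scale[OF linD, of "-1"] by simp
  have D_zero: "D (\<lambda>f. 0) = (\<lambda>v. 0)" using scale[OF linD, of 0] by simp

  note cob = dual_heis_cobracket[OF dual, OF mem, OF D]
  have closed: "ext_deriv a1 X Y m = 0" "ext_deriv a2 X Y m = 0"
    if "vector_field (atlas M) X" "vector_field (atlas M) Y" for X Y m
  proof -
    \<comment> \<open>The cobrackets of \<open>\<xi>\<close> and \<open>\<eta>\<close> vanish, so
      the empty list represents them and the Maurer-Cartan equation reduces to closedness.\<close>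
    have "represents_cobracket G \<xi> []" "represents_cobracket G \<eta> []"
      unfolding represents_cobracket_def using cob mem D by simp_all
    then show "ext_deriv a1 X Y m = 0" "ext_deriv a2 X Y m = 0"
      using IM(4)[OF mem(1) _ that, of "[]" m] IM(4)[OF mem(2) _ that, of "[]" m]
      by (simp_all add: a1_def a2_def)
  qed
  have d3: "ext_deriv a3 X Y m = - wedge a1 a2 X Y m"
    if "vector_field (atlas M) X" "vector_field (atlas M) Y" for X Y m
  proof -
    have nb: "b (\<lambda>f. - \<xi> f) = - b \<xi>" if "b \<in> lie_coalgebra G" for b
      using cotangent_combination_vec[OF that[unfolded lie_coalgebra_def] mem(1,1)[unfolded lie_algebra_def], of "-1" 0]
      by simp
    \<comment> \<open>The wedge is written as two tensors; the minus sign sits in a factor because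
      the list carries no coefficients. The two entries contribute the same wedge of forms, which
      absorbs the factor 1/2.\<close>
    have "represents_cobracket G \<zeta> [(\<xi>, \<eta>), (\<eta>, \<lambda>f. - \<xi> f)]"
      unfolding represents_cobracket_def
    proof (intro conjI ballI)
      fix a b assume "a \<in> lie_coalgebra G" and b: "b \<in> lie_coalgebra G"
      with cob[OF mem(3)] nb[OF b] D show "cobracket G \<zeta> a b
          = (\<Sum>(\<kappa>1, \<kappa>2)\<leftarrow>[(\<xi>, \<eta>), (\<eta>, \<lambda>f. - \<xi> f)]. a \<kappa>1 * b \<kappa>2)"
        by simp
    qed (use mem neg in simp)
    from IM(4)[OF mem(3) this that, of m] show ?thesis
      by (simp add: wedge_def \<alpha>_neg field_simps flip: a1_def a2_def a3_def)
  qed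

  define c where "c m = \<pi> m (a1 m) (a2 m)" for m
  define p13 where "p13 m = \<pi> m (a1 m) (a3 m)" for m
  define p23 where "p23 m = \<pi> m (a2 m) (a3 m)" for m
  have p_smooth: "c \<in> C\<^sub>M" "p13 \<in> C\<^sub>M" "p23 \<in> C\<^sub>M"
    unfolding c_def p13_def p23_def by (intro bivector_smooth[OF bivec] a)+
  have fb12: "form_bracket M a1 a2 X m = 0" if "vector_field (atlas M) X" for X m
    using IM(3)[OF mem(1,2) that, of m] assms(23) \<alpha>_zero by (auto simp: a1_def a2_def)
  have fb13: "form_bracket M a1 a3 X m = \<alpha> (lie_bracket G \<xi> \<zeta>) m (X m)"
    and fb23: "form_bracket M a2 a3 X m = \<alpha> (lie_bracket G \<eta> \<zeta>) m (X m)"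
    if "vector_field (atlas M) X" for X m
    using IM(3)[OF mem(1,3) that] IM(3)[OF mem(2,3) that] by (simp_all add: a1_def a2_def a3_def)
  have br: "v c = 0" "v p13 = \<alpha> (lie_bracket G \<xi> \<zeta>) p v - c p * a1 p v"
    "v p23 = \<alpha> (lie_bracket G \<eta> \<zeta>) p v - c p * a2 p v" if v: "v \<in> tangent_space (atlas M) p" for p v
    unfolding c_def[abs_def] p13_def[abs_def] p23_def[abs_def]
    by (rule bracket_derivatives[OF a closed d3 fb12 fb13 fb23 v]; assumption)+
  have cc: "c m = c m'" for m m'
    by (rule constant_if_dfun_zero[OF p_smooth(1) con]) (rule br(1))

  have lf: "left_form ?H (D \<xi>) g = \<theta>\<^sub>1 g" "left_form ?H (D \<eta>) g = \<theta>\<^sub>2 g" "left_form ?H (D \<zeta>) g = \<theta>\<^sub>3 g" for g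
    by (simp_all add: left_form_heis cot mem D)
  have hx: "heis_x \<in> lie_algebra ?H" "heis_y \<in> lie_algebra ?H" "heis_z \<in> lie_algebra ?H"
    by (simp_all add: lie_algebra_def heis_x_def heis_y_def heis_z_def heis_tangent_eq evec_in_tangent_space)
  \<comment> \<open>The transpose of the bracket of \<open>G\<close> is the derivative of
    \<open>\<pi>H\<close> at the unit, so the coefficients of the linear functions in
    \<open>heis_bivector\<close> can be read off from the two given brackets.\<close>
  have DH: "l (\<lambda>g. \<pi>H g (left_form ?H (D \<kappa>1) g) (left_form ?H (D \<kappa>2) g)) = D (lie_bracket G \<kappa>1 \<kappa>2) l"
    if "l \<in> lie_algebra ?H" "\<kappa>1 \<in> lie_algebra G" "\<kappa>2 \<in> lie_algebra G" for l \<kappa>1 \<kappa>2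
    using dual that by (simp add: dual_poisson_lie_group_def cobracket_def)
  note D12 = DH[OF hx(1) mem(1,2), unfolded lf] DH[OF hx(2) mem(1,2), unfolded lf] DH[OF hx(3) mem(1,2), unfolded lf]
  note D13 = DH[OF hx(1) mem(1,3), unfolded lf] DH[OF hx(2) mem(1,3), unfolded lf] DH[OF hx(3) mem(1,3), unfolded lf]
  note D23 = DH[OF hx(1) mem(2,3), unfolded lf] DH[OF hx(2) mem(2,3), unfolded lf] DH[OF hx(3) mem(2,3), unfolded lf]
  have "lie_bracket G \<xi> \<eta> = (\<lambda>f. 0)" using assms(23) by blast
  then have z12: "heis_x (\<lambda>g. \<pi>H g (\<theta>\<^sub>1 g) (\<theta>\<^sub>2 g)) = 0" "heis_y (\<lambda>g. \<pi>H g (\<theta>\<^sub>1 g) (\<theta>\<^sub>2 g)) = 0"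
    "heis_z (\<lambda>g. \<pi>H g (\<theta>\<^sub>1 g) (\<theta>\<^sub>2 g)) = 0"
    using D12 D_zero by simp_all
  note PH = heis_bivector[OF mult bvH z12, unfolded D13 D23]

  \<comment> \<open>\<open>f1\<close> and \<open>f2\<close> are the only candidates for the first
    two components of a momentum map: the conditions on the pairings with the third form are solved
    for \<open>h1 g\<close> and \<open>h2 g\<close>. The two brackets are distinguished only here;
    what follows uses these three properties.\<close>
  obtain f1 f2 where f: "f1 \<in> C\<^sub>M" "f2 \<in> C\<^sub>M"
    and df: "\<And>p v. c p = 0 \<Longrightarrow> v \<in> tangent_space (atlas M) p \<Longrightarrow> v f1 = a1 p v \<and> v f2 = a2 p v"
    and match: "\<And>m g. p13 m = \<pi>H g (\<theta>\<^sub>1 g) (\<theta>\<^sub>3 g) \<and> p23 m = \<pi>H g (\<theta>\<^sub>2 g) (\<theta>\<^sub>3 g) \<longleftrightarrow> h1 g = f1 m \<and> h2 g = f2 m"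
    using assms(23)
  proof
    assume L: "lie_bracket G \<xi> \<eta> = (\<lambda>f. 0) \<and> lie_bracket G \<xi> \<zeta> = \<xi> \<and> lie_bracket G \<eta> \<zeta> = \<eta>"
    show thesis
    proof (rule that[OF p_smooth(2,3)])
      show "v p13 = a1 p v \<and> v p23 = a2 p v" if "c p = 0" "v \<in> tangent_space (atlas M) p" for p v
        using br(2,3)[OF that(2)] that(1) L by (simp add: a1_def a2_def)
      show "p13 m = \<pi>H g (\<theta>\<^sub>1 g) (\<theta>\<^sub>3 g) \<and> p23 m = \<pi>H g (\<theta>\<^sub>2 g) (\<theta>\<^sub>3 g) \<longleftrightarrow> h1 g = p13 m \<and> h2 g = p23 m" for m g
        unfolding PH using L D by auto
    qed
  next
    assume L: "lie_bracket G \<xi> \<eta> = (\<lambda>f. 0) \<and> lie_bracket G \<xi> \<zeta> = \<eta> \<and> lie_bracket G \<eta> \<zeta> = (\<lambda>f. - \<xi> f)"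
    \<comment> \<open>For this bracket the pairing of the second and third forms on the group is
      minus the first coordinate, so that coordinate is recovered with a sign.\<close>
    have n: "(\<lambda>m. (-1) * p23 m) \<in> C\<^sub>M" by (intro smooth_scale p_smooth)
    show thesis
    proof (rule that[OF n p_smooth(2)])
      fix p v assume c: "c p = 0" and v: "v \<in> tangent_space (atlas M) p"
      have "v (\<lambda>m. (-1) * p23 m) = (-1) * v p23" by (rule tangent_space_scale_fun[OF v p_smooth(3)])
      then show "v (\<lambda>m. (-1) * p23 m) = a1 p v \<and> v p13 = a2 p v"
        using br(2,3)[OF v] c L \<alpha>_neg by (simp add: a2_def)
    next
      show "p13 m = \<pi>H g (\<theta>\<^sub>1 g) (\<theta>\<^sub>3 g) \<and> p23 m = \<pi>H g (\<theta>\<^sub>2 g) (\<theta>\<^sub>3 g) \<longleftrightarrow> h1 g = (-1) * p23 m \<and> h2 g = p13 m" for m g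
        unfolding PH using L D D_neg by auto
    qed
  qed

  \<comment> \<open>By linearity in \<open>\<kappa>\<close> the pull-back condition needs checking
    on the basis only, where it prescribes the differentials of the three components of
    \<open>\<mu>\<close>.\<close>
  have pull: "(\<forall>\<kappa>\<in>lie_algebra G. form_pull (atlas M) (atlas ?H) \<mu> (left_form ?H (D \<kappa>)) = \<alpha> \<kappa>) \<longleftrightarrow>
      (\<forall>p. \<forall>v\<in>tangent_space (atlas M) p. v (\<lambda>q. h1 (\<mu> q)) = a1 p v \<and> v (\<lambda>q. h2 (\<mu> q)) = a2 p v \<and>
        v (\<lambda>q. h3 (\<mu> q)) = a3 p v + h1 (\<mu> p) * a2 p v)" (is "?L \<longleftrightarrow> ?R")
    if \<mu>: "smooth_map (atlas M) euclidean_atlas \<mu>" for \<mu>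
  proof
    assume L: ?L
    show ?R
    proof (intro allI ballI)
      fix p v assume v: "v \<in> tangent_space (atlas M) p"
      have e: "\<alpha> \<kappa> p v = D \<kappa> heis_x * v (\<lambda>q. h1 (\<mu> q)) + D \<kappa> heis_y * v (\<lambda>q. h2 (\<mu> q))
          + D \<kappa> heis_z * (v (\<lambda>q. h3 (\<mu> q)) - h1 (\<mu> p) * v (\<lambda>q. h2 (\<mu> q)))" if "\<kappa> \<in> lie_algebra G" for \<kappa>
        using form_pull_heis[OF \<mu> cot[OF that] v, of \<pi>H] L that by simp
      show "v (\<lambda>q. h1 (\<mu> q)) = a1 p v \<and> v (\<lambda>q. h2 (\<mu> q)) = a2 p v \<and>
          v (\<lambda>q. h3 (\<mu> q)) = a3 p v + h1 (\<mu> p) * a2 p v"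
        using e[OF mem(1)] e[OF mem(2)] e[OF mem(3)] D by (simp add: a1_def a2_def a3_def)
    qed
  next
    assume R: ?R
    show ?L
    proof (intro ballI ext)
      fix \<kappa> p v assume \<kappa>: "\<kappa> \<in> lie_algebra G"
      show "form_pull (atlas M) (atlas ?H) \<mu> (left_form ?H (D \<kappa>)) p v = \<alpha> \<kappa> p v"
      proof (cases "v \<in> tangent_space (atlas M) p")
        case v: True
        have "\<alpha> \<kappa> p = \<alpha> (\<lambda>f. D \<kappa> heis_x * \<xi> f + D \<kappa> heis_y * \<eta> f + D \<kappa> heis_z * \<zeta> f) p"
          using dual_heis_decomposition[OF dual, OF mem, OF D, OF \<kappa>] by simp
        also have "\<dots> = (\<lambda>v. D \<kappa> heis_x * a1 p v + D \<kappa> heis_y * a2 p v + D \<kappa> heis_z * a3 p v)"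
          unfolding a1_def a2_def a3_def
          by (rule linear_fun_on_tangent_combination[OF IM(2)[unfolded lie_algebra_def] mem[unfolded lie_algebra_def]])
        finally show ?thesis
          using form_pull_heis[OF \<mu> cot[OF \<kappa>] v, of \<pi>H] R[rule_format, OF v] by simp
      next
        case False
        then show ?thesis using one_form_cotangent[OF IM(1)[OF \<kappa>], of p]
          by (simp add: form_pull_def cot_pull_def cotangent_space_def)
      qed
    qed
  qed

  \<comment> \<open>Once the pull-back condition holds, being Poisson is a pointwise condition. Its
    first equation reads \<open>c p = 0\<close>, because the pairing of the first two forms on the
    group vanishes; so any momentum map forces the constant to be 0.\<close>
  have MM: "\<mu> \<in> momentum_maps G H D M \<alpha> \<longleftrightarrow> smooth_map (atlas M) euclidean_atlas \<mu> \<and>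
      (\<forall>p. \<forall>v\<in>tangent_space (atlas M) p. v (\<lambda>q. h1 (\<mu> q)) = a1 p v \<and> v (\<lambda>q. h2 (\<mu> q)) = a2 p v \<and>
        v (\<lambda>q. h3 (\<mu> q)) = a3 p v + h1 (\<mu> p) * a2 p v) \<and>
      (\<forall>p. c p = 0 \<and> h1 (\<mu> p) = f1 p \<and> h2 (\<mu> p) = f2 p)" (is "_ \<longleftrightarrow> ?s \<and> ?d \<and> ?e") for \<mu>
  proof -
    have "\<mu> \<in> momentum_maps G H D M \<alpha> \<longleftrightarrow> ?s \<and> ?d \<and> poisson_map M ?H \<mu>"
      unfolding momentum_maps_def assms(9) using pull[of \<mu>] by (auto simp: poisson_map_def)
    moreover have "poisson_map M ?H \<mu> \<longleftrightarrow> ?e" if s: ?s and d: ?d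
    proof -
      have "poisson_map M ?H \<mu> \<longleftrightarrow> (\<forall>p. c p = \<pi>H (\<mu> p) (\<theta>\<^sub>1 (\<mu> p)) (\<theta>\<^sub>2 (\<mu> p))
          \<and> p13 p = \<pi>H (\<mu> p) (\<theta>\<^sub>1 (\<mu> p)) (\<theta>\<^sub>3 (\<mu> p)) \<and> p23 p = \<pi>H (\<mu> p) (\<theta>\<^sub>2 (\<mu> p)) (\<theta>\<^sub>3 (\<mu> p)))"
        unfolding c_def p13_def p23_def
        by (rule poisson_map_heis_iff[OF bvH s acot]; drule d[rule_format]) blast+
      then show ?thesis by (simp only: match PH(1))
    qed
    ultimately show ?thesis by blast
  qed

  show ?thesis
  \<comment> \<open>\<open>c\<close> is constant, so its value at the arbitrary point
    \<open>undefined\<close> serves as the witness.\<close>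
  proof (intro exI[of _ "c undefined"] conjI allI)
    show "\<pi> m (\<alpha> \<xi> m) (\<alpha> \<eta> m) = c undefined" for m
      using cc[of m undefined] by (simp add: c_def a1_def a2_def)
    \<comment> \<open>For vanishing \<open>c\<close> the prescribed differentials of the first two
      components follow from \<open>df\<close> once these components are \<open>f1\<close> and
      \<open>f2\<close>; this leaves the description that \<open>heis_lifts\<close> expects.\<close>
    have S: "\<mu> \<in> momentum_maps G H D M \<alpha> \<longleftrightarrow> smooth_map (atlas M) euclidean_atlas \<mu> \<and>
        (\<forall>p. h1 (\<mu> p) = f1 p \<and> h2 (\<mu> p) = f2 p) \<and>
        (\<forall>p. \<forall>v\<in>tangent_space (atlas M) p. v (\<lambda>q. h3 (\<mu> q)) = a3 p v + f1 p * a2 p v)"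
      if "c undefined = 0" for \<mu>
    proof -
      have "c p = 0" for p using cc[of p undefined] that by simp
      with df show ?thesis unfolding MM by auto
    qed
    have dfs: "v f1 = a1 p v" "v f2 = a2 p v" if "c undefined = 0" "v \<in> tangent_space (atlas M) p" for p v
      using df[of p v] cc[of p undefined] that by simp_all
    have lifts: "momentum_maps G H D M \<alpha> \<noteq> {}"
      "\<exists>\<sigma>. simply_transitive_real_action M ?H (momentum_maps G H D M \<alpha>) \<sigma>" if c0: "c undefined = 0"
      by (rule heis_lifts[OF sc con f a dfs[OF c0] closed(2) d3 S[OF c0]]; assumption)+
    show "momentum_maps G H D M \<alpha> \<noteq> {} \<longleftrightarrow> c undefined = 0"
      using lifts(1) MM by blast
    show "c undefined = 0 \<longrightarrow> (\<exists>\<sigma>. simply_transitive_real_action M H (momentum_maps G H D M \<alpha>) \<sigma>)"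
      using lifts(2) unfolding assms(9) by blast
  qed
qed

end
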